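(* Let $m,n\ge1$ be integers. The commuting actions of $\mathcal H_m^{\mathrm{hf}}$ (from the left) and of $\mathbb H_n(\mathrm B)$ (from the right) on $\mathbb V_m^{\otimes n}$ are each other's centralizers; i.e. in $\operatorname{End}_{\mathbb Q(q)}(\mathbb V_m^{\otimes n})$ the image of $\mathcal H_m^{\mathrm{hf}}$ is the commutant of the image of $\mathbb H_n(\mathrm B)$ and vice versa.
   Context: The ground field is $\mathbb Q(q)$. $\mathcal U_q(\mathfrak{gl}_{2m})$: generators $E_i,F_i$ ($i\in\mathbb Z$, $|i|\le m-1$), $D_j^{\pm1}$ ($j\in\mathbb Z+\frac12$, $|j|\le m-\frac12$), with $K_i=D_{i-1/2}D_{i+1/2}^{-1}$ and the standard relations ($D_jE_iD_j^{-1}=q^{\delta_{j,i-1/2}-\delta_{j,i+1/2}}E_i$, $D_jF_iD_j^{-1}=q^{\delta_{j,i+1/2}-\delta_{j,i-1/2}}F_i$, $[E_i,F_{i'}]=\delta_{ii'}(K_i-K_i^{-1})/(q-q^{-1})$, quantum Serre relations); comultiplication $\Delta(E_i)=K_i\otimes E_i+E_i\otimes1$, $\Delta(F_i)=F_i\otimes K_i^{-1}+1\otimes F_i$, $\Delta(D_j)=D_j\otimes D_j$. The natural representation $\mathbb V_m$ has basis $v_l$, $l\in\{\pm\frac12,\dots,\pm(m-\frac12)\}$, with $E_iv_l=\delta_{i+1/2,l}v_{l-1}$, $F_iv_l=\delta_{i-1/2,l}v_{l+1}$, $D_jv_l=q^{\delta_{jl}}v_l$. $\mathcal H_m^{\mathrm{hf}}\subset\mathcal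 U_q(\mathfrak{gl}_{2m})$ is the (right coideal) subalgebra generated by all $(D_jD_{-j})^{\pm1}$ and $B_i=E_iK_{-i}^{-1}+F_{-i}$ for $0<|i|\le m-1$, $B_0=q^{-1}E_0K_0^{-1}+F_0$; it acts on $\mathbb V_m^{\otimes n}$ by restriction. $\mathbb H_n(\mathrm B)$ is the unital $\mathbb Q(q)$-algebra with generators $H_0,\dots,H_{n-1}$ and relations $H_0^2=1$, $H_i^2=1+(q^{-1}-q)H_i$ for $i\ge1$, the type $A$ braid relations among $H_1,\dots,H_{n-1}$, $H_0H_1H_0H_1=H_1H_0H_1H_0$, and $H_0H_i=H_iH_0$ for $i>1$. Its right action on $\mathbb V_m^{\otimes n}$: for $1\le i\le n-1$, $H_i$ acts on the tensor factors $i,i+1$ by $(v_a\otimes v_b).H_i=v_b\otimes v_a$ if $a<b$; $=v_b\otimes v_a+(q^{-1}-q)v_a\otimes v_b$ if $a>b$; $=q^{-1}v_b\otimes v_a$ if $a=b$; and $H_0$ acts on the first tensor factor by $v_a\mapsto v_{-a}$. *)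

theory Defs
  imports
    "HOL-Library.Poly_Mapping"
    "HOL-Library.Product_Plus"
    "HOL-Library.FuncSet"
    "HOL-Computational_Algebra.Polynomial"
    "HOL-Computational_Algebra.Fraction_Field"
    "HOL-Algebra.QuotRing"
    "HOL-Algebra.Generated_Rings"
begin

section \<open>The ground field\<close>

type_synonym qfield = "rat poly fract"

definition q :: qfield where
  "q = Fract [:0, 1:] 1"


section \<open>Free algebras and algebras given by generators and relations\<close>

datatype 'g word = Word (letters: "'g list")

instantiation word :: (type) monoid_add
begin
definition "0 = Word []"
definition "u + w = Word (letters u @ letters w)"
instance by standard (simp_all add: zero_word_def plus_word_def)
end

text \<open>The product on the type below comes from its instance of \<^class>\<open>ring_1\<close>: it is the
  convolution product for concatenation of words.\<close>

type_synonym 'g falg = "'g word \<Rightarrow>\<^sub>0 qfield"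

abbreviation scalar :: "qfield \<Rightarrow> 'b::monoid_add \<Rightarrow>\<^sub>0 qfield" where
  "scalar c \<equiv> Poly_Mapping.single 0 c"

abbreviation gen :: "'g \<Rightarrow> 'g falg" where
  "gen x \<equiv> Poly_Mapping.single (Word [x]) 1"

definition free_alg :: "'g set \<Rightarrow> 'g falg ring" where
  "free_alg G =
     \<lparr>carrier = {p. \<forall>w\<in>Poly_Mapping.keys p. set (letters w) \<subseteq> G},
      mult = (*), one = 1, zero = 0, add = (+)\<rparr>"

lemma keys_mult_words:
  "w \<in> Poly_Mapping.keys ((a::'g falg) * b) \<Longrightarrow>
   \<exists>u\<in>Poly_Mapping.keys a. \<exists>v\<in>Poly_Mapping.keys b. w = u + v"
  using keys_mult[of a b] by blast

lemma free_alg_mult: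
  "a \<in> carrier (free_alg G) \<Longrightarrow> b \<in> carrier (free_alg G) \<Longrightarrow> a * b \<in> carrier (free_alg G)"
  unfolding free_alg_def by (fastforce dest!: keys_mult_words simp: plus_word_def)

lemma free_alg_add:
  "a \<in> carrier (free_alg G) \<Longrightarrow> b \<in> carrier (free_alg G) \<Longrightarrow> a + b \<in> carrier (free_alg G)"
  unfolding free_alg_def using Poly_Mapping.keys_add[of a b] by auto

lemma free_alg_diff:
  "a \<in> carrier (free_alg G) \<Longrightarrow> b \<in> carrier (free_alg G) \<Longrightarrow> a - b \<in> carrier (free_alg G)"
  unfolding free_alg_def using keys_diff[of a b] by auto

lemma free_alg_scalar: "scalar c \<in> carrier (free_alg G)"
  unfolding free_alg_def by (auto simp: zero_word_def)

lemma free_alg_consts: "0 \<in> carrier (free_alg G)" "1 \<in> carrier (free_alg G)"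
  unfolding free_alg_def by (auto simp: zero_word_def)

lemma free_alg_gen: "gen x \<in> carrier (free_alg G) \<longleftrightarrow> x \<in> G"
  unfolding free_alg_def by auto

lemmas free_alg_closed = free_alg_mult free_alg_add free_alg_diff free_alg_scalar free_alg_consts

lemma free_alg_simps [simp]:
  "x \<otimes>\<^bsub>free_alg G\<^esub> y = x * y" "x \<oplus>\<^bsub>free_alg G\<^esub> y = x + y"
  "\<one>\<^bsub>free_alg G\<^esub> = 1" "\<zero>\<^bsub>free_alg G\<^esub> = 0"
  by (simp_all add: free_alg_def)

lemma free_alg_ring: "ring (free_alg G)"
proof (rule ringI)
  show "abelian_group (free_alg G)"
  proof (rule abelian_groupI)
    fix x assume "x \<in> carrier (free_alg G)"
    then have "- x \<in> carrier (free_alg G)" by (simp add: free_alg_def)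
    then show "\<exists>y\<in>carrier (free_alg G). y \<oplus>\<^bsub>free_alg G\<^esub> x = \<zero>\<^bsub>free_alg G\<^esub>"
      by (intro bexI[of _ "- x"]) simp_all
  qed (simp_all add: free_alg_add free_alg_consts add_ac)
  show "Group.monoid (free_alg G)"
    by (rule monoidI) (simp_all add: free_alg_mult free_alg_consts mult.assoc)
qed (simp_all add: distrib_left distrib_right)

definition pres_alg :: "'g set \<Rightarrow> 'g falg set \<Rightarrow> 'g falg set ring" where
  "pres_alg G R = free_alg G Quot (Idl\<^bsub>free_alg G\<^esub> R)"

definition cls :: "'g set \<Rightarrow> 'g falg set \<Rightarrow> 'g falg \<Rightarrow> 'g falg set" where
  "cls G R p = (Idl\<^bsub>free_alg G\<^esub> R) +>\<^bsub>free_alg G\<^esub> p"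

definition alg_lift :: "('g \<Rightarrow> ('b::monoid_add \<Rightarrow>\<^sub>0 qfield)) \<Rightarrow> 'g falg \<Rightarrow> ('b \<Rightarrow>\<^sub>0 qfield)" where
  "alg_lift h p =
     (\<Sum>w\<in>Poly_Mapping.keys p. scalar (Poly_Mapping.lookup p w) * prod_list (map h (letters w)))"


section \<open>The tensor space\<close>

text \<open>Half-integers are encoded by their doubles: \<open>l \<in> \<int> + 1/2\<close> is the odd integer \<open>2 * l\<close>.\<close>

definition halfs :: "nat \<Rightarrow> int set" where
  "halfs m = {l. odd l \<and> \<bar>l\<bar> \<le> 2 * int m - 1}"

text \<open>The \<open>n\<close>-th tensor power of the natural representation is the degree \<open>n\<close> component of its
  tensor algebra, i.e. of the free algebra on the basis vectors \<open>v_l\<close>. The word \<open>[l_1, ..., l_n]\<close>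
  stands for \<open>v_(l_1) \<otimes> ... \<otimes> v_(l_n)\<close>, the tensor product of vectors is \<open>*\<close>, and multiplication
  by \<open>scalar c\<close> is multiplication by the scalar \<open>c\<close>.\<close>

definition tens :: "nat \<Rightarrow> nat \<Rightarrow> int falg set" where
  "tens m n = {v. \<forall>w\<in>Poly_Mapping.keys v. length (letters w) = n \<and> set (letters w) \<subseteq> halfs m}"

definition lin_ext :: "(int list \<Rightarrow> int falg) \<Rightarrow> int falg \<Rightarrow> int falg" where
  "lin_ext f v =
     (\<Sum>w\<in>Poly_Mapping.keys v. scalar (Poly_Mapping.lookup v w) * f (letters w))"

definition endos :: "nat \<Rightarrow> nat \<Rightarrow> (int falg \<Rightarrow> int falg) set" where
  "endos m n = {T \<in> tens m n \<rightarrow>\<^sub>E tens m n.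
     (\<forall>v\<in>tens m n. \<forall>w\<in>tens m n. T (v + w) = T v + T w) \<and>
     (\<forall>c. \<forall>v\<in>tens m n. T (scalar c * v) = scalar c * T v)}"

definition commutant ::
    "nat \<Rightarrow> nat \<Rightarrow> (int falg \<Rightarrow> int falg) set \<Rightarrow> (int falg \<Rightarrow> int falg) set" where
  "commutant m n A = {T \<in> endos m n. \<forall>S\<in>A. \<forall>v\<in>tens m n. T (S v) = S (T v)}"


section \<open>The quantum group of \<open>gl_(2m)\<close>\<close>

datatype ugen = GE int | GF int | GD int | GDinv int

definition ugens :: "nat \<Rightarrow> ugen set" where
  "ugens m = GE ` {i. \<bar>i\<bar> \<le> int m - 1} \<union> GF ` {i. \<bar>i\<bar> \<le> int m - 1}
           \<union> GD ` halfs m \<union> GDinv ` halfs m"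

abbreviation E :: "int \<Rightarrow> ugen falg" where "E i \<equiv> gen (GE i)"
abbreviation F :: "int \<Rightarrow> ugen falg" where "F i \<equiv> gen (GF i)"
abbreviation D :: "int \<Rightarrow> ugen falg" where "D j \<equiv> gen (GD j)"
abbreviation Dinv :: "int \<Rightarrow> ugen falg" where "Dinv j \<equiv> gen (GDinv j)"

definition K :: "int \<Rightarrow> ugen falg" where "K i = D (2 * i - 1) * Dinv (2 * i + 1)"
definition Kinv :: "int \<Rightarrow> ugen falg" where "Kinv i = D (2 * i + 1) * Dinv (2 * i - 1)"

text \<open>In \<^term>\<open>GD j\<close> the index \<open>j\<close> is doubled, in \<^term>\<open>GE i\<close> and \<^term>\<open>GF i\<close> the index \<open>i\<close> is not.
  Each element of the following set is a relation \<open>lhs - rhs\<close>.\<close>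

definition uq_rels :: "nat \<Rightarrow> ugen falg set" where
  "uq_rels m =
     {D j * Dinv j - 1 | j. j \<in> halfs m} \<union>
     {Dinv j * D j - 1 | j. j \<in> halfs m} \<union>
     {D j * D k - D k * D j | j k. j \<in> halfs m \<and> k \<in> halfs m} \<union>
     {D j * E i * Dinv j
        - scalar (q powi (of_bool (j = 2 * i - 1) - of_bool (j = 2 * i + 1))) * E i
      | i j. \<bar>i\<bar> \<le> int m - 1 \<and> j \<in> halfs m} \<union>
     {D j * F i * Dinv j
        - scalar (q powi (of_bool (j = 2 * i + 1) - of_bool (j = 2 * i - 1))) * F i
      | i j. \<bar>i\<bar> \<le> int m - 1 \<and> j \<in> halfs m} \<union>
     {E i * F k - F k * E i
        - (if i = k then scalar (inverse (q - inverse q)) * (K i - Kinv i) else 0)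
      | i k. \<bar>i\<bar> \<le> int m - 1 \<and> \<bar>k\<bar> \<le> int m - 1} \<union>
     {E i * E k - E k * E i
      | i k. \<bar>i\<bar> \<le> int m - 1 \<and> \<bar>k\<bar> \<le> int m - 1 \<and> \<bar>i - k\<bar> > 1} \<union>
     {F i * F k - F k * F i
      | i k. \<bar>i\<bar> \<le> int m - 1 \<and> \<bar>k\<bar> \<le> int m - 1 \<and> \<bar>i - k\<bar> > 1} \<union>
     {E i * E i * E k - scalar (q + inverse q) * E i * E k * E i + E k * E i * E i
      | i k. \<bar>i\<bar> \<le> int m - 1 \<and> \<bar>k\<bar> \<le> int m - 1 \<and> \<bar>i - k\<bar> = 1} \<union>
     {F i * F i * F k - scalar (q + inverse q) * F i * F k * F i + F k * F i * F i
      | i k. \<bar>i\<bar> \<le> int m - 1 \<and> \<bar>k\<bar> \<le> int m - 1 \<and> \<bar>i - k\<bar> = 1}"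

text \<open>The generated ideal is meaningful only for relations inside the carrier.\<close>

lemma half_neighbours: "\<bar>i\<bar> \<le> int m - 1 \<Longrightarrow> 2 * i - 1 \<in> halfs m \<and> 2 * i + 1 \<in> halfs m"
  by (auto simp: halfs_def)

lemma ugens_iff:
  "GE i \<in> ugens m \<longleftrightarrow> \<bar>i\<bar> \<le> int m - 1"
  "GF i \<in> ugens m \<longleftrightarrow> \<bar>i\<bar> \<le> int m - 1"
  "GD j \<in> ugens m \<longleftrightarrow> j \<in> halfs m"
  "GDinv j \<in> ugens m \<longleftrightarrow> j \<in> halfs m"
  by (auto simp: ugens_def)

lemma uq_rels_carrier: "uq_rels m \<subseteq> carrier (free_alg (ugens m))"
proof -
  have K: "K i \<in> carrier (free_alg (ugens m))" "Kinv i \<in> carrier (free_alg (ugens m))"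
    if "\<bar>i\<bar> \<le> int m - 1" for i
    using half_neighbours[OF that]
    by (auto simp: K_def Kinv_def ugens_iff free_alg_gen intro!: free_alg_closed)
  show ?thesis
    unfolding uq_rels_def
    by (auto simp: ugens_iff free_alg_gen split: if_splits intro!: free_alg_closed K)
qed

definition Uq :: "nat \<Rightarrow> ugen falg set ring" where
  "Uq m = pres_alg (ugens m) (uq_rels m)"

definition B :: "int \<Rightarrow> ugen falg" where
  "B i = (if i = 0 then scalar (inverse q) * E 0 * Kinv 0 + F 0 else E i * Kinv (- i) + F (- i))"

text \<open>A subalgebra is a subring that contains the scalars.\<close>

definition Hhf :: "nat \<Rightarrow> ugen falg set set" where
  "Hhf m = generate_ring (Uq m) (cls (ugens m) (uq_rels m) `
     (range scalar \<union>
      {D j * D (- j) | j. j \<in> halfs m} \<union> {Dinv (- j) * Dinv j | j. j \<in> halfs m} \<union>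
      {B i | i. \<bar>i\<bar> \<le> int m - 1}))"


subsection \<open>Its action on the tensor space\<close>

primrec nat_rep_gen :: "ugen \<Rightarrow> int \<Rightarrow> int falg" where
  "nat_rep_gen (GE i) l = (if l = 2 * i + 1 then gen (l - 2) else 0)"
| "nat_rep_gen (GF i) l = (if l = 2 * i - 1 then gen (l + 2) else 0)"
| "nat_rep_gen (GD j) l = scalar (if j = l then q else 1) * gen l"
| "nat_rep_gen (GDinv j) l = scalar (if j = l then inverse q else 1) * gen l"

definition nat_rep :: "ugen falg \<Rightarrow> int falg \<Rightarrow> int falg" where
  "nat_rep p v =
     (\<Sum>w\<in>Poly_Mapping.keys p. scalar (Poly_Mapping.lookup p w) *
        foldr (\<lambda>x. lin_ext (\<lambda>ls. nat_rep_gen x (hd ls))) (letters w) v)"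

text \<open>The tensor square of the free algebra is the algebra of the monoid of pairs of words.\<close>

type_synonym 'g falg2 = "('g word \<times> 'g word) \<Rightarrow>\<^sub>0 qfield"

definition tensor2 :: "'g falg \<Rightarrow> 'g falg \<Rightarrow> 'g falg2" where
  "tensor2 a b = (\<Sum>u\<in>Poly_Mapping.keys a. \<Sum>w\<in>Poly_Mapping.keys b.
     Poly_Mapping.single (u, w) (Poly_Mapping.lookup a u * Poly_Mapping.lookup b w))"

primrec comult_gen :: "ugen \<Rightarrow> ugen falg2" where
  "comult_gen (GE i) = tensor2 (K i) (E i) + tensor2 (E i) 1"
| "comult_gen (GF i) = tensor2 (F i) (Kinv i) + tensor2 1 (F i)"
| "comult_gen (GD j) = tensor2 (D j) (D j)"
| "comult_gen (GDinv j) = tensor2 (Dinv j) (Dinv j)"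

definition comult :: "ugen falg \<Rightarrow> ugen falg2" where
  "comult = alg_lift comult_gen"

text \<open>The action on tensor powers \<open>V \<otimes> V^(\<otimes>(n+1))\<close> through the comultiplication. Only exponents
  \<open>n \<ge> 1\<close> occur; the value for \<open>n = 0\<close> is left unspecified.\<close>

fun tens_rep :: "nat \<Rightarrow> ugen falg \<Rightarrow> int falg \<Rightarrow> int falg" where
  "tens_rep (Suc 0) p v = nat_rep p v"
| "tens_rep (Suc (Suc n)) p v =
     lin_ext (\<lambda>ls. \<Sum>(x, y)\<in>Poly_Mapping.keys (comult p).
        scalar (Poly_Mapping.lookup (comult p) (x, y)) *
        (nat_rep (Poly_Mapping.single x 1) (gen (hd ls)) *
         tens_rep (Suc n) (Poly_Mapping.single y 1) (Poly_Mapping.single (Word (tl ls)) 1))) v"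

text \<open>An element of a presented algebra is a coset of the ideal of relations. All elements of a
  coset act by the same operator, and that operator is picked by \<^const>\<open>the_elem\<close>.\<close>

definition Uq_act :: "nat \<Rightarrow> nat \<Rightarrow> ugen falg set \<Rightarrow> int falg \<Rightarrow> int falg" where
  "Uq_act m n X = the_elem ((\<lambda>p. restrict (tens_rep n p) (tens m n)) ` X)"


section \<open>The Hecke algebra of type B\<close>

definition hecke_gens :: "nat \<Rightarrow> nat set" where
  "hecke_gens n = {..<n}"

abbreviation H :: "nat \<Rightarrow> nat falg" where "H i \<equiv> gen i"

definition hecke_rels :: "nat \<Rightarrow> nat falg set" where
  "hecke_rels n =
     {H 0 * H 0 - 1} \<union>
     {H i * H i - (1 + scalar (inverse q - q) * H i) | i. 1 \<le> i \<and> i < n} \<union>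
     {H i * H (i + 1) * H i - H (i + 1) * H i * H (i + 1) | i. 1 \<le> i \<and> i + 1 < n} \<union>
     {H i * H j - H j * H i | i j. 1 \<le> i \<and> i + 1 < j \<and> j < n} \<union>
     (if 1 < n then {H 0 * H 1 * H 0 * H 1 - H 1 * H 0 * H 1 * H 0} else {}) \<union>
     {H 0 * H i - H i * H 0 | i. 1 < i \<and> i < n}"

lemma hecke_rels_carrier: "n \<ge> 1 \<Longrightarrow> hecke_rels n \<subseteq> carrier (free_alg (hecke_gens n))"
  unfolding hecke_rels_def
  by (auto simp: hecke_gens_def free_alg_gen split: if_splits intro!: free_alg_closed)

definition Hecke :: "nat \<Rightarrow> nat falg set ring" where
  "Hecke n = pres_alg (hecke_gens n) (hecke_rels n)"

definition hecke_rep_gen :: "nat \<Rightarrow> int list \<Rightarrow> int falg" where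
  "hecke_rep_gen i ls =
     (if i = 0 then Poly_Mapping.single (Word (ls[0 := - (ls ! 0)])) 1
      else let a = ls ! (i - 1); b = ls ! i;
               v = Poly_Mapping.single (Word ls) 1;
               v' = Poly_Mapping.single (Word (ls[i - 1 := b, i := a])) 1
           in if a < b then v'
              else if a > b then v' + scalar (inverse q - q) * v
              else scalar (inverse q) * v')"

text \<open>For this right action the first letter of a word acts first.\<close>

definition hecke_rep :: "nat falg \<Rightarrow> int falg \<Rightarrow> int falg" where
  "hecke_rep p v =
     (\<Sum>w\<in>Poly_Mapping.keys p. scalar (Poly_Mapping.lookup p w) *
        fold (\<lambda>i. lin_ext (hecke_rep_gen i)) (letters w) v)"

definition Hecke_act :: "nat \<Rightarrow> nat \<Rightarrow> nat falg set \<Rightarrow> int falg \<Rightarrow> int falg" where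
  "Hecke_act m n X = the_elem ((\<lambda>p. restrict (hecke_rep p) (tens m n)) ` X)"

end

theory Submission
  imports Defs "HOL-Combinatorics.Permutations"
begin

text \<open>
  The two actions commute; this is checked on words, letter by letter, after the action through the
  comultiplication has been identified with a twisted Leibniz rule. The converse inclusions come from
  specialization at \<open>q = 1\<close>: a \<open>\<rat>(q)\<close>-subspace of matrices is determined, inside a larger subspace,
  by the values at \<open>q = 1\<close> of its members that are regular there. Hence it suffices to bound the
  specialized commutants.

  At \<open>q = 1\<close> the Hecke algebra contains the permutation operators of the hyperoctahedral group \<open>G\<close>,
  and the coideal subalgebra contains the derivations of the tensor space induced by the matrices
  \<open>E\<^sub>a\<^sub>b + E\<^sub>-\<^sub>a\<^sub>,\<^sub>-\<^sub>b\<close>; the diagonal ones come from \<open>(D\<^sub>j D\<^sub>-\<^sub>j - 1) / (q - 1)\<close> and the others are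
  commutators of specialized generators. Multiplying partially symmetrized tensors by such derivations
  shows that these generate all fully symmetrized tensors, that is, all \<open>G\<close>-invariant operators.
  So the specialized commutant of the Hecke algebra lies in the specialization of the coideal
  subalgebra. An operator that commutes with all \<open>G\<close>-invariant operators is a combination of elements
  of \<open>G\<close>, which settles the other inclusion.
\<close>

section \<open>Linear maps between monoid algebras\<close>

text \<open>Why values at \<open>q = 1\<close> suffice: for one of the two pairs, let the smaller
  space be the image of one algebra and the larger one the commutant of the other. If each regular
  member of the larger space agrees at \<open>q = 1\<close> with a regular member of the smaller
  one, their difference is \<open>q - 1\<close> times a regular member of the larger space, and the
  step can be repeated. A functional that vanishes on the smaller space therefore takes values
  divisible by every power of \<open>q - 1\<close>, that is, zero. What gets specialized is the
  whole space of operators over \<open>qfield\<close>, not a list of generators: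
  \<open>D j * D (- j)\<close> degenerates to the identity, and its content survives only to first
  order in \<open>q - 1\<close>. Rational coefficients serve twice at \<open>q = 1\<close>: the
  invariant matrices are halved sums of signed matrix units, and a vanishing sum of squares has
  vanishing terms, which drives the double commutant argument. Kernels carry the input word as row
  and the output word as column, so composition of operators reverses the order of kernels.\<close>

definition sm :: "qfield \<Rightarrow> ('b::monoid_add \<Rightarrow>\<^sub>0 qfield) \<Rightarrow> ('b \<Rightarrow>\<^sub>0 qfield)" where
  "sm c v = scalar c * v"

abbreviation bas :: "'b \<Rightarrow> ('b \<Rightarrow>\<^sub>0 qfield)" where
  "bas k \<equiv> Poly_Mapping.single k 1"

abbreviation wd :: "'g list \<Rightarrow> 'g falg" where
  "wd w \<equiv> bas (Word w)"

lemma lookup_sm [simp]: "Poly_Mapping.lookup (sm c v) w = c * Poly_Mapping.lookup v w"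
proof -
  have "sm c v = Poly_Mapping.map ((*) c) v"
    by (simp add: sm_def mult_map_scale_conv_mult)
  then show ?thesis by (simp add: map.rep_eq when_def)
qed

lemma keys_sm: "Poly_Mapping.keys (sm c v) \<subseteq> Poly_Mapping.keys v"
  by (auto simp: in_keys_iff)

lemma sm_add_right: "sm c (v + w) = sm c v + sm c w"
  by (simp add: sm_def distrib_left)
lemma sm_diff_right: "sm c (v - w) = sm c v - sm c w"
  by (simp add: sm_def right_diff_distrib)
lemma sm_add_left: "sm (c + d) v = sm c v + sm d v"
  by (simp add: sm_def single_add distrib_right)
lemma sm_sm [simp]: "sm c (sm d v) = sm (c * d) v"
  by (simp add: sm_def mult_single flip: mult.assoc)
lemma sm_zero [simp]: "sm c 0 = 0" "sm 0 v = 0"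
  by (simp_all add: sm_def)
lemma sm_one [simp]: "sm 1 v = v"
  by (simp add: sm_def)
lemma sm_minus [simp]: "sm c (- v) = - sm c v"
  by (simp add: sm_def)
lemma sm_sum: "sm c (\<Sum>i\<in>I. f i) = (\<Sum>i\<in>I. sm c (f i))"
  by (simp add: sm_def sum_distrib_left)
lemma sm_bas: "sm c (bas k) = Poly_Mapping.single k c"
  by (simp add: sm_def mult_single)
lemma sm_mult_left [simp]: "sm c v * w = sm c (v * w)"
  by (simp add: sm_def mult.assoc)
lemma bas_decomp: "v = (\<Sum>k\<in>Poly_Mapping.keys v. sm (Poly_Mapping.lookup v k) (bas k))"
  by (rule poly_mapping_eqI) (simp add: lookup_sum lookup_single when_def in_keys_iff if_distrib cong: if_cong)

lemma scalar_central: "v * scalar c = scalar c * v"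
proof -
  let ?s = "\<Sum>k\<in>Poly_Mapping.keys v. Poly_Mapping.single k (Poly_Mapping.lookup v k)"
  have "v = ?s" using bas_decomp[of v] by (simp add: sm_bas)
  moreover have "?s * scalar c = scalar c * ?s"
    by (simp add: sum_distrib_left sum_distrib_right mult_single mult.commute)
  ultimately show ?thesis by metis
qed

lemma sm_mult_right [simp]: "w * sm c v = sm c (w * v)"
  by (simp only: sm_def scalar_central[of w c] flip: mult.assoc)

text \<open>Linearity on the whole monoid algebra, in all degrees at once: identities can be checked
  on basis words without side conditions. Restriction to \<open>tens m n\<close> enters only with
  \<open>endos\<close>.\<close>

definition lin :: "(('a::monoid_add \<Rightarrow>\<^sub>0 qfield) \<Rightarrow> ('b::monoid_add \<Rightarrow>\<^sub>0 qfield)) \<Rightarrow> bool" where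
  "lin T \<longleftrightarrow> (\<forall>v w. T (v + w) = T v + T w) \<and> (\<forall>c v. T (sm c v) = sm c (T v))"

lemma linI: "(\<And>v w. T (v + w) = T v + T w) \<Longrightarrow> (\<And>c v. T (sm c v) = sm c (T v)) \<Longrightarrow> lin T"
  by (simp add: lin_def)
lemma lin_add: "lin T \<Longrightarrow> T (v + w) = T v + T w" by (simp add: lin_def)
lemma lin_sm: "lin T \<Longrightarrow> T (sm c v) = sm c (T v)" by (simp add: lin_def)
lemma lin_0: "lin T \<Longrightarrow> T 0 = 0" using lin_sm[of T 0 0] by simp
lemma lin_uminus: "lin T \<Longrightarrow> T (- v) = - T v"
  using lin_add[of T v "- v"] lin_0[of T] by (simp add: eq_neg_iff_add_eq_0 add.commute)
lemma lin_diff: "lin T \<Longrightarrow> T (v - w) = T v - T w"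
  using lin_add[of T v "- w"] lin_uminus[of T w] by simp
lemma lin_sum: "lin T \<Longrightarrow> T (\<Sum>i\<in>I. f i) = (\<Sum>i\<in>I. T (f i))"
  by (induction I rule: infinite_finite_induct) (simp_all add: lin_0 lin_add)
lemmas lin_rules = lin_add lin_sm lin_0 lin_diff lin_uminus

lemma lin_expand:
  "lin T \<Longrightarrow> T v = (\<Sum>k\<in>Poly_Mapping.keys v. sm (Poly_Mapping.lookup v k) (T (bas k)))"
  by (subst bas_decomp[of v]) (simp add: lin_sum lin_sm)

lemma lin_eq_on:
  assumes "lin S" "lin T" and "\<And>k. k \<in> Poly_Mapping.keys v \<Longrightarrow> S (bas k) = T (bas k)"
  shows "S v = T v"
  using assms by (simp add: lin_expand[of S v] lin_expand[of T v])

lemma lin_eq: "lin S \<Longrightarrow> lin T \<Longrightarrow> (\<And>k. S (bas k) = T (bas k)) \<Longrightarrow> S v = T v"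
  by (rule lin_eq_on)

lemma lin_id: "lin (\<lambda>v. v)" by (simp add: lin_def)
lemma lin_zero: "lin (\<lambda>v. 0)" by (simp add: lin_def)
lemma lin_comp: "lin S \<Longrightarrow> lin T \<Longrightarrow> lin (\<lambda>v. S (T v))" by (simp add: lin_def)
lemma lin_plus: "lin S \<Longrightarrow> lin T \<Longrightarrow> lin (\<lambda>v. S v + T v)"
  by (simp add: lin_def sm_add_right algebra_simps)
lemma lin_minus: "lin S \<Longrightarrow> lin T \<Longrightarrow> lin (\<lambda>v. S v - T v)"
  by (simp add: lin_def sm_diff_right algebra_simps)
lemma lin_smc: "lin S \<Longrightarrow> lin (\<lambda>v. sm c (S v))"
  by (simp add: lin_def sm_add_right mult.commute)
lemma lin_multl: "lin S \<Longrightarrow> lin (\<lambda>v. a * S v)"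
  by (simp add: lin_def distrib_left)
lemma lin_multr: "lin S \<Longrightarrow> lin (\<lambda>v. S v * a)"
  by (simp add: lin_def distrib_right)
lemma lin_if: "(P \<Longrightarrow> lin S) \<Longrightarrow> (\<not> P \<Longrightarrow> lin T) \<Longrightarrow> lin (\<lambda>v. if P then S v else T v)"
  by (cases P) auto
lemma lin_sumf: "(\<And>i. i \<in> I \<Longrightarrow> lin (f i)) \<Longrightarrow> lin (\<lambda>v. \<Sum>i\<in>I. f i v)"
  by (induction I rule: infinite_finite_induct) (auto intro: lin_zero lin_plus)

definition lext :: "('a \<Rightarrow> ('b::monoid_add \<Rightarrow>\<^sub>0 qfield)) \<Rightarrow> ('a \<Rightarrow>\<^sub>0 qfield) \<Rightarrow> ('b \<Rightarrow>\<^sub>0 qfield)" where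
  "lext f v = (\<Sum>k\<in>Poly_Mapping.keys v. sm (Poly_Mapping.lookup v k) (f k))"

lemma lext_superset:
  "finite S \<Longrightarrow> Poly_Mapping.keys v \<subseteq> S \<Longrightarrow> lext f v = (\<Sum>k\<in>S. sm (Poly_Mapping.lookup v k) (f k))"
  unfolding lext_def by (rule sum.mono_neutral_left) (auto simp: in_keys_iff)

lemma lin_lext [simp]: "lin (lext f)"
proof (rule linI)
  fix v w :: "'a::monoid_add \<Rightarrow>\<^sub>0 qfield" and c
  let ?S = "Poly_Mapping.keys v \<union> Poly_Mapping.keys w"
  show "lext f (v + w) = lext f v + lext f w"
    using lext_superset[of ?S v f] lext_superset[of ?S w f]
      lext_superset[of ?S "v + w" f] keys_add[of v w]
    by (simp add: lookup_add sm_add_left sum.distrib)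
  show "lext f (sm c v) = sm c (lext f v)"
    using lext_superset[of "Poly_Mapping.keys v" "sm c v" f] keys_sm[of c v]
    by (simp add: lext_def sm_sum)
qed

lemma lext_bas [simp]: "lext f (bas k) = f k"
  by (simp add: lext_def)

lemma lext_single [simp]: "lext f (Poly_Mapping.single k c) = sm c (f k)"
  by (simp add: lext_def)

lemma lin_lext_fun: "(\<And>k. lin (\<lambda>v. f k v)) \<Longrightarrow> lin (\<lambda>v. lext (\<lambda>k. f k v) p)"
  unfolding lext_def by (intro lin_sumf lin_smc)

lemma lext_cong: "(\<And>k. k \<in> Poly_Mapping.keys v \<Longrightarrow> f k = g k) \<Longrightarrow> lext f v = lext g v"
  by (simp add: lext_def)

lemmas lin_intros = lin_id lin_zero lin_plus lin_minus lin_smc lin_multl lin_multr lin_if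

lemma lin_ext_lext: "lin_ext f = lext (\<lambda>w. f (letters w))"
  by (rule ext) (simp add: lin_ext_def lext_def sm_def)

lemma bas_mult: "bas j * bas k = bas (j + k)"
  by (simp add: mult_single)
lemma wd_mult: "wd u * wd v = wd (u @ v)"
  by (simp add: mult_single plus_word_def)
lemma wd_Nil: "wd [] = 1"
  by (metis single_one zero_word_def)
lemma gen_wd: "gen l * wd w = wd (l # w)"
  by (simp add: mult_single plus_word_def)

section \<open>Modules over a free algebra, generator by generator\<close>

definition act :: "('g \<Rightarrow> 'h falg \<Rightarrow> 'h falg) \<Rightarrow> 'g falg \<Rightarrow> 'h falg \<Rightarrow> 'h falg" where
  "act A p v = lext (\<lambda>w. foldr A (letters w) v) p"

lemma lin_foldr: "(\<And>x. lin (A x)) \<Longrightarrow> lin (foldr A ws)"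
  by (induction ws) (auto simp: lin_def)

lemma lin_act1: "lin (\<lambda>p. act A p v)"
  by (simp add: act_def)
lemma lin_act2: "(\<And>x. lin (A x)) \<Longrightarrow> lin (act A p)"
  unfolding act_def by (intro lin_lext_fun lin_foldr)

text \<open>Bilinearity reduces the claim to two words, where \<open>foldr\<close> over a
  concatenation is a composition. The leftmost letter acts last, as befits a left action.\<close>

lemma act_mult:
  assumes A: "\<And>x. lin (A x)"
  shows "act A (p * r) v = act A p (act A r v)"
proof (rule lin_eq[where S = "\<lambda>p. act A (p * r) v" and T = "\<lambda>p. act A p (act A r v)" and v = p])
  show "lin (\<lambda>p. act A (p * r) v)"
    by (rule lin_comp[OF lin_act1 lin_multr[OF lin_id]])
  show "lin (\<lambda>p. act A p (act A r v))" by (rule lin_act1)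
  fix k :: "'a word"
  show "act A (bas k * r) v = act A (bas k) (act A r v)"
  proof (rule lin_eq[where S = "\<lambda>r. act A (bas k * r) v" and T = "\<lambda>r. act A (bas k) (act A r v)" and v = r])
    show "lin (\<lambda>r. act A (bas k * r) v)"
      by (rule lin_comp[OF lin_act1 lin_multl[OF lin_id]])
    show "lin (\<lambda>r. act A (bas k) (act A r v))"
      by (rule lin_comp[OF lin_act2[OF A] lin_act1])
    show "act A (bas k * bas j) v = act A (bas k) (act A (bas j) v)" for j
      by (simp add: act_def bas_mult plus_word_def)
  qed
qed

lemma act_gen: "act A (gen x) v = A x v" by (simp add: act_def)
lemma act_scalar: "act A (scalar c) v = sm c v" by (simp add: act_def zero_word_def)
lemma act_one: "act A 1 v = v" using act_scalar[of A 1 v] by (simp only: single_one sm_one)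
lemma act_add: "act A (p + r) v = act A p v + act A r v"
  by (simp add: act_def lin_rules)
lemma act_diff: "act A (p - r) v = act A p v - act A r v"
  by (simp add: act_def lin_rules)
lemma act_zero: "act A 0 v = 0"
  by (simp add: act_def lext_def)

lemmas act_simps = act_mult act_gen act_scalar act_one act_add act_diff act_zero

section \<open>The action of the quantum group\<close>

lemma q_nonzero [simp]: "q \<noteq> 0"
  by (simp add: q_def Zero_fract_def eq_fract)

lemma lin_eq2:
  assumes "\<And>v. lin (\<lambda>u. S u v)" "\<And>u. lin (S u)" "\<And>v. lin (\<lambda>u. T u v)" "\<And>u. lin (T u)"
    and "\<And>j k. S (bas j) (bas k) = T (bas j) (bas k)"
  shows "S u v = T u v"
proof (rule lin_eq[where S = "\<lambda>u. S u v" and T = "\<lambda>u. T u v" and v = u])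
  show "S (bas j) v = T (bas j) v" for j
    by (rule lin_eq[where S = "S (bas j)" and T = "T (bas j)" and v = v, OF assms(2,4,5)])
qed (rule assms)+

lemma lin_eq_words:
  assumes "lin S" "lin T" "\<And>w. S (wd w) = T (wd w)"
  shows "S v = T v"
proof (rule lin_eq[OF assms(1,2)])
  show "S (bas k) = T (bas k)" for k
    using assms(3) by (cases k) simp
qed

text \<open>The eigenvalue of \<open>K i\<close> on the letter \<open>l\<close>;
  \<open>kinvw\<close> is the eigenvalue of \<open>Kinv i\<close> on a whole word.\<close>

definition kap :: "int \<Rightarrow> int \<Rightarrow> qfield" where
  "kap i l = (if l = 2 * i - 1 then q else if l = 2 * i + 1 then inverse q else 1)"

definition kinvw :: "int \<Rightarrow> int list \<Rightarrow> qfield" where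
  "kinvw i w = q ^ count_list w (2 * i + 1) * inverse q ^ count_list w (2 * i - 1)"

text \<open>The iterated comultiplication with the first tensor factor split off. For
  \<open>E\<close> it is \<open>K \<otimes> E + E \<otimes> 1\<close>, so the twist falls on the
  head; for \<open>F\<close> it is \<open>F \<otimes> Kinv + 1 \<otimes> F\<close>, so it falls on
  the tail. \<open>D\<close> is grouplike and only counts letters.\<close>

fun uact_word :: "ugen \<Rightarrow> int list \<Rightarrow> int falg" where
  "uact_word (GD j) w = sm (q ^ count_list w j) (wd w)"
| "uact_word (GDinv j) w = sm (inverse q ^ count_list w j) (wd w)"
| "uact_word (GE i) [] = 0"
| "uact_word (GE i) (l # w) = sm (kap i l) (gen l * uact_word (GE i) w)
     + (if l = 2 * i + 1 then gen (l - 2) * wd w else 0)"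
| "uact_word (GF i) [] = 0"
| "uact_word (GF i) (l # w) = gen l * uact_word (GF i) w
     + (if l = 2 * i - 1 then sm (kinvw i w) (gen (l + 2) * wd w) else 0)"

definition uact :: "ugen \<Rightarrow> int falg \<Rightarrow> int falg" where
  "uact x = lext (\<lambda>w. uact_word x (letters w))"

definition Kop :: "int \<Rightarrow> int falg \<Rightarrow> int falg" where
  "Kop i v = uact (GD (2 * i - 1)) (uact (GDinv (2 * i + 1)) v)"
definition Kinvop :: "int \<Rightarrow> int falg \<Rightarrow> int falg" where
  "Kinvop i v = uact (GD (2 * i + 1)) (uact (GDinv (2 * i - 1)) v)"

lemma lin_uact [simp]: "lin (uact x)" by (simp add: uact_def)
lemma lin_Kop [simp]: "lin (Kop i)" by (rule linI) (simp_all add: Kop_def lin_rules[OF lin_uact])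
lemma lin_Kinvop [simp]: "lin (Kinvop i)" by (rule linI) (simp_all add: Kinvop_def lin_rules[OF lin_uact])

lemmas uact_lin = lin_rules[OF lin_uact] lin_rules[OF lin_Kop] lin_rules[OF lin_Kinvop]

lemma uact_wd: "uact x (wd w) = uact_word x w" by (simp add: uact_def)

lemma Kinvop_wd: "Kinvop i (wd w) = sm (kinvw i w) (wd w)"
  by (simp add: Kinvop_def uact_wd uact_lin kinvw_def mult.commute)

lemma uact_GD_mult: "uact (GD j) (u * v) = uact (GD j) u * uact (GD j) v"
proof (rule lin_eq2[where S = "\<lambda>u v. uact (GD j) (u * v)"
      and T = "\<lambda>u v. uact (GD j) u * uact (GD j) v"])
  show "uact (GD j) (bas a * bas b) = uact (GD j) (bas a) * uact (GD j) (bas b)" for a b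
    by (cases a; cases b) (simp add: uact_wd wd_mult power_add mult.commute)
qed (intro lin_comp[OF lin_uact] lin_intros lin_uact)+

lemma uact_GDinv_mult: "uact (GDinv j) (u * v) = uact (GDinv j) u * uact (GDinv j) v"
proof (rule lin_eq2[where S = "\<lambda>u v. uact (GDinv j) (u * v)"
      and T = "\<lambda>u v. uact (GDinv j) u * uact (GDinv j) v"])
  show "uact (GDinv j) (bas a * bas b) = uact (GDinv j) (bas a) * uact (GDinv j) (bas b)" for a b
    by (cases a; cases b) (simp add: uact_wd wd_mult power_add mult.commute)
qed (intro lin_comp[OF lin_uact] lin_intros lin_uact)+

lemma Kop_mult: "Kop i (u * v) = Kop i u * Kop i v"
  by (simp add: Kop_def uact_GD_mult uact_GDinv_mult)
lemma Kinvop_mult: "Kinvop i (u * v) = Kinvop i u * Kinvop i v"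
  by (simp add: Kinvop_def uact_GD_mult uact_GDinv_mult)

lemma uact_1 [simp]: "uact (GD j) 1 = 1" "uact (GDinv j) 1 = 1" "uact (GE i) 1 = 0" "uact (GF i) 1 = 0"
  by (simp_all add: uact_wd flip: wd_Nil)
lemma Kop_1 [simp]: "Kop i 1 = 1" "Kinvop i 1 = 1" by (simp_all add: Kop_def Kinvop_def)

lemma uact_gen:
  "uact (GD j) (gen l) = sm (if l = j then q else 1) (gen l)"
  "uact (GDinv j) (gen l) = sm (if l = j then inverse q else 1) (gen l)"
  "uact (GE i) (gen l) = (if l = 2 * i + 1 then gen (l - 2) else 0)"
  "uact (GF i) (gen l) = (if l = 2 * i - 1 then gen (l + 2) else 0)"
  by (simp_all add: uact_wd wd_Nil kinvw_def)

lemma Kop_gen: "Kop i (gen l) = sm (kap i l) (gen l)" "Kinvop i (gen l) = sm (inverse (kap i l)) (gen l)"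
  by (simp_all add: Kop_def Kinvop_def uact_gen uact_lin kap_def)

text \<open>\<open>uact_word\<close> splits after one letter; since \<open>K\<close> is grouplike
  (\<open>Kop_mult\<close>), the split can be moved to any position. This is coassociativity, seen
  on the tensor algebra.\<close>

lemma uact_GE_mult: "uact (GE i) (u * v) = Kop i u * uact (GE i) v + uact (GE i) u * v"
proof (rule lin_eq2[where S = "\<lambda>u v. uact (GE i) (u * v)"
      and T = "\<lambda>u v. Kop i u * uact (GE i) v + uact (GE i) u * v"])
  have "uact (GE i) (wd u * wd v) = Kop i (wd u) * uact (GE i) (wd v) + uact (GE i) (wd u) * wd v" for u v
  proof (induction u)
    case Nil
    then show ?case by (simp add: wd_Nil)
  next
    case (Cons l u)
    have 1: "uact (GE i) (wd (l # w)) = sm (kap i l) (gen l * uact (GE i) (wd w))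
      + (if l = 2 * i + 1 then gen (l - 2) * wd w else 0)" for w
      by (simp add: uact_wd)
    have 2: "Kop i (wd (l # u)) = sm (kap i l) (gen l * Kop i (wd u))"
      by (simp only: gen_wd[of l u, symmetric] Kop_mult Kop_gen sm_mult_left)
    have "uact (GE i) (wd (l # u) * wd v) = uact (GE i) (wd (l # (u @ v)))"
      by (simp add: wd_mult)
    also have "\<dots> = sm (kap i l) (gen l * uact (GE i) (wd u * wd v))
      + (if l = 2 * i + 1 then gen (l - 2) * (wd u * wd v) else 0)"
      unfolding 1 by (simp only: wd_mult)
    also have "\<dots> = Kop i (wd (l # u)) * uact (GE i) (wd v) + uact (GE i) (wd (l # u)) * wd v"
      unfolding 1 2 Cons by (simp add: algebra_simps sm_add_right)
    finally show ?case .
  qed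
  then show "uact (GE i) (bas j * bas k) = Kop i (bas j) * uact (GE i) (bas k) + uact (GE i) (bas j) * bas k" for j k
    by (cases j; cases k) simp
qed (intro lin_comp[OF lin_uact] lin_intros lin_uact lin_Kop)+

lemma uact_GF_mult: "uact (GF i) (u * v) = uact (GF i) u * Kinvop i v + u * uact (GF i) v"
proof (rule lin_eq2[where S = "\<lambda>u v. uact (GF i) (u * v)"
      and T = "\<lambda>u v. uact (GF i) u * Kinvop i v + u * uact (GF i) v"])
  have "uact (GF i) (wd u * wd v) = uact (GF i) (wd u) * Kinvop i (wd v) + wd u * uact (GF i) (wd v)" for u v
  proof (induction u)
    case Nil
    then show ?case by (simp add: wd_Nil)
  next
    case (Cons l u)
    have 1: "uact (GF i) (wd (l # w)) = gen l * uact (GF i) (wd w)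
      + (if l = 2 * i - 1 then gen (l + 2) * Kinvop i (wd w) else 0)" for w
      by (simp add: uact_wd Kinvop_wd)
    have "uact (GF i) (wd (l # u) * wd v) = uact (GF i) (wd (l # (u @ v)))"
      by (simp add: wd_mult)
    also have "\<dots> = gen l * uact (GF i) (wd u * wd v)
      + (if l = 2 * i - 1 then gen (l + 2) * Kinvop i (wd u * wd v) else 0)"
      unfolding 1 by (simp only: wd_mult)
    also have "\<dots> = uact (GF i) (wd (l # u)) * Kinvop i (wd v) + (gen l * wd u) * uact (GF i) (wd v)"
      unfolding 1 Cons Kinvop_mult by (simp add: algebra_simps)
    finally show ?case by (simp only: gen_wd)
  qed
  then show "uact (GF i) (bas j * bas k) = uact (GF i) (bas j) * Kinvop i (bas k) + bas j * uact (GF i) (bas k)" for j k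
    by (cases j; cases k) simp
qed (intro lin_comp[OF lin_uact] lin_intros lin_uact lin_Kinvop)+

lemmas uact_mult = uact_GD_mult uact_GDinv_mult uact_GE_mult uact_GF_mult Kop_mult Kinvop_mult

section \<open>The defining relations of the quantum group as operator identities\<close>

abbreviation "Eop i \<equiv> uact (GE i)"
abbreviation "Fop i \<equiv> uact (GF i)"
abbreviation "Dop j \<equiv> uact (GD j)"
abbreviation "Diop j \<equiv> uact (GDinv j)"

lemma lin_uact_comp: "lin T \<Longrightarrow> lin (\<lambda>v. uact x (T v))" by (rule lin_comp[OF lin_uact])
lemma lin_Kop_comp: "lin T \<Longrightarrow> lin (\<lambda>v. Kop i (T v))" by (rule lin_comp[OF lin_Kop])
lemma lin_Kinvop_comp: "lin T \<Longrightarrow> lin (\<lambda>v. Kinvop i (T v))" by (rule lin_comp[OF lin_Kinvop])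
lemmas lin_uacts = lin_uact_comp lin_Kop_comp lin_Kinvop_comp lin_intros

lemma D_inverse [simp]: "Dop j (Diop j v) = v" "Diop j (Dop j v) = v"
proof -
  show "Dop j (Diop j v) = v"
    by (rule lin_eq_words[where S = "\<lambda>v. Dop j (Diop j v)" and T = "\<lambda>v. v"])
      (intro lin_uacts | simp add: uact_wd uact_lin flip: power_mult_distrib)+
  show "Diop j (Dop j v) = v"
    by (rule lin_eq_words[where S = "\<lambda>v. Diop j (Dop j v)" and T = "\<lambda>v. v"])
      (intro lin_uacts | simp add: uact_wd uact_lin flip: power_mult_distrib)+
qed

lemma D_commute: "Dop j (Dop k v) = Dop k (Dop j v)" "Dop j (Diop k v) = Diop k (Dop j v)"
proof -
  show "Dop j (Dop k v) = Dop k (Dop j v)"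
    by (rule lin_eq_words[where S = "\<lambda>v. Dop j (Dop k v)" and T = "\<lambda>v. Dop k (Dop j v)"])
      (intro lin_uacts | simp add: uact_wd uact_lin mult.commute)+
  show "Dop j (Diop k v) = Diop k (Dop j v)"
    by (rule lin_eq_words[where S = "\<lambda>v. Dop j (Diop k v)" and T = "\<lambda>v. Diop k (Dop j v)"])
      (intro lin_uacts | simp add: uact_wd uact_lin mult.commute)+
qed

text \<open>Together with the twisted Leibniz rules this turns each defining relation into a
  computation with one letter.\<close>

lemma lin_eq_Cons:
  assumes "lin S" "lin T" and Nil: "S 1 = T 1"
    and Cons: "\<And>l w. S (wd w) = T (wd w) \<Longrightarrow> S (gen l * wd w) = T (gen l * wd w)"
  shows "S v = T v"
proof (rule lin_eq_words[OF assms(1,2)])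
  show "S (wd w) = T (wd w)" for w
    by (induction w) (auto simp: Nil wd_Nil gen_wd dest: Cons)
qed

definition dE :: "int \<Rightarrow> int \<Rightarrow> qfield" where
  "dE j i = (if j = 2 * i - 1 then q else if j = 2 * i + 1 then inverse q else 1)"

lemma dE_nonzero [simp]: "dE j i \<noteq> 0" by (simp add: dE_def)

lemma D_E: "Dop j (Eop i v) = sm (dE j i) (Eop i (Dop j v))"
  by (rule lin_eq_Cons[where S = "\<lambda>v. Dop j (Eop i v)" and T = "\<lambda>v. sm (dE j i) (Eop i (Dop j v))"])
    (intro lin_uacts | simp add: uact_lin uact_mult uact_gen Kop_gen sm_add_right kap_def dE_def)+

lemma D_F: "Dop j (Fop i v) = sm (inverse (dE j i)) (Fop i (Dop j v))"
  by (rule lin_eq_Cons[where S = "\<lambda>v. Dop j (Fop i v)" and T = "\<lambda>v. sm (inverse (dE j i)) (Fop i (Dop j v))"])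
    (intro lin_uacts | simp add: uact_lin uact_mult uact_gen Kop_gen sm_add_right dE_def D_commute Kinvop_def)+

lemma Di_E: "Diop j (Eop i v) = sm (inverse (dE j i)) (Eop i (Diop j v))"
proof -
  have "Dop j (Eop i (Diop j v)) = sm (dE j i) (Eop i v)" by (simp add: D_E)
  then have "Diop j (Dop j (Eop i (Diop j v))) = Diop j (sm (dE j i) (Eop i v))" by (rule arg_cong)
  then have "sm (inverse (dE j i)) (Eop i (Diop j v)) = sm (inverse (dE j i)) (sm (dE j i) (Diop j (Eop i v)))"
    by (simp only: D_inverse uact_lin)
  then show ?thesis by simp
qed

lemma Di_F: "Diop j (Fop i v) = sm (dE j i) (Fop i (Diop j v))"
proof -
  have "Dop j (Fop i (Diop j v)) = sm (inverse (dE j i)) (Fop i v)" by (simp add: D_F)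
  then have "Diop j (Dop j (Fop i (Diop j v))) = Diop j (sm (inverse (dE j i)) (Fop i v))" by (rule arg_cong)
  then have "sm (dE j i) (Fop i (Diop j v)) = sm (dE j i) (sm (inverse (dE j i)) (Diop j (Fop i v)))"
    by (simp only: D_inverse uact_lin)
  then show ?thesis by simp
qed

definition kE :: "int \<Rightarrow> int \<Rightarrow> qfield" where
  "kE k i = dE (2 * k + 1) i * inverse (dE (2 * k - 1) i)"

lemma kE_nonzero [simp]: "kE k i \<noteq> 0" by (simp add: kE_def)

lemma Kinv_E: "Kinvop k (Eop i v) = sm (kE k i) (Eop i (Kinvop k v))"
  by (simp add: Kinvop_def D_E Di_E uact_lin kE_def mult.commute)
lemma Kinv_F: "Kinvop k (Fop i v) = sm (inverse (kE k i)) (Fop i (Kinvop k v))"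
  by (simp add: Kinvop_def D_F Di_F uact_lin kE_def mult.commute)
lemmas expand_simps = uact_lin uact_mult uact_gen Kop_gen sm_add_right sm_diff_right kap_def

lemma q_minus_inverse_nonzero [simp]: "q - inverse q \<noteq> 0"
proof
  assume "q - inverse q = 0"
  then have "q * q = 1" by (metis eq_iff_diff_eq_0 q_nonzero right_inverse)
  then show False by (simp add: q_def One_fract_def eq_fract one_pCons)
qed

text \<open>Terms in which the two operators hit different blocks cancel, because the twists from
  \<open>K\<close> are inverse to each other. Hence the commutator of a product is
  \<open>[E, F] u * Kinv v + K u * [E, F] v\<close>, and with \<open>[E, F]\<close> proportional to
  \<open>K - Kinv\<close> the right-hand side telescopes.\<close>

lemma EF_diff:
  "Eop i (Fop k v) = Fop k (Eop i v)
     + (if i = k then sm (inverse (q - inverse q)) (Kop i v - Kinvop i v) else 0)"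
proof (rule lin_eq_Cons[where S = "\<lambda>v. Eop i (Fop k v)" and T = "\<lambda>v. Fop k (Eop i v)
     + (if i = k then sm (inverse (q - inverse q)) (Kop i v - Kinvop i v) else 0)"])
  fix l w
  assume IH: "Eop i (Fop k (wd w)) = Fop k (Eop i (wd w))
     + (if i = k then sm (inverse (q - inverse q)) (Kop i (wd w) - Kinvop i (wd w)) else 0)"
  \<comment> \<open>The commutator on a single moved letter is
    \<open>(q - inverse q) / (q - inverse q) = 1\<close>; this form of the identity lets simp match
    the two sides.\<close>
  have inv: "inverse (q - inverse q) * q = 1 + inverse (q - inverse q) * inverse q"
    by (metis right_diff_distrib left_inverse q_minus_inverse_nonzero diff_eq_eq)
  consider "l = 2 * i + 1" "i = k" | "l = 2 * i - 1" "i = k" | "l \<noteq> 2 * i + 1" "l \<noteq> 2 * i - 1" "i = k"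
    | "i \<noteq> k" by fastforce
  then show "Eop i (Fop k (gen l * wd w)) = Fop k (Eop i (gen l * wd w))
     + (if i = k then sm (inverse (q - inverse q)) (Kop i (gen l * wd w) - Kinvop i (gen l * wd w)) else 0)"
  proof cases
    case 1
    then show ?thesis using IH
      by (simp add: expand_simps Kinv_E kE_def dE_def distrib_left right_diff_distrib add.commute[of 1 "2 * k"]
          sm_add_left inv flip: mult.assoc)
  next
    case 2
    then show ?thesis using IH
      by (simp add: expand_simps Kinv_E kE_def dE_def distrib_left right_diff_distrib add.commute[of 1 "2 * k"]
          sm_add_left inv flip: mult.assoc)
  next
    case 3
    then show ?thesis using IH by (simp add: expand_simps Kinv_E kE_def dE_def distrib_left right_diff_distrib)
  next
    case 4
    then show ?thesis by (auto simp: expand_simps IH Kinv_E kE_def dE_def)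
  qed
qed (intro lin_uacts lin_uact lin_Kop lin_Kinvop | simp add: uact_lin)+

lemma EE_commute: "\<bar>i - k\<bar> > 1 \<Longrightarrow> Eop i (Eop k v) = Eop k (Eop i v)"
  by (rule lin_eq_Cons[where S = "\<lambda>v. Eop i (Eop k v)" and T = "\<lambda>v. Eop k (Eop i v)"])
    (intro lin_uacts | auto simp: expand_simps mult.commute add_ac)+

lemma FF_commute: "\<bar>i - k\<bar> > 1 \<Longrightarrow> Fop i (Fop k v) = Fop k (Fop i v)"
  by (rule lin_eq_Cons[where S = "\<lambda>v. Fop i (Fop k v)" and T = "\<lambda>v. Fop k (Fop i v)"])
    (intro lin_uacts | auto simp: expand_simps mult.commute add_ac Kinv_F kE_def dE_def)+

lemma q_cancel: "q * q * inverse q = q" "inverse q * inverse q * q = inverse q"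
  by (simp_all add: mult.assoc)

text \<open>The endpoints \<open>2 * i \<plusminus> 1\<close> and
  \<open>2 * k \<plusminus> 1\<close> are the only letters on which \<open>E\<close> or
  \<open>K\<close> for these two indices acts nontrivially, and two of them coincide for
  neighbouring indices. Comparing the head letter with all four settles the induction step.\<close>

lemma Serre_E:
  assumes "\<bar>i - k\<bar> = 1"
  shows "Eop i (Eop i (Eop k v)) = sm (q + inverse q) (Eop i (Eop k (Eop i v))) - Eop k (Eop i (Eop i v))"
proof (rule lin_eq_Cons[where S = "\<lambda>v. Eop i (Eop i (Eop k v))"
      and T = "\<lambda>v. sm (q + inverse q) (Eop i (Eop k (Eop i v))) - Eop k (Eop i (Eop i v))"])
  fix l w
  assume IH: "Eop i (Eop i (Eop k (wd w))) =
    sm (q + inverse q) (Eop i (Eop k (Eop i (wd w)))) - Eop k (Eop i (Eop i (wd w)))"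
  have ik: "k = i + 1 \<or> k = i - 1" using assms by auto
  show "Eop i (Eop i (Eop k (gen l * wd w))) = sm (q + inverse q) (Eop i (Eop k (Eop i (gen l * wd w))))
    - Eop k (Eop i (Eop i (gen l * wd w)))"
    using ik IH
    by (elim disjE; cases "l = 2 * i + 1"; cases "l = 2 * i - 1"; cases "l = 2 * k + 1"; cases "l = 2 * k - 1")
      (simp_all add: expand_simps distrib_left right_diff_distrib distrib_right sm_add_left add.commute[of 1 "2 * i"]
        q_cancel flip: mult.assoc)
qed (intro lin_uacts | simp add: uact_lin)+

lemma Serre_F:
  assumes "\<bar>i - k\<bar> = 1"
  shows "Fop i (Fop i (Fop k v)) = sm (q + inverse q) (Fop i (Fop k (Fop i v))) - Fop k (Fop i (Fop i v))"
proof (rule lin_eq_Cons[where S = "\<lambda>v. Fop i (Fop i (Fop k v))"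
      and T = "\<lambda>v. sm (q + inverse q) (Fop i (Fop k (Fop i v))) - Fop k (Fop i (Fop i v))"])
  fix l w
  assume IH: "Fop i (Fop i (Fop k (wd w))) =
    sm (q + inverse q) (Fop i (Fop k (Fop i (wd w)))) - Fop k (Fop i (Fop i (wd w)))"
  have ik: "k = i + 1 \<or> k = i - 1" using assms by auto
  show "Fop i (Fop i (Fop k (gen l * wd w))) = sm (q + inverse q) (Fop i (Fop k (Fop i (gen l * wd w))))
    - Fop k (Fop i (Fop i (gen l * wd w)))"
    using ik IH
    by (elim disjE; cases "l = 2 * i + 1"; cases "l = 2 * i - 1"; cases "l = 2 * k + 1"; cases "l = 2 * k - 1")
      (simp_all add: expand_simps Kinv_F kE_def dE_def distrib_left right_diff_distrib distrib_right sm_add_left add.commute[of 1 "2 * i"]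
        q_cancel flip: mult.assoc)
qed (intro lin_uacts | simp add: uact_lin)+

lemma act_K: "act uact (K i) v = Kop i v" "act uact (Kinv i) v = Kinvop i v"
  by (simp_all add: K_def Kinv_def Kop_def Kinvop_def act_simps)

theorem uq_rels_act:
  assumes "r \<in> uq_rels m"
  shows "act uact r v = 0"
proof -
  have powi: "q powi (of_bool (j = 2 * i - 1) - of_bool (j = 2 * i + 1)) = dE j i"
    "q powi (of_bool (j = 2 * i + 1) - of_bool (j = 2 * i - 1)) = inverse (dE j i)" for i j
    by (auto simp: dE_def)
  show ?thesis
    using assms unfolding uq_rels_def
    by (elim UnE CollectE exE conjE)
      (simp_all add: act_simps act_K powi D_E D_F EF_diff D_commute[of _ _ v] EE_commute[of _ _ v]
        FF_commute[of _ _ v] Serre_E Serre_F)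
qed

section \<open>Word sets\<close>

text \<open>Parametrized by a set of words because three alphabets occur: all integers when only the
  degree matters, odd integers for the commutation with the Hecke generators, and
  \<open>halfs m\<close> for \<open>tens m n\<close>.\<close>

definition wspan :: "'g list set \<Rightarrow> 'g falg set" where
  "wspan P = {v. \<forall>w\<in>Poly_Mapping.keys v. letters w \<in> P}"

definition words :: "'g set \<Rightarrow> nat \<Rightarrow> 'g list set" where
  "words S n = {w. length w = n \<and> set w \<subseteq> S}"

lemma tens_wspan: "tens m n = wspan (words (halfs m) n)"
  by (simp add: tens_def wspan_def words_def)

lemma wspan_wd [simp]: "wd w \<in> wspan P \<longleftrightarrow> w \<in> P"
  by (simp add: wspan_def)
lemma wspan_zero [simp]: "0 \<in> wspan P" by (simp add: wspan_def)
lemma wspan_add: "u \<in> wspan P \<Longrightarrow> v \<in> wspan P \<Longrightarrow> u + v \<in> wspan P"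
  unfolding wspan_def using keys_add[of u v] by auto
lemma wspan_sm: "v \<in> wspan P \<Longrightarrow> sm c v \<in> wspan P"
  unfolding wspan_def using keys_sm[of c v] by auto
lemma wspan_sum: "(\<And>i. i \<in> I \<Longrightarrow> f i \<in> wspan P) \<Longrightarrow> (\<Sum>i\<in>I. f i) \<in> wspan P"
  by (induction I rule: infinite_finite_induct) (auto intro: wspan_add)
lemma wspan_mult:
  assumes "u \<in> wspan P" "v \<in> wspan Q" "\<And>x y. x \<in> P \<Longrightarrow> y \<in> Q \<Longrightarrow> x @ y \<in> R"
  shows "u * v \<in> wspan R"
  unfolding wspan_def
proof safe
  fix w assume "w \<in> Poly_Mapping.keys (u * v)"
  then obtain a b where "a \<in> Poly_Mapping.keys u" "b \<in> Poly_Mapping.keys v" "w = a + b"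
    using keys_mult[of u v] by blast
  then show "letters w \<in> R" using assms by (simp add: wspan_def plus_word_def)
qed
lemma wspan_lin:
  assumes "lin T" "v \<in> wspan P" "\<And>w. w \<in> P \<Longrightarrow> T (wd w) \<in> wspan R"
  shows "T v \<in> wspan R"
proof -
  have "T v = (\<Sum>k\<in>Poly_Mapping.keys v. sm (Poly_Mapping.lookup v k) (T (bas k)))"
    by (rule lin_expand[OF assms(1)])
  moreover have "T (bas k) \<in> wspan R" if "k \<in> Poly_Mapping.keys v" for k
    using that assms(2) assms(3)[of "letters k"] by (auto simp: wspan_def)
  ultimately show ?thesis by (auto intro!: wspan_sum wspan_sm)
qed

lemma lin_eq_wspan:
  assumes "lin S" "lin T" "v \<in> wspan P" "\<And>w. w \<in> P \<Longrightarrow> S (wd w) = T (wd w)"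
  shows "S v = T v"
proof (rule lin_eq_on[OF assms(1,2)])
  fix k assume "k \<in> Poly_Mapping.keys v"
  with assms(3) have "letters k \<in> P" by (simp add: wspan_def)
  from assms(4)[OF this] show "S (bas k) = T (bas k)" by simp
qed

text \<open>\<open>alphabet_ok S x\<close> ensures that the generator \<open>x\<close> maps words over \<open>S\<close> to such words.\<close>

definition alphabet_ok :: "int set \<Rightarrow> ugen \<Rightarrow> bool" where
  "alphabet_ok S x \<longleftrightarrow> (case x of GE i \<Rightarrow> 2 * i - 1 \<in> S | GF i \<Rightarrow> 2 * i + 1 \<in> S | _ \<Rightarrow> True)"

lemma uact_words:
  assumes S: "alphabet_ok S x" and v: "v \<in> wspan (words S n)"
  shows "uact x v \<in> wspan (words S n)"
proof (rule wspan_lin[OF lin_uact v])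
  show "uact x (wd w) \<in> wspan (words S n)" if "w \<in> words S n" for w
    using that
  proof (induction w arbitrary: n)
    case Nil
    then show ?case by (cases x) (simp_all add: uact_wd words_def wspan_sm)
  next
    case (Cons l w)
    then obtain k where n: "n = Suc k" and l: "l \<in> S" and w: "w \<in> words S k"
      by (cases n) (auto simp: words_def)
    have mult: "u * v \<in> wspan (words S n)" if "u \<in> wspan (words S 1)" "v \<in> wspan (words S k)" for u v
      by (rule wspan_mult[OF that]) (auto simp: words_def n)
    have 1: "gen l \<in> wspan (words S 1)" using l by (simp add: words_def)
    have 2: "wd w \<in> wspan (words S k)" using w by simp
    have 3: "uact y (gen l) \<in> wspan (words S 1)" if "alphabet_ok S y" for y
      using that l by (cases y) (auto simp: uact_gen alphabet_ok_def words_def add.commute intro!: wspan_sm)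
    have 4: "uact y (wd w) \<in> wspan (words S k)" if "y = x \<or> (\<exists>j. y = GD j \<or> y = GDinv j)" for y
      using that Cons.IH[OF w] 2 by (auto simp: uact_wd intro!: wspan_sm)
    have 5: "Kop i (gen l) \<in> wspan (words S 1)" "Kinvop i (wd w) \<in> wspan (words S k)" for i
      using 1 2 by (auto simp: Kop_gen Kinvop_wd intro!: wspan_sm)
    have "uact x (gen l * wd w) \<in> wspan (words S n)"
      using S 4[of x] 1 2 5 3[of x] by (cases x) (auto simp: uact_mult intro!: wspan_add mult)
    then show ?case by (simp add: gen_wd)
  qed
qed

lemma alphabet_ok_UNIV: "alphabet_ok UNIV x" by (simp add: alphabet_ok_def split: ugen.split)
lemma alphabet_ok_halfs: "x \<in> ugens m \<Longrightarrow> alphabet_ok (halfs m) x"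
  using half_neighbours[of _ m] by (auto simp: ugens_def alphabet_ok_def)

section \<open>Comparison with the action defined through the comultiplication\<close>

lemma lin_lext_push: "lin T \<Longrightarrow> T (lext f p) = lext (\<lambda>k. T (f k)) p"
  by (simp add: lext_def lin_sum lin_sm)

lemma lext_one [simp]: "lext f 1 = f 0"
  by (metis lext_bas single_one)

text \<open>\<open>nat_rep\<close> looks only at the head of a word, so it agrees with
  \<open>uact\<close> in degree one only; the induction over a word of generators carries along that
  the degree stays one.\<close>

lemma nat_rep_act:
  assumes v: "v \<in> wspan (words UNIV (Suc 0))"
  shows "nat_rep p v = act uact p v"
proof -
  let ?g = "\<lambda>x. lin_ext (\<lambda>ls. nat_rep_gen x (hd ls))"
  have step: "?g x u = uact x u" if "u \<in> wspan (words UNIV (Suc 0))" for x u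
  proof (rule lin_eq_wspan[OF _ lin_uact that])
    show "lin (?g x)" by (simp add: lin_ext_lext)
    fix w :: "int list" assume "w \<in> words UNIV (Suc 0)"
    then obtain l where w: "w = [l]" by (auto simp: words_def length_Suc_conv)
    show "?g x (wd w) = uact x (wd w)"
      by (cases x) (auto simp: lin_ext_lext w uact_gen sm_def eq_commute)
  qed
  have "foldr ?g ws v = foldr uact ws v \<and> foldr uact ws v \<in> wspan (words UNIV (Suc 0))" for ws
    by (induction ws) (auto simp: v step intro: uact_words alphabet_ok_UNIV)
  then show ?thesis by (simp add: nat_rep_def act_def lext_def sm_def)
qed

definition act2 :: "ugen falg2 \<Rightarrow> int falg \<Rightarrow> int falg \<Rightarrow> int falg" where
  "act2 t u v = lext (\<lambda>(x, y). act uact (bas x) u * act uact (bas y) v) t"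

lemma lin_act2_fst [simp]: "lin (\<lambda>t. act2 t u v)" by (simp add: act2_def)

lemma act2_tensor2: "act2 (tensor2 a b) u v = act uact a u * act uact b v"
proof -
  have "act2 (tensor2 a b) u v = (\<Sum>x\<in>Poly_Mapping.keys a. \<Sum>y\<in>Poly_Mapping.keys b.
     sm (Poly_Mapping.lookup a x * Poly_Mapping.lookup b y) (act uact (bas x) u * act uact (bas y) v))"
    by (simp add: act2_def tensor2_def lin_sum[OF lin_lext])
  also have "\<dots> = act uact a u * act uact b v"
    by (simp add: lin_expand[OF lin_act1[where A = uact and v = u], of a] lin_expand[OF lin_act1[where A = uact and v = v], of b]
        sum_product mult.commute[of "Poly_Mapping.lookup a _"])
  finally show ?thesis .
qed

lemma act2_mult:
  "act2 (s * t) u v = lext (\<lambda>(x, y). act2 s (act uact (bas x) u) (act uact (bas y) v)) t"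
proof (rule lin_eq2[where S = "\<lambda>s t. act2 (s * t) u v"
      and T = "\<lambda>s t. lext (\<lambda>(x, y). act2 s (act uact (bas x) u) (act uact (bas y) v)) t"])
  show "lin (\<lambda>s. act2 (s * t) u v)" for t
    by (rule lin_comp[OF lin_act2_fst lin_multr[OF lin_id]])
  show "lin (\<lambda>t. act2 (s * t) u v)" for s
    by (rule lin_comp[OF lin_act2_fst lin_multl[OF lin_id]])
  show "lin (\<lambda>s. lext (\<lambda>(x, y). act2 s (act uact (bas x) u) (act uact (bas y) v)) t)" for t
    by (intro lin_lext_fun) (simp add: split_def)
  show "act2 (bas j * bas k) u v = lext (\<lambda>(x, y). act2 (bas j) (act uact (bas x) u) (act uact (bas y) v)) (bas k)"
    for j k
  proof -
    have "act uact (bas (a + b)) w = act uact (bas a) (act uact (bas b) w)" for a b w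
      using act_mult[of uact "bas a" "bas b" w] by (simp add: bas_mult)
    then show ?thesis by (cases j; cases k) (simp add: act2_def bas_mult)
  qed
qed simp

lemma comult_lext: "comult = lext (\<lambda>w. prod_list (map comult_gen (letters w)))"
  by (rule ext) (simp add: comult_def alg_lift_def lext_def sm_def)

lemma act2_gen: "act2 (comult_gen g) u v = uact g (u * v)"
  by (cases g) (simp_all add: lin_rules[OF lin_act2_fst] act2_tensor2 act_simps act_K uact_mult)

text \<open>The tensor algebra is a module algebra. For a generator this is its Leibniz rule
  (\<open>act2_gen\<close>), and both sides turn products in \<open>p\<close> into
  compositions.\<close>

lemma act_comult: "act uact p (u * v) = act2 (comult p) u v"
proof (rule lin_eq_words[where S = "\<lambda>p. act uact p (u * v)" and T = "\<lambda>p. act2 (comult p) u v"])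
  show "lin (\<lambda>p. act uact p (u * v))" by (rule lin_act1)
  show "lin (\<lambda>p. act2 (comult p) u v)" unfolding comult_lext
    by (rule lin_comp[OF lin_act2_fst lin_lext])
  show "act uact (wd w) (u * v) = act2 (comult (wd w)) u v" for w
  proof (induction w)
    case Nil
    have "act2 (bas 0) u v = u * v"
      unfolding act2_def lext_bas by (simp add: zero_prod_def act_one)
    then show ?case by (simp add: comult_lext act_def wd_Nil zero_word_def)
  next
    case (Cons g w)
    have "act uact (wd (g # w)) (u * v) = uact g (act uact (wd w) (u * v))"
      by (simp add: act_def)
    also have "\<dots> = lext (\<lambda>(x, y). uact g (act uact (bas x) u * act uact (bas y) v)) (comult (wd w))"
      unfolding Cons act2_def lin_lext_push[OF lin_uact] by (simp add: split_def)
    also have "\<dots> = act2 (comult_gen g * comult (wd w)) u v"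
      by (simp add: act2_mult act2_gen)
    finally show ?case by (simp add: comult_lext)
  qed
qed

text \<open>The recursive clause of \<open>tens_rep\<close> is \<open>act_comult\<close> with a
  single letter as left block.\<close>

theorem tens_rep_act:
  "v \<in> wspan (words UNIV (Suc n)) \<Longrightarrow> tens_rep (Suc n) p v = act uact p v"
proof (induction n arbitrary: p v)
  case 0
  then show ?case by (simp add: nat_rep_act)
next
  case (Suc n)
  let ?f = "\<lambda>ls. \<Sum>(x, y)\<in>Poly_Mapping.keys (comult p).
        scalar (Poly_Mapping.lookup (comult p) (x, y)) *
        (nat_rep (Poly_Mapping.single x 1) (gen (hd ls)) *
         tens_rep (Suc n) (Poly_Mapping.single y 1) (Poly_Mapping.single (Word (tl ls)) 1))"
  have "tens_rep (Suc (Suc n)) p v = lin_ext ?f v" by simp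
  also have "\<dots> = act uact p v"
  proof (rule lin_eq_wspan[OF _ _ Suc.prems])
    show "lin (lin_ext ?f)" by (simp add: lin_ext_lext)
    show "lin (act uact p)" by (rule lin_act2) simp
    fix w :: "int list" assume "w \<in> words UNIV (Suc (Suc n))"
    then obtain l ls where w: "w = l # ls" "ls \<in> words UNIV (Suc n)"
      by (cases w) (auto simp: words_def)
    have "?f w = (\<Sum>(x, y)\<in>Poly_Mapping.keys (comult p). sm (Poly_Mapping.lookup (comult p) (x, y))
        (act uact (bas x) (gen l) * act uact (bas y) (wd ls)))"
      using w by (simp add: sm_def Suc.IH nat_rep_act words_def)
    also have "\<dots> = act2 (comult p) (gen l) (wd ls)"
      by (simp add: act2_def lext_def split_def)
    also have "\<dots> = act uact p (wd w)"
      by (simp add: w gen_wd flip: act_comult)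
    finally show "lin_ext ?f (wd w) = act uact p (wd w)" by (simp add: lin_ext_lext)
  qed
  finally show ?case .
qed

section \<open>The action of the Hecke algebra\<close>

lemma sm_diff_left: "sm (c - d) v = sm c v - sm d v"
  by (rule poly_mapping_eqI) (simp add: lookup_minus left_diff_distrib)

definition hop :: "nat \<Rightarrow> int falg \<Rightarrow> int falg" where
  "hop i = lin_ext (hecke_rep_gen i)"

lemma lin_hop [simp]: "lin (hop i)" by (simp add: hop_def lin_ext_lext)
lemma lin_hop_comp: "lin T \<Longrightarrow> lin (\<lambda>v. hop i (T v))" by (rule lin_comp[OF lin_hop])
lemmas hop_lin = lin_rules[OF lin_hop]
lemma hop_wd: "hop i (wd w) = hecke_rep_gen i w" by (simp add: hop_def lin_ext_lext)

lemma hecke_rep_lext: "hecke_rep p v = lext (\<lambda>w. fold hop (letters w) v) p"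
  by (simp add: hecke_rep_def lext_def sm_def hop_def[abs_def])

lemma hecke_rep_rev: "hecke_rep (bas w) v = fold hop (letters w) v"
  by (simp add: hecke_rep_lext)

lemma lin_fold_hop: "lin (fold hop ws)"
  by (induction ws) (auto simp: lin_def hop_lin)

lemma lin_hecke_rep1: "lin (\<lambda>p. hecke_rep p v)" by (simp add: hecke_rep_lext)
lemma lin_hecke_rep2: "lin (hecke_rep p)"
  unfolding hecke_rep_lext[abs_def] by (intro lin_lext_fun lin_fold_hop)

lemma hecke_rep_mult: "hecke_rep (p * r) v = hecke_rep r (hecke_rep p v)"
proof (rule lin_eq2[where S = "\<lambda>p r. hecke_rep (p * r) v" and T = "\<lambda>p r. hecke_rep r (hecke_rep p v)"])
  show "lin (\<lambda>p. hecke_rep (p * r) v)" for r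
    by (rule lin_comp[OF lin_hecke_rep1 lin_multr[OF lin_id]])
  show "lin (\<lambda>r. hecke_rep (p * r) v)" for p
    by (rule lin_comp[OF lin_hecke_rep1 lin_multl[OF lin_id]])
  show "lin (\<lambda>p. hecke_rep r (hecke_rep p v))" for r
    by (rule lin_comp[OF lin_hecke_rep2 lin_hecke_rep1])
  show "lin (\<lambda>r. hecke_rep r (hecke_rep p v))" for p by (rule lin_hecke_rep1)
  show "hecke_rep (bas j * bas k) v = hecke_rep (bas k) (hecke_rep (bas j) v)" for j k
    by (simp add: bas_mult plus_word_def hecke_rep_rev)
qed

lemma hecke_rep_gen_act: "hecke_rep (gen i) v = hop i v" by (simp add: hecke_rep_rev)
lemma hecke_rep_scalar: "hecke_rep (scalar c) v = sm c v" by (simp add: hecke_rep_lext zero_word_def)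
lemma hecke_rep_one: "hecke_rep 1 v = v" using hecke_rep_scalar[of 1 v] by (simp only: single_one sm_one)
lemma hecke_rep_add: "hecke_rep (p + r) v = hecke_rep p v + hecke_rep r v"
  by (simp add: hecke_rep_lext lin_rules)
lemma hecke_rep_diff: "hecke_rep (p - r) v = hecke_rep p v - hecke_rep r v"
  by (simp add: hecke_rep_lext lin_rules)
lemma hecke_rep_zero: "hecke_rep 0 v = 0" by (simp add: hecke_rep_lext lext_def)
lemmas hecke_rep_simps = hecke_rep_mult hecke_rep_gen_act hecke_rep_scalar hecke_rep_one
  hecke_rep_add hecke_rep_diff hecke_rep_zero

lemma hop_0: "hop 0 (gen a * v) = gen (- a) * v"
  by (rule lin_eq_words[where S = "\<lambda>v. hop 0 (gen a * v)" and T = "\<lambda>v. gen (- a) * v"])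
    (intro lin_hop_comp lin_intros | simp add: gen_wd hop_wd hecke_rep_gen_def)+

definition swap2 :: "int \<Rightarrow> int \<Rightarrow> int falg \<Rightarrow> int falg" where
  "swap2 a b v = (if a < b then gen b * (gen a * v)
    else if a > b then gen b * (gen a * v) + sm (inverse q - q) (gen a * (gen b * v))
    else sm (inverse q) (gen b * (gen a * v)))"

lemma lin_swap2: "lin T \<Longrightarrow> lin (\<lambda>v. swap2 a b (T v))"
  unfolding swap2_def by (intro lin_intros)

lemma hop_1: "hop (Suc 0) (gen a * (gen b * v)) = swap2 a b v"
proof (rule lin_eq_words[where S = "\<lambda>v. hop (Suc 0) (gen a * (gen b * v))" and T = "\<lambda>v. swap2 a b v"])
  show "lin (\<lambda>v. hop (Suc 0) (gen a * (gen b * v)))" by (intro lin_hop_comp lin_intros)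
  show "lin (\<lambda>v. swap2 a b v)" by (intro lin_swap2 lin_id)
  show "hop (Suc 0) (gen a * (gen b * wd w)) = swap2 a b (wd w)" for w
    by (simp add: gen_wd hop_wd hecke_rep_gen_def swap2_def sm_def[symmetric])
qed

text \<open>With this shift each relation among the generators moves to the left end of the word,
  where \<open>hop_0\<close> and \<open>hop_1\<close> leave at most three letters to
  inspect.\<close>

lemma hop_Suc_Suc: "hop (Suc (Suc i)) (gen l * v) = gen l * hop (Suc i) v"
proof (rule lin_eq_words[where S = "\<lambda>v. hop (Suc (Suc i)) (gen l * v)" and T = "\<lambda>v. gen l * hop (Suc i) v"])
  show "lin (\<lambda>v. hop (Suc (Suc i)) (gen l * v))" by (intro lin_hop_comp lin_intros)
  show "lin (\<lambda>v. gen l * hop (Suc i) v)" by (intro lin_intros lin_hop)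
  show "hop (Suc (Suc i)) (gen l * wd w) = gen l * hop (Suc i) (wd w)" for w
    by (simp add: gen_wd hop_wd hecke_rep_gen_def Let_def distrib_left flip: sm_def)
qed

lemmas hop_simps = hop_0 hop_1 hop_Suc_Suc

lemma Cons_words:
  assumes "w \<in> words S (Suc n)"
  obtains l w' where "l \<in> S" "w' \<in> words S n" "w = l # w'"
  using assms by (cases w) (auto simp: words_def)

lemma words_split2:
  assumes "w \<in> words UNIV n" "1 < n"
  obtains a b w' where "wd w = gen a * (gen b * wd w')"
proof -
  from assms obtain a b w' where "w = a # b # w'"
    by (cases w; cases "tl w") (auto simp: words_def)
  with that show ?thesis by (simp add: gen_wd)
qed

lemma hop_quadratic:
  assumes "w \<in> words UNIV n" "Suc i < n"
  shows "hop (Suc i) (hop (Suc i) (wd w)) = wd w + sm (inverse q - q) (hop (Suc i) (wd w))"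
  using assms
proof (induction i arbitrary: w n)
  case 0
  then obtain a b w' where w: "wd w = gen a * (gen b * wd w')"
    using words_split2[OF 0(1)] by auto
  have "inverse q * inverse q = 1 + (inverse q - q) * inverse q"
    by (simp add: left_diff_distrib)
  then show ?case unfolding w
    by (auto simp: hop_simps swap2_def hop_lin sm_add_right sm_add_left)
next
  case (Suc i)
  obtain l w' k where "n = Suc k" "w = l # w'" "w' \<in> words UNIV k"
    using Suc.prems by (cases n) (auto elim: Cons_words)
  with Suc show ?case by (simp add: gen_wd[symmetric, of l w'] hop_Suc_Suc distrib_left)
qed

lemma hop_far:
  assumes "w \<in> words UNIV n" "Suc i < j" "j < n"
  shows "hop i (hop j (wd w)) = hop j (hop i (wd w))"
  using assms
proof (induction i arbitrary: w n j)
  case 0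
  then obtain j' where j: "j = Suc (Suc j')" by (metis less_imp_Suc_add add_Suc)
  obtain a b w' where w: "wd w = gen a * (gen b * wd w')"
    using words_split2[OF 0(1)] 0 by auto
  then show ?case by (simp add: j hop_simps)
next
  case (Suc i)
  then obtain j' where j: "j = Suc (Suc (Suc j'))" by (metis less_imp_Suc_add add_Suc)
  show ?case
  proof (cases i)
    case 0
    obtain a b w' where w: "wd w = gen a * (gen b * wd w')"
      using words_split2[OF Suc.prems(1)] Suc.prems by auto
    show ?thesis by (simp add: w j 0 hop_simps swap2_def hop_lin)
  next
    case (Suc i')
    obtain l w' k where "n = Suc k" "w = l # w'" "w' \<in> words UNIV k"
      using Suc.prems by (cases n) (auto elim: Cons_words)
    with Suc.IH[of w' k "Suc (Suc j')"] Suc Suc.prems show ?thesis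
      by (simp add: gen_wd[symmetric, of l w'] hop_Suc_Suc j)
  qed
qed

lemma hop_braid:
  assumes "w \<in> words UNIV n" "Suc (Suc i) < n"
  shows "hop (Suc i) (hop (Suc (Suc i)) (hop (Suc i) (wd w)))
    = hop (Suc (Suc i)) (hop (Suc i) (hop (Suc (Suc i)) (wd w)))"
  using assms
proof (induction i arbitrary: w n)
  case 0
  then obtain a b c w' where "w = a # b # c # w'"
    by (cases w; cases "tl w"; cases "tl (tl w)") (auto simp: words_def)
  then have w: "wd w = gen a * (gen b * (gen c * wd w'))" by (simp add: gen_wd)
  \<comment> \<open>The second identity is the quadratic relation
    \<open>inverse q * inverse q = 1 + (inverse q - q) * inverse q\<close> times
    \<open>inverse q - q\<close>; it is what equal letters require.\<close>
  have c: "inverse q * (inverse q - q) = (inverse q - q) * inverse q"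
    "(inverse q - q) * inverse q * inverse q = (inverse q - q) + (inverse q - q) * inverse q * (inverse q - q)"
    by (simp_all add: algebra_simps)
  show ?case unfolding w
    using less_linear[of a b] less_linear[of b c] less_linear[of a c]
    by (elim disjE)
      (simp_all add: hop_simps swap2_def hop_lin sm_add_right distrib_left,
        simp_all only: c sm_add_left add_ac)
next
  case (Suc i)
  obtain l w' k where "n = Suc k" "w = l # w'" "w' \<in> words UNIV k"
    using Suc.prems by (cases n) (auto elim: Cons_words)
  with Suc show ?case by (simp add: gen_wd[symmetric, of l w'] hop_Suc_Suc)
qed

text \<open>The sign changes produce only the comparisons of \<open>\<plusminus> a\<close> with
  \<open>\<plusminus> b\<close>, and these are all decided by the order of \<open>a\<close>,
  \<open>b\<close> and that of \<open>- a\<close>, \<open>b\<close>.\<close>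

lemma hop_braid_B:
  assumes "w \<in> words UNIV n" "1 < n"
  shows "hop (Suc 0) (hop 0 (hop (Suc 0) (hop 0 (wd w)))) = hop 0 (hop (Suc 0) (hop 0 (hop (Suc 0) (wd w))))"
proof -
  obtain a b w' where w: "wd w = gen a * (gen b * wd w')"
    using words_split2[OF assms] by auto
  show ?thesis unfolding w
    using less_linear[of a b] less_linear[of "-a" b] 
    by (elim disjE)
      (simp_all add: hop_simps swap2_def hop_lin sm_add_right distrib_left,
        simp_all add: mult.commute)
qed

lemma hop_words:
  assumes S: "\<And>l. l \<in> S \<Longrightarrow> - l \<in> S" and v: "v \<in> wspan (words S n)" and i: "i < n"
  shows "hop i v \<in> wspan (words S n)"
proof (rule wspan_lin[OF lin_hop v])
  fix w assume w: "w \<in> words S n"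
  have *: "ls[k := x] \<in> words S n" if "ls \<in> words S n" "x \<in> S" for ls k x
    using that set_update_subset_insert[of ls k x] by (auto simp: words_def)
  have nth: "w ! j \<in> S" if "j < n" for j
    using w that by (auto simp: words_def)
  show "hop i (wd w) \<in> wspan (words S n)"
    using w i S nth[of i] nth[of "i - 1"]
    by (auto simp: hop_wd hecke_rep_gen_def Let_def sm_def[symmetric] intro!: wspan_add wspan_sm *)
qed

text \<open>In contrast to \<open>uq_rels_act\<close> the degree is fixed: \<open>hop i\<close>
  represents a generator only on words with more than \<open>i\<close> letters.\<close>

theorem hecke_rels_act:
  assumes r: "r \<in> hecke_rels n" and n: "n \<ge> 1" and v: "v \<in> wspan (words UNIV n)"
  shows "hecke_rep r v = 0"
proof (rule lin_eq_wspan[OF lin_hecke_rep2 lin_zero v])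
  fix w :: "int list" assume w: "w \<in> words UNIV n"
  have quad: "hop i (hop i (wd w)) = wd w + sm (inverse q - q) (hop i (wd w))" if "1 \<le> i" "i < n" for i
    using hop_quadratic[OF w, of "i - 1"] that by simp
  have braid: "hop i (hop (Suc i) (hop i (wd w))) = hop (Suc i) (hop i (hop (Suc i) (wd w)))"
    if "1 \<le> i" "Suc i < n" for i
    using hop_braid[OF w, of "i - 1"] that by simp
  have quad0: "hop 0 (hop 0 (wd w)) = wd w"
  proof -
    obtain l w' where "w = l # w'" using w n by (cases w) (auto simp: words_def)
    then show ?thesis by (simp add: gen_wd[symmetric, of l w'] hop_0)
  qed
  show "hecke_rep r (wd w) = 0"
    using r unfolding hecke_rels_def
    by (elim UnE CollectE exE conjE)
      (auto simp: hecke_rep_simps quad quad0 braid hop_lin hop_braid_B[OF w, simplified]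
        intro: hop_far[OF w] hop_far[OF w, symmetric] split: if_splits)
qed

section \<open>Commutation of the quantum group generators with the Hecke generators\<close>

lemma q_cancel': "inverse q * (q * q) = q"
  by (simp flip: mult.assoc)

text \<open>Parity is essential: \<open>E\<close> moves a letter by two, which among odd letters
  never jumps over another letter. A strict comparison can at most become an equality or arise from
  one, and \<open>inverse q - q\<close> together with the twist \<open>kap\<close> balances these
  cases.\<close>

lemma Eop_swap2:
  assumes "odd a" "odd b"
  shows "Eop i (swap2 a b v) = hop (Suc 0) (Eop i (gen a * (gen b * v)))"
proof -
  from assms obtain a' b' where ab: "a = 2 * a' + 1" "b = 2 * b' + 1" by (auto elim!: oddE)
  show ?thesis
    using less_linear[of a' b'] unfolding ab
    by (elim disjE; cases "a' = i"; cases "a' = i - 1"; cases "b' = i"; cases "b' = i - 1")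
      (simp_all add: hop_1 swap2_def uact_mult uact_gen Kop_gen uact_lin hop_lin sm_add_right distrib_left kap_def,
       simp_all add: right_diff_distrib[of _ "inverse q" q] left_diff_distrib[of "inverse q" q] sm_diff_left mult.assoc
        q_cancel' add.commute[of 1 "2 * i"])
qed

lemma Fop_swap2:
  assumes "odd a" "odd b"
  shows "Fop i (swap2 a b v) = hop (Suc 0) (Fop i (gen a * (gen b * v)))"
proof -
  from assms obtain a' b' where ab: "a = 2 * a' + 1" "b = 2 * b' + 1" by (auto elim!: oddE)
  show ?thesis
    using less_linear[of a' b'] unfolding ab
    by (elim disjE; cases "a' = i"; cases "a' = i - 1"; cases "b' = i"; cases "b' = i - 1")
      (simp_all add: hop_1 swap2_def uact_mult uact_gen Kop_gen uact_lin hop_lin sm_add_right distrib_left kap_def,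
       simp_all add: right_diff_distrib[of _ "inverse q" q] left_diff_distrib[of "inverse q" q] sm_diff_left mult.assoc
        q_cancel' add.commute[of 1 "2 * i"])
qed

lemma Dop_swap2: "Dop i (swap2 a b v) = hop (Suc 0) (Dop i (gen a * (gen b * v)))"
  by (cases "a = i"; cases "b = i")
    (auto simp: hop_1 swap2_def uact_mult uact_gen uact_lin hop_lin sm_add_right mult_ac)

lemma Diop_swap2: "Diop i (swap2 a b v) = hop (Suc 0) (Diop i (gen a * (gen b * v)))"
  by (cases "a = i"; cases "b = i")
    (auto simp: hop_1 swap2_def uact_mult uact_gen uact_lin hop_lin sm_add_right mult_ac)

abbreviation odds :: "int set" where "odds \<equiv> {l. odd l}"

lemma uact_hop_wd:
  assumes "w \<in> words odds n" "Suc i < n"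
  shows "uact x (hop (Suc i) (wd w)) = hop (Suc i) (uact x (wd w))"
  using assms
proof (induction i arbitrary: w n x)
  case 0
  then obtain a b w' where "w = a # b # w'" and odd: "odd a" "odd b"
    by (cases w; cases "tl w") (auto simp: words_def)
  then have w: "wd w = gen a * (gen b * wd w')" by (simp add: gen_wd)
  show ?case by (cases x) (simp_all add: w odd hop_1 Eop_swap2 Fop_swap2 Dop_swap2 Diop_swap2)
next
  case (Suc i)
  obtain l w' k where w: "n = Suc k" "w = l # w'" "w' \<in> words odds k"
    using Suc.prems by (cases n) (auto elim: Cons_words)
  have "uact y (hop (Suc i) (wd w')) = hop (Suc i) (uact y (wd w'))" for y
    using Suc w by auto
  moreover have "Kinvop j (hop (Suc i) (wd w')) = hop (Suc i) (Kinvop j (wd w'))" for j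
    by (simp add: Kinvop_def calculation uact_wd uact_lin hop_lin)
  ultimately show ?case
    by (cases x) (simp_all add: w gen_wd[symmetric, of l w'] hop_Suc_Suc hop_lin uact_mult uact_gen Kop_gen)
qed

lemma uact_hop:
  assumes "v \<in> wspan (words odds n)" "1 \<le> i" "i < n"
  shows "uact x (hop i v) = hop i (uact x v)"
proof (rule lin_eq_wspan[OF lin_uact_comp lin_hop_comp assms(1)])
  show "uact x (hop i (wd w)) = hop i (uact x (wd w))" if "w \<in> words odds n" for w
    using uact_hop_wd[OF that, of "i - 1"] assms by simp
qed simp_all

definition Bop :: "int \<Rightarrow> int falg \<Rightarrow> int falg" where
  "Bop i = act uact (B i)"

lemma Bop_eq: "Bop i v = (if i = 0 then sm (inverse q) (Eop 0 (Kinvop 0 v)) + Fop 0 v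
    else Eop i (Kinvop (- i) v) + Fop (- i) v)"
  by (simp add: Bop_def B_def act_simps act_K)

lemma lin_Bop [simp]: "lin (Bop i)"
  unfolding Bop_def by (rule lin_act2) simp

text \<open>For \<open>i \<noteq> 0\<close>, \<open>B i\<close> acts on head and tail as \<open>B i
  \<otimes> Kinv (- i) + K i * Kinv (- i) \<otimes> E i * Kinv (- i) + 1 \<otimes> F (- i)\<close>,
  and every left leg commutes with \<open>v_l \<mapsto> v_{-l}\<close> on one letter: this is the
  coideal property at work. For \<open>i = 0\<close>, \<open>E 0 * Kinv 0\<close> sends the letter
  \<open>1\<close> to \<open>q\<close> times \<open>-1\<close>, and the factor
  \<open>inverse q\<close> in \<open>B 0\<close> makes the exchange of \<open>1\<close> and
  \<open>-1\<close> symmetric.\<close>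

lemma Bop_hop_0: "odd l \<Longrightarrow> Bop i (gen (- l) * v) = hop 0 (Bop i (gen l * v))"
proof -
  assume "odd l"
  then obtain k where l: "l = 2 * k + 1" by (auto elim!: oddE)
  show ?thesis
  proof (cases "i = 0")
    case True
    consider "k = 0" | "k = -1" | "k \<noteq> 0" "k \<noteq> -1" by auto
    then show ?thesis
      by cases (auto simp: l True Bop_eq uact_mult uact_gen Kop_gen uact_lin kap_def hop_0 hop_lin sm_add_right)
  next
    case False
    consider "k = i" | "k = -i" | "k = i - 1" | "k = - i - 1" | "k \<notin> {i, -i, i - 1, -i - 1}" by auto
    then show ?thesis
      using False by cases (auto simp: l Bop_eq uact_mult uact_gen Kop_gen uact_lin kap_def hop_0 hop_lin sm_add_right)
  qed
qed

lemma D_hop_0: "Dop j (Dop (- j) (gen (- l) * v)) = hop 0 (Dop j (Dop (- j) (gen l * v)))"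
  by (auto simp: uact_mult uact_gen uact_lin hop_0 hop_lin)
lemma Di_hop_0: "Diop (- j) (Diop j (gen (- l) * v)) = hop 0 (Diop (- j) (Diop j (gen l * v)))"
  by (auto simp: uact_mult uact_gen uact_lin hop_0 hop_lin)

lemma hop_0_commute:
  assumes T: "lin T" "\<And>l v. odd l \<Longrightarrow> T (gen (- l) * v) = hop 0 (T (gen l * v))"
    and v: "v \<in> wspan (words odds n)" "n \<ge> 1"
  shows "T (hop 0 v) = hop 0 (T v)"
proof (rule lin_eq_wspan[OF lin_comp[OF T(1) lin_hop] lin_comp[OF lin_hop T(1)] v(1)])
  fix w assume "w \<in> words odds n"
  then obtain l w' where "w = l # w'" "odd l" using v(2) by (cases w) (auto simp: words_def)
  then show "T (hop 0 (wd w)) = hop 0 (T (wd w))"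
    using T(2)[of l "wd w'"] by (simp add: gen_wd[symmetric, of l w'] hop_0)
qed

section \<open>The two actions as algebras of operators\<close>

lemma cls_hom:
  assumes "R \<subseteq> carrier (free_alg G)"
  shows "cls G R \<in> ring_hom (free_alg G) (pres_alg G R)"
  unfolding cls_def[abs_def] pres_alg_def
  by (rule ideal.rcos_ring_hom[OF ring.genideal_ideal[OF free_alg_ring assms]])

lemma carrier_pres_alg: "carrier (pres_alg G R) = cls G R ` carrier (free_alg G)"
  by (auto simp: pres_alg_def cls_def FactRing_def A_RCOSETS_def')

lemma pres_alg_ring: "R \<subseteq> carrier (free_alg G) \<Longrightarrow> ring (pres_alg G R)"
  unfolding pres_alg_def
  by (rule ideal.quotient_is_ring[OF ring.genideal_ideal[OF free_alg_ring]])

lemmas cls_simps = ring_hom_add[OF cls_hom, simplified] ring_hom_mult[OF cls_hom, simplified]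
  ring_hom_one[OF cls_hom, simplified]

lemma free_alg_uminus: "p \<in> carrier (free_alg G) \<Longrightarrow> - p \<in> carrier (free_alg G)"
  by (simp add: free_alg_def)

lemma cls_uminus:
  assumes R: "R \<subseteq> carrier (free_alg G)" and p: "p \<in> carrier (free_alg G)"
  shows "\<ominus>\<^bsub>pres_alg G R\<^esub> cls G R p = cls G R (- p)"
proof -
  interpret P: ring "pres_alg G R" by (rule pres_alg_ring[OF R])
  have carr: "cls G R p \<in> carrier (pres_alg G R)" if "p \<in> carrier (free_alg G)" for p
    using that by (auto simp: carrier_pres_alg)
  have z: "cls G R 0 \<oplus>\<^bsub>pres_alg G R\<^esub> cls G R 0 = cls G R 0"
    using cls_simps(1)[OF R, of 0 0] by (simp add: free_alg_consts)
  then have "cls G R 0 = \<zero>\<^bsub>pres_alg G R\<^esub>"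
    using carr[of 0] P.add.l_cancel_one by (simp add: free_alg_consts)
  then have "cls G R (- p) \<oplus>\<^bsub>pres_alg G R\<^esub> cls G R p = \<zero>\<^bsub>pres_alg G R\<^esub>"
    using cls_simps(1)[OF R, of "- p" p] p by (simp add: free_alg_uminus)
  then show ?thesis
    using p carr by (simp add: P.minus_equality free_alg_uminus)
qed

lemma ideal_free_algI:
  assumes J: "J \<subseteq> carrier (free_alg G)" "0 \<in> J"
    and add: "\<And>a b. a \<in> J \<Longrightarrow> b \<in> J \<Longrightarrow> a + b \<in> J" and um: "\<And>a. a \<in> J \<Longrightarrow> - a \<in> J"
    and "\<And>a x. a \<in> J \<Longrightarrow> x \<in> carrier (free_alg G) \<Longrightarrow> x * a \<in> J"
    and "\<And>a x. a \<in> J \<Longrightarrow> x \<in> carrier (free_alg G) \<Longrightarrow> a * x \<in> J"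
  shows "ideal J (free_alg G)"
proof (rule idealI[OF free_alg_ring])
  interpret ring "free_alg G" by (rule free_alg_ring)
  show "subgroup J (add_monoid (free_alg G))"
  proof (rule add.subgroupI)
    fix a assume a: "a \<in> J"
    have "\<ominus>\<^bsub>free_alg G\<^esub> a = - a"
      using a J by (intro minus_equality) (auto simp: free_alg_uminus)
    then show "\<ominus>\<^bsub>free_alg G\<^esub> a \<in> J" using um[OF a] by simp
  qed (use J add in auto)
qed (use assms in auto)

text \<open>The generated ideal is only bounded from above: any ideal that contains the relations
  and leaves \<open>f\<close> unchanged makes \<open>f\<close> constant on the coset. In both uses
  \<open>J\<close> is an annihilator.\<close>

lemma the_elem_cls:
  assumes J: "ideal J (free_alg G)" "R \<subseteq> J" and f: "\<And>x. x \<in> J \<Longrightarrow> f (x + p) = f p"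
  shows "the_elem (f ` cls G R p) = f p"
proof -
  interpret ring "free_alg G" by (rule free_alg_ring)
  have "Idl\<^bsub>free_alg G\<^esub> R \<subseteq> J" by (rule genideal_minimal[OF J])
  moreover have "\<zero>\<^bsub>free_alg G\<^esub> \<in> Idl\<^bsub>free_alg G\<^esub> R"
  proof (rule additive_subgroup.zero_closed[OF ideal.axioms(1)[OF genideal_ideal]])
    show "R \<subseteq> carrier (free_alg G)" using J ideal.Icarr by fastforce
  qed
  ultimately have "f ` cls G R p = {f p}"
    using f by (force simp: cls_def a_r_coset_def')
  then show ?thesis by simp
qed

definition uact_op :: "nat \<Rightarrow> nat \<Rightarrow> ugen falg \<Rightarrow> int falg \<Rightarrow> int falg" where
  "uact_op m n p = restrict (act uact p) (tens m n)"
definition hact_op :: "nat \<Rightarrow> nat \<Rightarrow> nat falg \<Rightarrow> int falg \<Rightarrow> int falg" where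
  "hact_op m n p = restrict (hecke_rep p) (tens m n)"

lemma halfs_uminus: "l \<in> halfs m \<Longrightarrow> - l \<in> halfs m" by (simp add: halfs_def)

lemma tens_words: "v \<in> tens m n \<Longrightarrow> v \<in> wspan (words UNIV n)" "v \<in> tens m n \<Longrightarrow> v \<in> wspan (words odds n)"
  by (auto simp: tens_wspan wspan_def words_def halfs_def)

lemma tens_closed:
  "v \<in> tens m n \<Longrightarrow> w \<in> tens m n \<Longrightarrow> v + w \<in> tens m n" "v \<in> tens m n \<Longrightarrow> sm c v \<in> tens m n"
  by (simp_all add: tens_wspan wspan_add wspan_sm)

lemma act_tens:
  assumes p: "p \<in> carrier (free_alg (ugens m))" and v: "v \<in> tens m n"
  shows "act uact p v \<in> tens m n"
proof -
  have "foldr uact ws v \<in> tens m n" if "set ws \<subseteq> ugens m" for ws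
    using that v unfolding tens_wspan by (induction ws) (auto intro: uact_words alphabet_ok_halfs)
  then show ?thesis using p unfolding act_def lext_def tens_wspan
    by (intro wspan_sum wspan_sm) (auto simp: free_alg_def)
qed

lemma hecke_rep_tens:
  assumes p: "p \<in> carrier (free_alg (hecke_gens n))" and v: "v \<in> tens m n"
  shows "hecke_rep p v \<in> tens m n"
proof -
  have "fold hop ws v \<in> tens m n" if "set ws \<subseteq> hecke_gens n" for ws
    using that v unfolding tens_wspan
    by (induction ws arbitrary: v) (auto intro: hop_words halfs_uminus simp: hecke_gens_def)
  then show ?thesis using p unfolding hecke_rep_lext lext_def tens_wspan
    by (intro wspan_sum wspan_sm) (auto simp: free_alg_def)
qed

lemma Uq_act_cls:
  assumes n: "n \<ge> 1" and p: "p \<in> carrier (free_alg (ugens m))"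
  shows "Uq_act m n (cls (ugens m) (uq_rels m) p) = uact_op m n p"
proof -
  let ?J = "{x \<in> carrier (free_alg (ugens m)). \<forall>v. act uact x v = 0}"
  have "ideal ?J (free_alg (ugens m))"
    by (rule ideal_free_algI)
      (auto simp: act_simps free_alg_closed free_alg_uminus lin_rules[OF lin_act1] lin_rules[OF lin_act2[OF lin_uact]])
  moreover have "uq_rels m \<subseteq> ?J" using uq_rels_carrier uq_rels_act by blast
  moreover have tr: "restrict (tens_rep n x) (tens m n) = uact_op m n x" for x
    using n by (cases n) (auto simp: uact_op_def tens_rep_act[OF tens_words(1)] intro!: restrict_ext)
  ultimately show ?thesis
    unfolding Uq_act_def tr by (intro the_elem_cls[of ?J]) (auto simp: uact_op_def act_add)
qed

lemma Hecke_act_cls: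
  assumes n: "n \<ge> 1" and p: "p \<in> carrier (free_alg (hecke_gens n))"
  shows "Hecke_act m n (cls (hecke_gens n) (hecke_rels n) p) = hact_op m n p"
proof -
  let ?J = "{x \<in> carrier (free_alg (hecke_gens n)). \<forall>v\<in>tens m n. hecke_rep x v = 0}"
  have "ideal ?J (free_alg (hecke_gens n))"
    by (rule ideal_free_algI)
      (auto simp: hecke_rep_simps free_alg_closed free_alg_uminus lin_rules[OF lin_hecke_rep1]
        lin_rules[OF lin_hecke_rep2] hecke_rep_tens)
  moreover have "hecke_rels n \<subseteq> ?J"
    using hecke_rels_carrier[OF n] hecke_rels_act[OF _ n] tens_words by blast
  ultimately show ?thesis
    unfolding Hecke_act_def hact_op_def
    by (intro the_elem_cls[of ?J]) (auto simp: hecke_rep_add intro!: restrict_ext)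
qed

definition hhf_gens :: "nat \<Rightarrow> ugen falg set" where
  "hhf_gens m = range scalar \<union>
      {D j * D (- j) | j. j \<in> halfs m} \<union> {Dinv (- j) * Dinv j | j. j \<in> halfs m} \<union>
      {B i | i. \<bar>i\<bar> \<le> int m - 1}"

lemma hhf_gens_carrier: "hhf_gens m \<subseteq> carrier (free_alg (ugens m))"
proof -
  have "B i \<in> carrier (free_alg (ugens m))" if "\<bar>i\<bar> \<le> int m - 1" for i
    using that half_neighbours[of i m] half_neighbours[of "- i" m] half_neighbours[of 0 m]
    by (auto simp: B_def Kinv_def ugens_iff free_alg_gen intro!: free_alg_closed)
  then show ?thesis
    by (auto simp: hhf_gens_def free_alg_gen ugens_iff halfs_uminus intro!: free_alg_closed)
qed

text \<open>\<open>generate_ring\<close> transported to the free algebra, so that statements about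
  \<open>Hhf\<close> can be proved by induction on representatives.\<close>

inductive_set hhf_elems :: "nat \<Rightarrow> ugen falg set" for m where
  one: "1 \<in> hhf_elems m"
| gen: "p \<in> hhf_gens m \<Longrightarrow> p \<in> hhf_elems m"
| uminus: "p \<in> hhf_elems m \<Longrightarrow> - p \<in> hhf_elems m"
| add: "p \<in> hhf_elems m \<Longrightarrow> r \<in> hhf_elems m \<Longrightarrow> p + r \<in> hhf_elems m"
| mult: "p \<in> hhf_elems m \<Longrightarrow> r \<in> hhf_elems m \<Longrightarrow> p * r \<in> hhf_elems m"

lemma hhf_elems_carrier: "p \<in> hhf_elems m \<Longrightarrow> p \<in> carrier (free_alg (ugens m))"
  by (induction rule: hhf_elems.induct)
    (use hhf_gens_carrier in \<open>auto intro: free_alg_closed free_alg_uminus\<close>)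

lemma Hhf_eq: "Hhf m = cls (ugens m) (uq_rels m) ` hhf_elems m"
proof -
  note R = uq_rels_carrier[of m]
  have *: "Hhf m = generate_ring (pres_alg (ugens m) (uq_rels m)) (cls (ugens m) (uq_rels m) ` hhf_gens m)"
    by (simp add: Hhf_def Uq_def hhf_gens_def)
  show ?thesis
  proof (intro equalityI subsetI)
    fix X assume "X \<in> Hhf m"
    then show "X \<in> cls (ugens m) (uq_rels m) ` hhf_elems m" unfolding *
    proof (induction rule: generate_ring.induct)
      case one then show ?case using cls_simps(3)[OF R] hhf_elems.one by (auto simp: image_iff)
    next
      case (incl h) then show ?case using hhf_elems.gen by auto
    next
      case (a_inv h) then show ?case
        using cls_uminus[OF R] hhf_elems.uminus hhf_elems_carrier by (auto simp: image_iff)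
    next
      case (eng_add h1 h2)
      then obtain p r where pr: "p \<in> hhf_elems m" "r \<in> hhf_elems m"
        "h1 = cls (ugens m) (uq_rels m) p" "h2 = cls (ugens m) (uq_rels m) r"
        by auto
      show ?case
        unfolding pr cls_simps(1)[OF R hhf_elems_carrier[OF pr(1)] hhf_elems_carrier[OF pr(2)], symmetric]
        using hhf_elems.add[OF pr(1,2)] by (rule imageI)
    next
      case (eng_mult h1 h2)
      then obtain p r where pr: "p \<in> hhf_elems m" "r \<in> hhf_elems m"
        "h1 = cls (ugens m) (uq_rels m) p" "h2 = cls (ugens m) (uq_rels m) r"
        by auto
      show ?case
        unfolding pr cls_simps(2)[OF R hhf_elems_carrier[OF pr(1)] hhf_elems_carrier[OF pr(2)], symmetric]
        using hhf_elems.mult[OF pr(1,2)] by (rule imageI)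
    qed
  next
    fix X assume "X \<in> cls (ugens m) (uq_rels m) ` hhf_elems m"
    then obtain p where p: "p \<in> hhf_elems m" and X: "X = cls (ugens m) (uq_rels m) p" by auto
    from p show "X \<in> Hhf m" unfolding X *
    proof (induction rule: hhf_elems.induct)
      case one then show ?case using cls_simps(3)[OF R] generate_ring.one by metis
    next
      case (gen p) then show ?case by (auto intro: generate_ring.incl)
    next
      case (uminus p) then show ?case using cls_uminus[OF R] generate_ring.a_inv hhf_elems_carrier by metis
    next
      case (add p r) then show ?case using cls_simps(1)[OF R] generate_ring.eng_add hhf_elems_carrier by metis
    next
      case (mult p r) then show ?case using cls_simps(2)[OF R] generate_ring.eng_mult hhf_elems_carrier by metis
    qed
  qed
qed

lemma Uq_image: "n \<ge> 1 \<Longrightarrow> Uq_act m n ` Hhf m = uact_op m n ` hhf_elems m"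
  by (simp add: Hhf_eq image_image Uq_act_cls hhf_elems_carrier cong: image_cong)

lemma Hecke_image:
  "n \<ge> 1 \<Longrightarrow> Hecke_act m n ` carrier (Hecke n) = hact_op m n ` carrier (free_alg (hecke_gens n))"
  by (simp add: Hecke_def carrier_pres_alg image_image Hecke_act_cls cong: image_cong)

lemma endosI:
  assumes "lin T" "\<And>v. v \<in> tens m n \<Longrightarrow> T v \<in> tens m n"
  shows "restrict T (tens m n) \<in> endos m n"
  using assms tens_closed(1)[of _ m n] tens_closed(2)[of _ m n]
  by (auto simp: endos_def lin_rules simp flip: sm_def)

lemma uact_op_endos: "p \<in> hhf_elems m \<Longrightarrow> uact_op m n p \<in> endos m n"
  unfolding uact_op_def by (rule endosI) (auto intro: lin_act2 act_tens hhf_elems_carrier)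
lemma hact_op_endos: "p \<in> carrier (free_alg (hecke_gens n)) \<Longrightarrow> hact_op m n p \<in> endos m n"
  unfolding hact_op_def by (rule endosI) (auto intro: lin_hecke_rep2 hecke_rep_tens)

lemma hhf_hop_commute:
  assumes "p \<in> hhf_elems m" "i < n" "v \<in> tens m n"
  shows "act uact p (hop i v) = hop i (act uact p v)"
  using assms(1,3)
proof (induction arbitrary: v rule: hhf_elems.induct)
  case one then show ?case by (simp add: act_simps)
next
  case (gen p)
  note v = tens_words(2)[OF gen(2)]
  show ?case
  proof (cases "i = 0")
    case False
    \<comment> \<open>For \<open>i \<ge> 1\<close> the whole quantum group commutes with
      \<open>hop i\<close>; only \<open>hop 0\<close> singles out the coideal subalgebra.\<close>
    have "act uact r (hop i u) = hop i (act uact r u)" if "u \<in> tens m n" "r \<in> carrier (free_alg (ugens m))" for r u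
    proof -
      have "foldr uact ws (hop i u) = hop i (foldr uact ws u) \<and> foldr uact ws u \<in> tens m n"
        if "set ws \<subseteq> ugens m" for ws
        using that
      proof (induction ws)
        case Nil then show ?case using \<open>u \<in> tens m n\<close> by simp
      next
        case (Cons x ws)
        then show ?case using uact_hop[OF tens_words(2)[of _ m n], of "foldr uact ws u" i x] False assms(2)
          by (auto simp: tens_wspan intro: uact_words alphabet_ok_halfs)
      qed
      then show ?thesis using that(2)
        unfolding act_def lin_lext_push[OF lin_hop] by (intro lext_cong) (auto simp: free_alg_def)
    qed
    then show ?thesis using gen hhf_gens_carrier by auto
  next
    case True
    have n: "n \<ge> 1" using assms(2) by simp
    have B: "act uact (B i) (hop 0 v) = hop 0 (act uact (B i) v)" for i
      by (rule hop_0_commute[OF _ _ v n]) (simp_all add: Bop_hop_0 flip: Bop_def)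
    have D: "Dop j (Dop (- j) (hop 0 v)) = hop 0 (Dop j (Dop (- j) v))" for j
      by (rule hop_0_commute[where T = "\<lambda>v. Dop j (Dop (- j) v)", OF lin_uact_comp[OF lin_uact] _ v n])
        (rule D_hop_0)
    have Di: "Diop (- j) (Diop j (hop 0 v)) = hop 0 (Diop (- j) (Diop j v))" for j
      by (rule hop_0_commute[where T = "\<lambda>v. Diop (- j) (Diop j v)", OF lin_uact_comp[OF lin_uact] _ v n])
        (rule Di_hop_0)
    show ?thesis using gen(1) unfolding True hhf_gens_def
      by (auto simp: act_simps D Di B hop_lin)
  qed
next
  case (uminus p)
  then show ?case by (simp add: lin_uminus[OF lin_act1] hop_lin)
next
  case (add p r)
  then show ?case by (simp add: act_add hop_lin)
next
  case (mult p r)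
  then show ?case by (simp add: act_mult act_tens hhf_elems_carrier)
qed

lemma hhf_hecke_commute:
  assumes "p \<in> hhf_elems m" "r \<in> carrier (free_alg (hecke_gens n))" "v \<in> tens m n"
  shows "act uact p (hecke_rep r v) = hecke_rep r (act uact p v)"
proof -
  have "act uact p (fold hop ws u) = fold hop ws (act uact p u)"
    if "set ws \<subseteq> hecke_gens n" "u \<in> tens m n" for ws u
    using that
  proof (induction ws arbitrary: u)
    case (Cons i ws)
    then have "hop i u \<in> tens m n" unfolding tens_wspan
      by (auto intro!: hop_words halfs_uminus simp: hecke_gens_def)
    then show ?case using Cons hhf_hop_commute[OF assms(1), of i n u] by (simp add: hecke_gens_def)
  qed simp
  then show ?thesis using assms
    unfolding hecke_rep_lext lin_lext_push[OF lin_act2[OF lin_uact]]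
    by (intro lext_cong) (auto simp: free_alg_def)
qed

section \<open>Specialization at $q = 1$\<close>

text \<open>Evaluation at \<open>q = 1\<close> as a relation: it is partial, defined exactly on the
  local ring of fractions without a pole at \<open>1\<close>.\<close>

definition spec1 :: "qfield \<Rightarrow> rat \<Rightarrow> bool" where
  "spec1 x r \<longleftrightarrow> (\<exists>a b. x = Fract a b \<and> poly b 1 \<noteq> 0 \<and> r = poly a 1 / poly b 1)"

lemma spec1_Fract: "poly b 1 \<noteq> 0 \<Longrightarrow> spec1 (Fract a b) (poly a 1 / poly b 1)"
  by (auto simp: spec1_def)

lemma spec1E:
  assumes "spec1 x r"
  obtains a b where "x = Fract a b" "poly b 1 \<noteq> 0" "r = poly a 1 / poly b 1"
  using assms unfolding spec1_def by blast

lemma spec1_unique: "spec1 x r \<Longrightarrow> spec1 x s \<Longrightarrow> r = s"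
proof -
  assume "spec1 x r" "spec1 x s"
  from this(1) obtain a b where "x = Fract a b" "poly b 1 \<noteq> 0" "r = poly a 1 / poly b 1" by (rule spec1E)
  moreover from \<open>spec1 x s\<close> obtain c d
    where "x = Fract c d" "poly d 1 \<noteq> 0" "s = poly c 1 / poly d 1" by (rule spec1E)
  moreover note x = calculation
  ultimately have "a * d = c * b" by (metis eq_fract(1) poly_0)
  then have "poly a 1 * poly d 1 = poly c 1 * poly b 1" by (metis poly_mult)
  with x show ?thesis by (simp add: frac_eq_eq)
qed

lemma spec1_add: "spec1 x r \<Longrightarrow> spec1 y s \<Longrightarrow> spec1 (x + y) (r + s)"
proof -
  assume "spec1 x r" "spec1 y s"
  from this(1) obtain a b where "x = Fract a b" "poly b 1 \<noteq> 0" "r = poly a 1 / poly b 1" by (rule spec1E)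
  moreover from \<open>spec1 y s\<close> obtain c d
    where "y = Fract c d" "poly d 1 \<noteq> 0" "s = poly c 1 / poly d 1" by (rule spec1E)
  moreover note x = calculation
  ultimately have "x + y = Fract (a * d + c * b) (b * d)" by (metis add_fract poly_0)
  with x show ?thesis using spec1_Fract[of "b * d" "a * d + c * b"] by (simp add: add_frac_eq)
qed

lemma spec1_mult: "spec1 x r \<Longrightarrow> spec1 y s \<Longrightarrow> spec1 (x * y) (r * s)"
proof -
  assume "spec1 x r" "spec1 y s"
  from this(1) obtain a b where "x = Fract a b" "poly b 1 \<noteq> 0" "r = poly a 1 / poly b 1" by (rule spec1E)
  moreover from \<open>spec1 y s\<close> obtain c d
    where "y = Fract c d" "poly d 1 \<noteq> 0" "s = poly c 1 / poly d 1" by (rule spec1E)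
  moreover note x = calculation
  ultimately show ?thesis using spec1_Fract[of "b * d" "a * c"] by simp
qed

lemma spec1_const: "spec1 (Fract [:c:] 1) c"
  using spec1_Fract[of 1 "[:c:]"] by simp

lemma spec1_0 [simp]: "spec1 0 0" and spec1_1 [simp]: "spec1 1 1"
  using spec1_Fract[of 1 0] spec1_Fract[of 1 1] by (simp_all add: fract_collapse)

lemma spec1_minus: "spec1 x r \<Longrightarrow> spec1 (- x) (- r)"
proof -
  assume "spec1 x r"
  moreover have "spec1 (- 1) (- 1)" using spec1_Fract[of 1 "- 1"] by (simp add: One_fract_def)
  ultimately show ?thesis using spec1_mult by fastforce
qed

lemma spec1_diff: "spec1 x r \<Longrightarrow> spec1 y s \<Longrightarrow> spec1 (x - y) (r - s)"
  using spec1_add[OF _ spec1_minus] by fastforce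

lemma spec1_sum: "(\<And>i. i \<in> I \<Longrightarrow> spec1 (f i) (g i)) \<Longrightarrow> spec1 (\<Sum>i\<in>I. f i) (\<Sum>i\<in>I. g i)"
  by (induction I rule: infinite_finite_induct) (auto intro: spec1_add)

lemma spec1_power: "spec1 x r \<Longrightarrow> spec1 (x ^ k) (r ^ k)"
  by (induction k) (auto intro: spec1_mult)

lemma spec1_q [simp]: "spec1 q 1" "spec1 (inverse q) 1"
  using spec1_Fract[of 1 "[:0, 1:]"] spec1_Fract[of "[:0, 1:]" 1] by (simp_all add: q_def)

lemma q_minus_1: "q - 1 = Fract [:-1, 1:] 1"
  by (simp add: q_def One_fract_def one_pCons)

lemma q_neq_1 [simp]: "q \<noteq> 1"
proof -
  have "q - 1 \<noteq> 0" by (simp add: q_minus_1 Zero_fract_def eq_fract)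
  then show ?thesis by simp
qed

definition regular :: "qfield \<Rightarrow> bool" where "regular x \<longleftrightarrow> (\<exists>r. spec1 x r)"

lemma spec1_0_dvd:
  assumes "spec1 x 0"
  obtains y where "x = (q - 1) * y" "regular y"
proof -
  obtain a b where x: "x = Fract a b" "poly b 1 \<noteq> 0" "poly a 1 = 0"
    using assms unfolding spec1_def by auto
  then obtain c where "a = [:-1, 1:] * c" by (auto simp: poly_eq_0_iff_dvd)
  then have "x = (q - 1) * Fract c b" using x by (simp add: q_minus_1)
  then show thesis using that spec1_Fract[OF x(2)] by (auto simp: regular_def)
qed

text \<open>The local ring at \<open>1\<close> has no nonzero element divisible by all powers of
  \<open>q - 1\<close>: the order of vanishing of a numerator bounds the exponent.\<close>

lemma regular_divisible_zero:
  assumes "regular x" and div: "\<And>k. \<exists>y. regular y \<and> x = (q - 1) ^ k * y"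
  shows "x = 0"
proof (rule ccontr)
  assume "x \<noteq> 0"
  obtain a b where x: "x = Fract a b" "poly b 1 \<noteq> 0" using assms(1) by (auto simp: regular_def spec1_def)
  with \<open>x \<noteq> 0\<close> have a: "a \<noteq> 0" by (auto simp: fract_collapse)
  define k where "k = Suc (Polynomial.order 1 a)"
  obtain y where "regular y" and xy: "x = (q - 1) ^ k * y" using div by blast
  then obtain c d where y: "y = Fract c d" "poly d 1 \<noteq> 0" by (auto simp: regular_def spec1_def)
  have "(q - 1) ^ k = Fract ([:-1, 1:] ^ k) 1"
  proof (induction k)
    case (Suc k)
    show ?case unfolding power_Suc Suc.IH unfolding q_minus_1 mult_fract by (simp only: mult_1)
  qed (simp add: One_fract_def)
  with xy x y have "Fract a b = Fract ([:-1, 1:] ^ k * c) d" by simp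
  moreover have "b \<noteq> 0" "d \<noteq> 0" using x y by auto
  ultimately have "a * d = [:-1, 1:] ^ k * c * b" by (simp add: eq_fract)
  then have "[:-1, 1:] ^ k dvd a * d" by (simp add: mult.assoc)
  then have "k \<le> Polynomial.order 1 (a * d)" using a \<open>d \<noteq> 0\<close> by (simp add: order_divides)
  also have "\<dots> = Polynomial.order 1 a" using a \<open>d \<noteq> 0\<close> y(2) by (simp add: order_mult order_0I)
  finally show False by (simp add: k_def)
qed

lemma clear_denominators:
  assumes "finite I"
  shows "\<exists>d. d \<noteq> 0 \<and> (\<forall>i\<in>I. regular (d * x i))"
  using assms
proof (induction I)
  case empty then show ?case by (intro exI[of _ 1]) simp
next
  case (insert i I)
  then obtain d where d: "d \<noteq> 0" "\<forall>i\<in>I. regular (d * x i)" by auto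
  obtain a b where x: "x i = Fract a b" "b \<noteq> 0" by (cases "x i") auto
  have b: "spec1 (Fract b 1) (poly b 1)" using spec1_Fract[of 1 b] by simp
  obtain e f where d': "d = Fract e f" "f \<noteq> 0" by (cases d) auto
  have f: "spec1 (Fract f 1) (poly f 1)" using spec1_Fract[of 1 f] by simp
  \<comment> \<open>\<open>b\<close> clears the new entry, and \<open>f\<close> clears the
    multiplier \<open>d\<close>, which is itself only a fraction.\<close>
  let ?c = "Fract b 1 * Fract f 1"
  have "regular (?c * (d * x j))" if "j \<in> I" for j
    using d(2) that spec1_mult[OF spec1_mult[OF b f]] unfolding regular_def by blast
  moreover have "?c * d * x i = Fract (e * a) 1"
    using x d' by (simp add: eq_fract)
  moreover have "spec1 (Fract (e * a) 1) (poly (e * a) 1)" using spec1_Fract[of 1 "e * a"] by simp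
  moreover have "?c * d \<noteq> 0" using d x d' by (simp add: Zero_fract_def eq_fract)
  ultimately show ?case
    by (intro exI[of _ "?c * d"]) (auto simp: regular_def mult.assoc)
qed

section \<open>Separating functionals and descent along powers of \<open>q - 1\<close>\<close>

definition fsubspace :: "('i \<Rightarrow> 'f::field) set \<Rightarrow> bool" where
  "fsubspace V \<longleftrightarrow> (\<lambda>_. 0) \<in> V \<and> (\<forall>f\<in>V. \<forall>g\<in>V. (\<lambda>i. f i + g i) \<in> V) \<and> (\<forall>c. \<forall>f\<in>V. (\<lambda>i. c * f i) \<in> V)"

lemma fsubspace_add: "fsubspace V \<Longrightarrow> f \<in> V \<Longrightarrow> g \<in> V \<Longrightarrow> (\<lambda>i. f i + g i) \<in> V"
  by (simp add: fsubspace_def)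
lemma fsubspace_scale: "fsubspace V \<Longrightarrow> f \<in> V \<Longrightarrow> (\<lambda>i. c * f i) \<in> V"
  by (simp add: fsubspace_def)
lemma fsubspace_diff: "fsubspace V \<Longrightarrow> f \<in> V \<Longrightarrow> g \<in> V \<Longrightarrow> (\<lambda>i. f i - g i) \<in> V"
  using fsubspace_add[OF _ _ fsubspace_scale[of V g "- 1"], of f] by simp

text \<open>Gaussian elimination, one coordinate of \<open>I\<close> at a time. \<open>V\<close>
  consists of functions on the whole type, but only their values on \<open>I\<close> count, so
  elements of \<open>V\<close> with equal restrictions need not be identified.\<close>

lemma separating_functional:
  fixes x :: "'i \<Rightarrow> 'f::field"
  assumes "finite I" "fsubspace V" "\<not> (\<exists>v\<in>V. \<forall>i\<in>I. v i = x i)"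
  shows "\<exists>\<phi>. (\<forall>v\<in>V. (\<Sum>i\<in>I. \<phi> i * v i) = 0) \<and> (\<Sum>i\<in>I. \<phi> i * x i) \<noteq> 0"
  using assms
proof (induction I arbitrary: V x)
  case empty
  then show ?case by (auto simp: fsubspace_def)
next
  case (insert j I)
  show ?case
  proof (cases "\<exists>e\<in>V. e j \<noteq> 0")
    case True
    then obtain e' where e': "e' \<in> V" "e' j \<noteq> 0" by auto
    define e where "e = (\<lambda>i. inverse (e' j) * e' i)"
    have e: "e \<in> V" "e j = 1" using e' insert.prems(1) by (auto simp: e_def fsubspace_def)
    define V0 where "V0 = {v \<in> V. v j = 0}"
    have V0: "fsubspace V0" using insert.prems(1) by (auto simp: V0_def fsubspace_def)
    define x' where "x' = (\<lambda>i. x i - x j * e i)"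
    have cV: "(\<lambda>i. c * e i) \<in> V" for c using e insert.prems(1) by (auto simp: fsubspace_def)
    have "\<not> (\<exists>v\<in>V0. \<forall>i\<in>I. v i = x' i)"
    proof
      assume "\<exists>v\<in>V0. \<forall>i\<in>I. v i = x' i"
      then obtain v where v: "v \<in> V" "v j = 0" "\<forall>i\<in>I. v i = x' i" by (auto simp: V0_def)
      then have "(\<lambda>i. v i + x j * e i) \<in> V" using cV insert.prems(1) by (intro fsubspace_add)
      then show False using v e insert.prems(2) by (force simp: x'_def)
    qed
    from insert.IH[OF V0 this] obtain \<phi> where
      \<phi>: "\<And>v. v \<in> V0 \<Longrightarrow> (\<Sum>i\<in>I. \<phi> i * v i) = 0" "(\<Sum>i\<in>I. \<phi> i * x' i) \<noteq> 0" by blast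
    \<comment> \<open>The value at \<open>j\<close> is chosen so that the functional kills
      \<open>e\<close>, which complements \<open>V0\<close> in \<open>V\<close>.\<close>
    define \<psi> where "\<psi> = \<phi>(j := - (\<Sum>i\<in>I. \<phi> i * e i))"
    have \<psi>: "(\<Sum>i\<in>insert j I. \<psi> i * y i) = (\<Sum>i\<in>I. \<phi> i * (y i - y j * e i))" for y
    proof -
      have "(\<Sum>i\<in>I. \<psi> i * y i) = (\<Sum>i\<in>I. \<phi> i * y i)"
        using insert.hyps by (intro sum.cong) (auto simp: \<psi>_def)
      then show ?thesis using insert.hyps
        by (simp add: \<psi>_def right_diff_distrib sum_subtractf sum_distrib_left mult_ac)
    qed
    have "(\<Sum>i\<in>insert j I. \<psi> i * v i) = 0" if "v \<in> V" for v
      unfolding \<psi> using e fsubspace_diff[OF insert.prems(1) that cV[of "v j"]]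
      by (intro \<phi>(1)) (simp add: V0_def)
    moreover have "(\<Sum>i\<in>insert j I. \<psi> i * x i) \<noteq> 0"
      unfolding \<psi> using \<phi>(2) by (simp add: x'_def)
    ultimately show ?thesis by blast
  next
    case False
    show ?thesis
    proof (cases "x j = 0")
      case True
      then have "\<not> (\<exists>v\<in>V. \<forall>i\<in>I. v i = x i)" using insert.prems(2) False by force
      from insert.IH[OF insert.prems(1) this] obtain \<phi> where
        \<phi>: "\<forall>v\<in>V. (\<Sum>i\<in>I. \<phi> i * v i) = 0" "(\<Sum>i\<in>I. \<phi> i * x i) \<noteq> 0" by blast
      then show ?thesis using False True insert.hyps by (intro exI[of _ \<phi>]) auto
    next
      case x: False
      have "(\<Sum>i\<in>I. of_bool (i = j) * y i) = 0" for y :: "'i \<Rightarrow> 'f"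
        using insert.hyps by (intro sum.neutral) auto
      then show ?thesis using False x insert.hyps
        by (intro exI[of _ "\<lambda>i. of_bool (i = j)"]) auto
    qed
  qed
qed

text \<open>The correction \<open>u\<close> is chosen in \<open>Phi\<close>, where the functional
  vanishes, while \<open>(y - u) / (q - 1)\<close> stays in \<open>Psi\<close> and is regular again.
  This is why the hypothesis \<open>spec\<close> concerns all regular members of \<open>Psi\<close>
  and not just \<open>x\<close>.\<close>

theorem specialization:
  assumes I: "finite I" and Phi: "fsubspace Phi" and Psi: "fsubspace Psi" and sub: "Phi \<subseteq> Psi"
    and spec: "\<And>x r. x \<in> Psi \<Longrightarrow> (\<And>i. i \<in> I \<Longrightarrow> spec1 (x i) (r i)) \<Longrightarrow>
      \<exists>y\<in>Phi. \<forall>i\<in>I. spec1 (y i) (r i)"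
    and x: "x \<in> Psi"
  shows "\<exists>y\<in>Phi. \<forall>i\<in>I. y i = x i"
proof (rule ccontr)
  assume "\<not> ?thesis"
  from separating_functional[OF I Phi this] obtain \<phi>0 where
    \<phi>0: "\<And>v. v \<in> Phi \<Longrightarrow> (\<Sum>i\<in>I. \<phi>0 i * v i) = 0" "(\<Sum>i\<in>I. \<phi>0 i * x i) \<noteq> 0" by blast
  obtain d where d: "d \<noteq> 0" "\<And>i. i \<in> I \<Longrightarrow> regular (d * \<phi>0 i)"
    using clear_denominators[OF I, of \<phi>0] by blast
  obtain c where c: "c \<noteq> 0" "\<And>i. i \<in> I \<Longrightarrow> regular (c * x i)"
    using clear_denominators[OF I, of x] by blast
  \<comment> \<open>Scaling by \<open>d\<close> gives regular coefficients, so \<open>ev\<close> is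
    regular on regular vectors; it still vanishes on \<open>Phi\<close>.\<close>
  define ev where "ev = (\<lambda>y. \<Sum>i\<in>I. (d * \<phi>0 i) * y i)"
  have ev_reg: "regular (ev y)" if reg: "\<And>i. i \<in> I \<Longrightarrow> regular (y i)" for y
  proof -
    have "\<exists>r. \<forall>i\<in>I. spec1 ((d * \<phi>0 i) * y i) (r i)"
      using d(2) reg spec1_mult unfolding regular_def by (intro bchoice) blast
    then obtain r where r: "\<And>i. i \<in> I \<Longrightarrow> spec1 ((d * \<phi>0 i) * y i) (r i)" by blast
    have "spec1 (ev y) (\<Sum>i\<in>I. r i)" unfolding ev_def by (rule spec1_sum[OF r])
    then show ?thesis by (auto simp: regular_def)
  qed
  have ev_Phi: "ev v = 0" if "v \<in> Phi" for v
    using \<phi>0(1)[OF that] by (simp add: ev_def mult.assoc flip: sum_distrib_left)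
  have key: "\<exists>z. regular z \<and> ev y = (q - 1) ^ k * z"
    if "y \<in> Psi" "\<And>i. i \<in> I \<Longrightarrow> regular (y i)" for k y
    using that
  proof (induction k arbitrary: y)
    case 0 then show ?case using ev_reg by auto
  next
    case (Suc k)
    obtain r where r: "\<And>i. i \<in> I \<Longrightarrow> spec1 (y i) (r i)"
      using Suc.prems(2) unfolding regular_def by metis
    from spec[OF Suc.prems(1) r] obtain u where u: "u \<in> Phi" "\<And>i. i \<in> I \<Longrightarrow> spec1 (u i) (r i)" by blast
    have diff: "(\<lambda>i. y i - u i) \<in> Psi"
      using fsubspace_diff[OF Psi Suc.prems(1)] u(1) sub by blast
    define z where "z = (\<lambda>i. inverse (q - 1) * (y i - u i))"
    have zP: "z \<in> Psi" unfolding z_def by (rule fsubspace_scale[OF Psi diff])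
    have "regular (z i)" if "i \<in> I" for i
    proof -
      have "spec1 (y i - u i) 0" using spec1_diff[OF r[OF that] u(2)[OF that]] by simp
      then obtain t where "y i - u i = (q - 1) * t" "regular t" by (rule spec1_0_dvd)
      then show ?thesis by (simp add: z_def flip: mult.assoc)
    qed
    from Suc.IH[OF zP this] obtain t where t: "regular t" "ev z = (q - 1) ^ k * t" by blast
    have "(q - 1) * z i = y i - u i" for i
      by (simp add: z_def flip: mult.assoc)
    then have "(d * \<phi>0 i) * y i - (d * \<phi>0 i) * u i = (q - 1) * ((d * \<phi>0 i) * z i)" for i
      by (metis mult.left_commute right_diff_distrib)
    then have "ev y - ev u = (q - 1) * ev z"
      by (simp add: ev_def sum_distrib_left flip: sum_subtractf)
    then show ?case using t ev_Phi[OF u(1)] by (auto simp: mult.assoc)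
  qed
  let ?x = "\<lambda>i. c * x i"
  have "?x \<in> Psi" using x Psi by (simp add: fsubspace_def)
  then have "ev ?x = 0"
    using regular_divisible_zero[OF ev_reg[of ?x]] key[of ?x] c(2) by blast
  moreover have "ev ?x = c * d * (\<Sum>i\<in>I. \<phi>0 i * x i)"
    by (simp add: ev_def sum_distrib_left mult_ac)
  ultimately show False using c(1) d(1) \<phi>0(2) by simp
qed

section \<open>Partially symmetric tensors\<close>

text \<open>The matrix product with inputs as rows: \<open>k\<close> acts before
  \<open>l\<close>.\<close>

definition kmul :: "int list set \<Rightarrow> (int list \<Rightarrow> int list \<Rightarrow> 'f::comm_ring_1) \<Rightarrow> (int list \<Rightarrow> int list \<Rightarrow> 'f)
    \<Rightarrow> int list \<Rightarrow> int list \<Rightarrow> 'f" where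
  "kmul W k l u w = (\<Sum>v\<in>W. k u v * l v w)"

definition lmul :: "int set \<Rightarrow> (int \<Rightarrow> int \<Rightarrow> rat) \<Rightarrow> (int \<Rightarrow> int \<Rightarrow> rat) \<Rightarrow> int \<Rightarrow> int \<Rightarrow> rat" where
  "lmul L Y Z c d = (\<Sum>e\<in>L. Y c e * Z e d)"

text \<open>The matrix coefficient of the sum, over all injections of \<open>S\<close> into the set of tensor factors,
  of the operators that apply \<open>Z i\<close> to the factor assigned to \<open>i\<close> and the identity to the other factors.\<close>

fun psym :: "(nat \<Rightarrow> int \<Rightarrow> int \<Rightarrow> rat) \<Rightarrow> nat set \<Rightarrow> int list \<Rightarrow> int list \<Rightarrow> rat" where
  "psym Z S [] [] = of_bool (S = {})"
| "psym Z S (c # u) (d # w) = of_bool (c = d) * psym Z S u w + (\<Sum>i\<in>S. Z i c d * psym Z (S - {i}) u w)"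
| "psym Z S u w = 0"

abbreviation deriv_op :: "(int \<Rightarrow> int \<Rightarrow> rat) \<Rightarrow> int list \<Rightarrow> int list \<Rightarrow> rat" where
  "deriv_op Y \<equiv> psym (\<lambda>_. Y) {0}"

lemma finite_words: "finite L \<Longrightarrow> finite (words L n)"
  using finite_lists_length_eq[of L n] by (simp add: words_def conj_commute)

lemma words_Suc: "words L (Suc n) = (\<lambda>(l, w). l # w) ` (L \<times> words L n)"
  by (auto simp: words_def image_iff length_Suc_conv)

lemma words_0: "words L 0 = {[]}" by (auto simp: words_def)

lemma sum_words_Suc: "(\<Sum>v\<in>words L (Suc n). f v) = (\<Sum>l\<in>L. \<Sum>v\<in>words L n. f (l # v))"
proof -
  have "(\<Sum>v\<in>words L (Suc n). f v) = (\<Sum>(l, v)\<in>L \<times> words L n. f (l # v))"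
    unfolding words_Suc by (subst sum.reindex) (auto simp: inj_on_def split_def)
  then show ?thesis by (simp add: sum.cartesian_product)
qed

lemma psym_cong:
  "(\<And>i c d. i \<in> S \<Longrightarrow> c \<in> set u \<Longrightarrow> d \<in> set w \<Longrightarrow> Z i c d = Z' i c d) \<Longrightarrow> psym Z S u w = psym Z' S u w"
proof (induction Z S u w rule: psym.induct)
  case (2 Z S c u d w)
  have "psym Z S u w = psym Z' S u w" by (rule 2(1)) (simp add: 2)
  moreover have "psym Z (S - {i}) u w = psym Z' (S - {i}) u w" if "i \<in> S" for i
    by (rule 2(2)[OF that]) (simp add: 2)
  ultimately show ?case using 2(3) by simp
qed simp_all

lemma psym_empty: "psym Z {} u w = of_bool (u = w)"
  by (induction Z "{} :: nat set" u w rule: psym.induct) auto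

lemma psym_sing: "(\<And>c d. c \<in> set u \<Longrightarrow> d \<in> set w \<Longrightarrow> Z i c d = Y c d) \<Longrightarrow> psym Z {i} u w = deriv_op Y u w"
proof (induction u arbitrary: w)
  case Nil then show ?case by (cases w) auto
next
  case (Cons c u) then show ?case by (cases w) (auto simp: psym_empty)
qed

text \<open>\<open>Y\<close> lands either on a factor that \<open>S\<close> leaves free, where it
  becomes a new index \<open>j0\<close>, or on the factor of some \<open>j \<in> S\<close>, where it
  is composed with \<open>Z j\<close>. Solved for the first term, this builds a symmetrized tensor
  with one more index.\<close>

lemma deriv_op_mult:
  assumes L: "finite L" and S: "finite S" "j0 \<notin> S" and uw: "u \<in> words L k" "w \<in> words L k"
  shows "kmul (words L k) (deriv_op Y) (psym Z S) u w =
    psym (Z(j0 := Y)) (insert j0 S) u w + (\<Sum>j\<in>S. psym (Z(j := lmul L Y (Z j))) S u w)"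
  using S uw
proof (induction k arbitrary: u w S)
  case 0
  then show ?case by (auto simp: words_0 kmul_def)
next
  case (Suc k)
  obtain c u' d w' where uw: "u = c # u'" "w = d # w'" "c \<in> L" "d \<in> L" "u' \<in> words L k" "w' \<in> words L k"
    using Suc.prems(3,4) by (auto elim!: Cons_words)
  let ?W = "words L k" and ?D = "deriv_op Y"
  let ?Zj = "\<lambda>j. Z(j := lmul L Y (Z j))"
  have fW: "finite ?W" by (rule finite_words[OF L])
  \<comment> \<open>At the first letter \<open>deriv_op Y\<close> either fixes it and acts on the
    tail, or acts on it and is the identity on the tail. The two resulting sums are expanded
    separately.\<close>
  have "kmul (words L (Suc k)) ?D (psym Z S) u w =
      (\<Sum>e\<in>L. \<Sum>v\<in>?W. (of_bool (c = e) * ?D u' v + Y c e * of_bool (u' = v)) * psym Z S (e # v) w)"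
    by (simp add: kmul_def sum_words_Suc uw psym_empty)
  also have "\<dots> = (\<Sum>e\<in>L. of_bool (c = e) * (\<Sum>v\<in>?W. ?D u' v * psym Z S (e # v) w))
      + (\<Sum>e\<in>L. Y c e * (\<Sum>v\<in>?W. of_bool (u' = v) * psym Z S (e # v) w))"
    by (simp add: distrib_right sum.distrib sum_distrib_left mult.assoc)
  also have "(\<Sum>e\<in>L. of_bool (c = e) * (\<Sum>v\<in>?W. ?D u' v * psym Z S (e # v) w))
      = (\<Sum>v\<in>?W. ?D u' v * psym Z S (c # v) w)"
    using uw L by (simp add: of_bool_def if_distrib[of "\<lambda>x. x * _"] sum.delta cong: if_cong)
  also have "(\<Sum>e\<in>L. Y c e * (\<Sum>v\<in>?W. of_bool (u' = v) * psym Z S (e # v) w))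
      = (\<Sum>e\<in>L. Y c e * psym Z S (e # u') w)"
    using uw fW by (simp add: of_bool_def if_distrib[of "\<lambda>x. x * _"] sum.delta cong: if_cong)
  also have "(\<Sum>v\<in>?W. ?D u' v * psym Z S (c # v) w) =
      of_bool (c = d) * kmul ?W ?D (psym Z S) u' w' + (\<Sum>i\<in>S. Z i c d * kmul ?W ?D (psym Z (S - {i})) u' w')"
    by (simp add: uw kmul_def distrib_left sum.distrib sum_distrib_left mult_ac sum.swap[of _ S])
  also have "(\<Sum>e\<in>L. Y c e * psym Z S (e # u') w) =
      Y c d * psym Z S u' w' + (\<Sum>i\<in>S. lmul L Y (Z i) c d * psym Z (S - {i}) u' w')"
  proof -
    have "(\<Sum>e\<in>L. Y c e * psym Z S (e # u') w) =
      (\<Sum>e\<in>L. of_bool (e = d) * (Y c e * psym Z S u' w')) + (\<Sum>e\<in>L. \<Sum>i\<in>S. Y c e * Z i e d * psym Z (S - {i}) u' w')"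
      by (simp add: uw distrib_left sum.distrib sum_distrib_left mult_ac)
    also have "(\<Sum>e\<in>L. of_bool (e = d) * (Y c e * psym Z S u' w')) = Y c d * psym Z S u' w'"
      using uw L by (simp add: of_bool_def if_distrib[of "\<lambda>x. x * _"] sum.delta cong: if_cong)
    also have "(\<Sum>e\<in>L. \<Sum>i\<in>S. Y c e * Z i e d * psym Z (S - {i}) u' w')
        = (\<Sum>i\<in>S. lmul L Y (Z i) c d * psym Z (S - {i}) u' w')"
      by (subst sum.swap) (simp add: lmul_def sum_distrib_right)
    finally show ?thesis .
  qed
  also have "kmul ?W ?D (psym Z S) u' w' =
      psym (Z(j0 := Y)) (insert j0 S) u' w' + (\<Sum>j\<in>S. psym (?Zj j) S u' w')"
    by (rule Suc.IH) (use Suc.prems uw in auto)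
  also have "(\<Sum>i\<in>S. Z i c d * kmul ?W ?D (psym Z (S - {i})) u' w') =
      (\<Sum>i\<in>S. Z i c d * psym (Z(j0 := Y)) (insert j0 (S - {i})) u' w')
      + (\<Sum>i\<in>S. \<Sum>j\<in>S - {i}. Z i c d * psym (?Zj j) (S - {i}) u' w')"
  proof -
    have "kmul ?W ?D (psym Z (S - {i})) u' w' = psym (Z(j0 := Y)) (insert j0 (S - {i})) u' w'
      + (\<Sum>j\<in>S - {i}. psym (?Zj j) (S - {i}) u' w')" for i
      by (rule Suc.IH) (use Suc.prems uw in auto)
    then show ?thesis by (simp add: distrib_left sum.distrib sum_distrib_left)
  qed
  finally have LHS: "kmul (words L (Suc k)) ?D (psym Z S) u w =
      of_bool (c = d) * (psym (Z(j0 := Y)) (insert j0 S) u' w' + (\<Sum>j\<in>S. psym (?Zj j) S u' w'))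
      + ((\<Sum>i\<in>S. Z i c d * psym (Z(j0 := Y)) (insert j0 (S - {i})) u' w')
        + (\<Sum>i\<in>S. \<Sum>j\<in>S - {i}. Z i c d * psym (?Zj j) (S - {i}) u' w'))
      + (Y c d * psym Z S u' w' + (\<Sum>i\<in>S. lmul L Y (Z i) c d * psym Z (S - {i}) u' w'))" .
  have cong: "psym (Z(j := y)) T u' w' = psym Z T u' w'" if "j \<notin> T" for j y T
    by (rule psym_cong) (use that in auto)
  have R1: "psym (Z(j0 := Y)) (insert j0 S) u w = of_bool (c = d) * psym (Z(j0 := Y)) (insert j0 S) u' w'
      + (Y c d * psym Z S u' w' + (\<Sum>i\<in>S. Z i c d * psym (Z(j0 := Y)) (insert j0 (S - {i})) u' w'))"
  proof -
    have "insert j0 S - {i} = insert j0 (S - {i})" if "i \<in> S" for i using that Suc.prems(2) by auto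
    moreover have "insert j0 S - {j0} = S" using Suc.prems(2) by auto
    moreover have "i \<noteq> j0" if "i \<in> S" for i using that Suc.prems(2) by auto
    ultimately show ?thesis using Suc.prems(1,2) by (simp add: uw cong)
  qed
  have R2: "psym (?Zj j) S u w = of_bool (c = d) * psym (?Zj j) S u' w' + (lmul L Y (Z j) c d * psym Z (S - {j}) u' w'
      + (\<Sum>i\<in>S - {j}. Z i c d * psym (?Zj j) (S - {i}) u' w'))" if "j \<in> S" for j
    using that Suc.prems(1) by (simp add: uw cong sum.remove[of S j])
  have R3: "(\<Sum>i\<in>S. \<Sum>j\<in>S - {i}. f i j) = (\<Sum>j\<in>S. \<Sum>i\<in>S - {j}. f i j)" for f :: "nat \<Rightarrow> nat \<Rightarrow> rat"
  proof -
    have "(\<Sum>i\<in>S. \<Sum>j\<in>S - {i}. f i j) = (\<Sum>i\<in>S. \<Sum>j\<in>S. if i = j then 0 else f i j)"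
      using Suc.prems(1) by (intro sum.cong refl sum.mono_neutral_cong_left) auto
    also have "\<dots> = (\<Sum>j\<in>S. \<Sum>i\<in>S. if i = j then 0 else f i j)" by (rule sum.swap)
    also have "\<dots> = (\<Sum>j\<in>S. \<Sum>i\<in>S - {j}. f i j)"
      using Suc.prems(1) by (intro sum.cong refl sum.mono_neutral_cong_right) auto
    finally show ?thesis .
  qed
  have "(\<Sum>j\<in>S. psym (?Zj j) S u w) = of_bool (c = d) * (\<Sum>j\<in>S. psym (?Zj j) S u' w')
      + ((\<Sum>j\<in>S. lmul L Y (Z j) c d * psym Z (S - {j}) u' w')
      + (\<Sum>j\<in>S. \<Sum>i\<in>S - {j}. Z i c d * psym (?Zj j) (S - {i}) u' w'))"
    unfolding sum_distrib_left sum.distrib[symmetric] by (rule sum.cong[OF refl R2])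
  then show ?case unfolding LHS R1 R3[of "\<lambda>i j. Z i c d * psym (?Zj j) (S - {i}) u' w'"] by (simp only: distrib_left add_ac)
qed

lemma deriv_op_sum:
  assumes "length u = length w" "\<And>c d. c \<in> set u \<Longrightarrow> d \<in> set w \<Longrightarrow> Y c d = (\<Sum>x\<in>I. t x * V x c d)"
  shows "deriv_op Y u w = (\<Sum>x\<in>I. t x * deriv_op (V x) u w)"
  using assms
proof (induction u w rule: list_induct2)
  case Nil then show ?case by simp
next
  case (Cons c u d w)
  then show ?case
    by (simp add: psym_empty distrib_left sum.distrib sum_distrib_left sum_distrib_right mult_ac)
qed

section \<open>The double commutant of a permutation group\<close>

locale kernel_algebra =
  fixes W :: "int list set" and A :: "(int list \<Rightarrow> int list \<Rightarrow> rat) set"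
  assumes finite_W: "finite W"
    and id_in: "(\<lambda>u w. of_bool (u = w)) \<in> A"
    and add_in: "k \<in> A \<Longrightarrow> l \<in> A \<Longrightarrow> (\<lambda>u w. k u w + l u w) \<in> A"
    and scale_in: "k \<in> A \<Longrightarrow> (\<lambda>u w. c * k u w) \<in> A"
    and mult_in: "k \<in> A \<Longrightarrow> l \<in> A \<Longrightarrow> kmul W k l \<in> A"
    and ext_in: "k \<in> A \<Longrightarrow> (\<And>u w. u \<in> W \<Longrightarrow> w \<in> W \<Longrightarrow> k u w = l u w) \<Longrightarrow> l \<in> A"
begin

lemma zero_in: "(\<lambda>u w. 0) \<in> A"
  using scale_in[OF id_in, of 0] by simp

lemma diff_in: "k \<in> A \<Longrightarrow> l \<in> A \<Longrightarrow> (\<lambda>u w. k u w - l u w) \<in> A"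
  using add_in[OF _ scale_in[of l "- 1"], of k] by simp

lemma sum_in: "(\<And>i. i \<in> I \<Longrightarrow> k i \<in> A) \<Longrightarrow> (\<lambda>u w. \<Sum>i\<in>I. k i u w) \<in> A"
  by (induction I rule: infinite_finite_induct) (auto intro: zero_in add_in)

text \<open>All permutations that \<open>A\<close> contains together with their inverses, rather
  than a prescribed group: the group laws then follow from those of \<open>A\<close>, and a given
  reflection belongs to it as soon as its kernel is found in \<open>A\<close>.\<close>

definition perms :: "(int list \<Rightarrow> int list) set" where
  "perms = {g. g permutes W \<and> (\<lambda>u w. of_bool (w = g u)) \<in> A \<and> (\<lambda>u w. of_bool (g w = u)) \<in> A}"

lemma finite_perms: "finite perms"
  by (rule finite_subset[OF _ finite_permutations[OF finite_W]]) (auto simp: perms_def)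

lemma perms_in: "g \<in> perms \<Longrightarrow> u \<in> W \<Longrightarrow> g u \<in> W"
  by (auto simp: perms_def permutes_in_image)

lemma perms_id: "id \<in> perms"
  using id_in by (simp add: perms_def permutes_id eq_commute)

lemma perms_comp:
  assumes "g \<in> perms" "h \<in> perms"
  shows "g \<circ> h \<in> perms"
proof -
  have 1: "(\<lambda>u w. of_bool (w = (g \<circ> h) u)) \<in> A"
  proof (rule ext_in)
    show "kmul W (\<lambda>u w. of_bool (w = h u)) (\<lambda>u w. of_bool (w = g u)) \<in> A"
      by (rule mult_in) (use assms in \<open>auto simp: perms_def\<close>)
    show "kmul W (\<lambda>u w. of_bool (w = h u)) (\<lambda>u w. of_bool (w = g u)) u w = of_bool (w = (g \<circ> h) u)"
      if "u \<in> W" for u w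
      using that finite_W perms_in[OF assms(2)]
      by (simp add: kmul_def of_bool_def if_distrib[of "\<lambda>x. x * _"] sum.delta cong: if_cong)
  qed
  have 2: "(\<lambda>u w. of_bool ((g \<circ> h) w = u)) \<in> A"
  proof (rule ext_in)
    show "kmul W (\<lambda>u w. of_bool (g w = u)) (\<lambda>u w. of_bool (h w = u)) \<in> A"
      by (rule mult_in) (use assms in \<open>auto simp: perms_def\<close>)
    show "kmul W (\<lambda>u w. of_bool (g w = u)) (\<lambda>u w. of_bool (h w = u)) u w = of_bool ((g \<circ> h) w = u)"
      if "w \<in> W" for u w
      using that finite_W perms_in[OF assms(2)]
      by (simp add: kmul_def of_bool_def if_distrib[of "\<lambda>x. _ * x"] sum.delta cong: if_cong)
  qed
  show ?thesis using assms 1 2 by (auto simp: perms_def intro: permutes_compose)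
qed

lemma perms_inv:
  assumes "g \<in> perms"
  shows "inv_into UNIV g \<in> perms"
proof -
  have g: "g permutes W" using assms by (simp add: perms_def)
  have "w = (inv_into UNIV g) u \<longleftrightarrow> g w = u" "(inv_into UNIV g) w = u \<longleftrightarrow> w = g u" for u w
    using permutes_inverses[OF g] by metis+
  then have "(\<lambda>u w. of_bool (w = (inv_into UNIV g) u)) = (\<lambda>u w. of_bool (g w = u) :: rat)"
    "(\<lambda>u w. of_bool (inv_into UNIV g w = u)) = (\<lambda>u w. of_bool (w = g u) :: rat)"
    by simp_all
  then show ?thesis using assms permutes_inv[OF g] by (simp add: perms_def)
qed

lemma sum_perms_comp:
  assumes "h \<in> perms"
  shows "(\<Sum>g\<in>perms. f (g \<circ> h)) = (\<Sum>g\<in>perms. f g)"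
proof (rule sum.reindex_bij_witness[where i = "\<lambda>g. g \<circ> inv_into UNIV h" and j = "\<lambda>g. g \<circ> h"])
  have h: "h permutes W" using assms by (simp add: perms_def)
  show "g \<circ> h \<circ> inv_into UNIV h = g" "g \<circ> inv_into UNIV h \<circ> h = g" for g
    using permutes_inv_o[OF h] by (simp_all add: comp_assoc)
qed (use assms perms_comp perms_inv in auto)

text \<open>If the functional \<open>\<phi>\<close> vanishes on the algebra then \<open>c g = \<phi> (g k)\<close> satisfies
  \<open>(\<Sum>g. c g * g) = 0\<close>, since \<open>k\<close> commutes with group averages. Pairing this relation with the
  matrix that defines \<open>c\<close> gives \<open>(\<Sum>g. c g * c g) = 0\<close>, whence \<open>\<phi> k = 0\<close>.\<close>

theorem double_commutant:
  assumes comm: "\<And>C u w. (\<And>g u w. g \<in> perms \<Longrightarrow> u \<in> W \<Longrightarrow> w \<in> W \<Longrightarrow> C (g u) (g w) = C u w) \<Longrightarrow>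
      u \<in> W \<Longrightarrow> w \<in> W \<Longrightarrow> kmul W k C u w = kmul W C k u w"
  shows "k \<in> A"
proof (rule ccontr)
  assume k: "k \<notin> A"
  define V where "V = {\<lambda>(u, w). l u w | l. l \<in> A}"
  have "fsubspace V"
    unfolding fsubspace_def
  proof (intro conjI ballI allI)
    show "(\<lambda>_. 0) \<in> V" using zero_in by (force simp: V_def)
    fix f g c assume "f \<in> V" then obtain l where l: "f = (\<lambda>(u, w). l u w)" "l \<in> A" by (auto simp: V_def)
    show "(\<lambda>i. c * f i) \<in> V" using scale_in[OF l(2), of c] by (force simp: V_def l)
    assume "g \<in> V" then obtain l' where l': "g = (\<lambda>(u, w). l' u w)" "l' \<in> A" by (auto simp: V_def)
    show "(\<lambda>i. f i + g i) \<in> V" using add_in[OF l(2) l'(2)] by (force simp: V_def l l')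
  qed
  moreover have "\<not> (\<exists>v\<in>V. \<forall>i\<in>W \<times> W. v i = (\<lambda>(u, w). k u w) i)"
    using k ext_in by (fastforce simp: V_def)
  ultimately obtain \<phi> where \<phi>: "\<And>v. v \<in> V \<Longrightarrow> (\<Sum>i\<in>W \<times> W. \<phi> i * v i) = 0"
    "(\<Sum>i\<in>W \<times> W. \<phi> i * (\<lambda>(u, w). k u w) i) \<noteq> 0"
    using separating_functional[of "W \<times> W" V "\<lambda>(u, w). k u w"] finite_W by blast
  have \<phi>A: "(\<Sum>u\<in>W. \<Sum>w\<in>W. \<phi> (u, w) * l u w) = 0" if "l \<in> A" for l
    using \<phi>(1)[of "\<lambda>(u, w). l u w"] that by (auto simp: V_def sum.cartesian_product split_def)
  have \<phi>k: "(\<Sum>u\<in>W. \<Sum>w\<in>W. \<phi> (u, w) * k u w) \<noteq> 0"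
    using \<phi>(2) by (simp add: sum.cartesian_product split_def)
  define c where "c g = (\<Sum>u\<in>W. \<Sum>w\<in>W. \<phi> (g u, w) * k u w)" for g
  have trace: "(\<Sum>y\<in>W. \<phi> (g y, y)) = 0" if "g \<in> perms" for g
  proof -
    have "(\<Sum>u\<in>W. \<Sum>w\<in>W. \<phi> (u, w) * of_bool (g w = u)) = 0"
      using that by (intro \<phi>A) (simp add: perms_def)
    also have "(\<Sum>u\<in>W. \<Sum>w\<in>W. \<phi> (u, w) * of_bool (g w = u)) = (\<Sum>w\<in>W. \<phi> (g w, w))"
      using finite_W perms_in[OF that]
      by (subst sum.swap) (simp add: of_bool_def if_distrib[of "\<lambda>x. _ * x"] sum.delta cong: if_cong sum.cong)
    finally show ?thesis .
  qed
  have rel: "(\<Sum>g\<in>perms. of_bool (g u = x) * c g) = 0" if "u \<in> W" for u x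
  proof -
    \<comment> \<open>A sum over the group, hence an invariant kernel to which \<open>comm\<close>
      applies. Multiplying it by \<open>k\<close> on one side yields the coefficients
      \<open>c g\<close>, on the other side the sums in \<open>trace\<close>, which vanish.\<close>
    define C where "C y u w = (\<Sum>g\<in>perms. of_bool (g u = x) * \<phi> (g w, y))" for y u w
    have inv: "C y (h u) (h w) = C y u w" if "h \<in> perms" for h y u w
      using sum_perms_comp[OF that, of "\<lambda>g. of_bool (g u = x) * \<phi> (g w, y)"] by (simp add: C_def)
    have "(\<Sum>g\<in>perms. of_bool (g u = x) * c g) = (\<Sum>y\<in>W. \<Sum>v\<in>W. C y u v * k v y)"
    proof -
      have "(\<Sum>y\<in>W. \<Sum>v\<in>W. C y u v * k v y) =
          (\<Sum>v\<in>W. \<Sum>y\<in>W. \<Sum>g\<in>perms. of_bool (g u = x) * (\<phi> (g v, y) * k v y))"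
        by (subst sum.swap) (simp add: C_def sum_distrib_right mult.assoc)
      also have "\<dots> = (\<Sum>g\<in>perms. \<Sum>v\<in>W. \<Sum>y\<in>W. of_bool (g u = x) * (\<phi> (g v, y) * k v y))"
        by (simp only: sum.swap[of _ perms])
      finally show ?thesis by (simp add: c_def sum_distrib_left)
    qed
    also have "\<dots> = (\<Sum>y\<in>W. kmul W (C y) k u y)" by (simp add: kmul_def)
    also have "\<dots> = (\<Sum>y\<in>W. kmul W k (C y) u y)"
      using comm[of "C _", OF inv] \<open>u \<in> W\<close> by (intro sum.cong) auto
    also have "\<dots> = (\<Sum>y\<in>W. \<Sum>v\<in>W. \<Sum>g\<in>perms. k u v * of_bool (g v = x) * \<phi> (g y, y))"
      by (simp add: kmul_def C_def sum_distrib_left mult.assoc)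
    also have "\<dots> = (\<Sum>v\<in>W. \<Sum>g\<in>perms. \<Sum>y\<in>W. k u v * of_bool (g v = x) * \<phi> (g y, y))"
      by (subst sum.swap) (simp only: sum.swap[of _ W perms])
    also have "\<dots> = 0" by (simp add: trace flip: sum_distrib_left)
    finally show ?thesis .
  qed
  have "(\<Sum>g\<in>perms. c g * c g) = (\<Sum>g\<in>perms. \<Sum>u\<in>W. \<Sum>w\<in>W. \<Sum>x\<in>W. k u w * \<phi> (x, w) * (of_bool (g u = x) * c g))"
  proof (rule sum.cong[OF refl])
    fix g assume g: "g \<in> perms"
    have "c g * c g = (\<Sum>u\<in>W. \<Sum>w\<in>W. k u w * \<phi> (g u, w) * c g)"
      by (subst (1) c_def) (simp add: sum_distrib_left sum_distrib_right mult_ac)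
    also have "\<dots> = (\<Sum>u\<in>W. \<Sum>w\<in>W. \<Sum>x\<in>W. k u w * \<phi> (x, w) * (of_bool (g u = x) * c g))"
    proof (intro sum.cong refl)
      fix u w assume "u \<in> W" "w \<in> W"
      then show "k u w * \<phi> (g u, w) * c g = (\<Sum>x\<in>W. k u w * \<phi> (x, w) * (of_bool (g u = x) * c g))"
        using finite_W perms_in[OF g]
        by (simp add: of_bool_def if_distrib[of "\<lambda>x. x * _"] if_distrib[of "\<lambda>x. _ * x"] sum.delta cong: if_cong)
    qed
    finally show "c g * c g = (\<Sum>u\<in>W. \<Sum>w\<in>W. \<Sum>x\<in>W. k u w * \<phi> (x, w) * (of_bool (g u = x) * c g))" .
  qed
  also have "\<dots> = (\<Sum>u\<in>W. \<Sum>w\<in>W. \<Sum>x\<in>W. k u w * \<phi> (x, w) * (\<Sum>g\<in>perms. of_bool (g u = x) * c g))"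
    by (simp only: sum_distrib_left sum.swap[of _ _ perms])
  also have "\<dots> = 0" by (simp add: rel)
  finally have "(\<Sum>g\<in>perms. c g * c g) = 0" .
  \<comment> \<open>Squares of rationals are nonnegative, so every term vanishes; and
    \<open>c id\<close> is the value of the functional at \<open>k\<close>, which is
    nonzero.\<close>
  then have "c id * c id = 0"
    using sum_nonneg_eq_0_iff[of perms "\<lambda>g. c g * c g"] finite_perms perms_id by simp
  then show False using \<phi>k by (simp add: c_def)
qed

end

section \<open>Invariant kernels\<close>

definition negate_first :: "int list \<Rightarrow> int list" where "negate_first u = u[0 := - u ! 0]"
definition swap_letters :: "nat \<Rightarrow> int list \<Rightarrow> int list" where "swap_letters i u = u[i := u ! Suc i, Suc i := u ! i]"

definition kinv :: "int set \<Rightarrow> nat \<Rightarrow> (int list \<Rightarrow> int list \<Rightarrow> rat) \<Rightarrow> bool" where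
  "kinv L n k \<longleftrightarrow> (\<forall>u\<in>words L n. \<forall>w\<in>words L n. k (negate_first u) (negate_first w) = k u w \<and>
     (\<forall>i. Suc i < n \<longrightarrow> k (swap_letters i u) (swap_letters i w) = k u w))"

definition signed_unit :: "int \<Rightarrow> int \<Rightarrow> int \<Rightarrow> int \<Rightarrow> rat" where
  "signed_unit a b c d = of_bool (c = a \<and> d = b) + of_bool (c = - a \<and> d = - b)"

text \<open>A normal form for a pair of letters up to simultaneous negation, valid when the first
  letter is nonzero.\<close>

definition sign_class :: "int \<times> int \<Rightarrow> int \<times> int" where
  "sign_class z = (if fst z > 0 then z else (- fst z, - snd z))"

lemma signed_unit_nonneg: "signed_unit a b c d \<ge> 0" by (simp add: signed_unit_def)
lemma signed_unit_pos_iff: "a \<noteq> 0 \<Longrightarrow> c \<noteq> 0 \<Longrightarrow> signed_unit a b c d > 0 \<longleftrightarrow> sign_class (a, b) = sign_class (c, d)"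
  by (auto simp: signed_unit_def sign_class_def)
lemma signed_unit_uminus: "signed_unit (- a) (- b) = signed_unit a b" by (intro ext) (simp add: signed_unit_def)

text \<open>Adjacent swaps carry the first entry of \<open>z\<close> to the front of
  \<open>z'\<close>; \<open>pre\<close> collects the entries already matched.\<close>

lemma swap_invariant_mset:
  assumes swap: "\<And>xs a b ys. f (xs @ a # b # ys) = f (xs @ b # a # ys)" and "mset z = mset z'"
  shows "f (pre @ z) = f (pre @ z')"
  using assms(2)
proof (induction z arbitrary: z' pre)
  case Nil then show ?case by simp
next
  case (Cons a t)
  then have "a \<in> set z'" by (metis list.set_intros(1) mset_eq_setD)
  then obtain p r where z': "z' = p @ a # r" by (metis split_list)
  have "f (pre @ p @ a # r) = f (pre @ a # p @ r)"
  proof (induction p arbitrary: r rule: rev_induct)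
    case (snoc x p)
    then show ?case using swap[of "pre @ p" x a r] by simp
  qed simp
  also have "\<dots> = f ((pre @ [a]) @ t)"
    using Cons.IH[of "p @ r" "pre @ [a]"] Cons.prems by (simp add: z')
  finally show ?case by (simp add: z')
qed

text \<open>Only the first entry may be negated, so each entry is carried to the front, normalized
  there and carried back.\<close>

lemma sign_invariant_class:
  assumes swap: "\<And>xs a b ys. f (xs @ a # b # ys) = f (xs @ b # a # ys)"
    and neg: "\<And>a b ys. f ((- a, - b) # ys) = f ((a, b) # ys)"
  shows "f (pre @ z) = f (pre @ map sign_class z)"
proof (induction z arbitrary: pre)
  case Nil then show ?case by simp
next
  case (Cons x z)
  have "f (pre @ x # z) = f (x # pre @ z)"
    using swap_invariant_mset[of f "pre @ x # z" "x # pre @ z" "[]", OF swap] by simp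
  also have "\<dots> = f (sign_class x # pre @ z)"
    using neg[of "fst x" "snd x"] by (simp add: sign_class_def)
  also have "\<dots> = f (pre @ sign_class x # z)"
    using swap_invariant_mset[of f "sign_class x # pre @ z" "pre @ sign_class x # z" "[]", OF swap] by simp
  also have "\<dots> = f ((pre @ [sign_class x]) @ map sign_class z)"
    using Cons.IH[of "pre @ [sign_class x]"] by simp
  finally show ?case by simp
qed

text \<open>The orbits of the hyperoctahedral group on pairs of words are classified by the multiset
  of sign classes of the letter pairs, and an invariant kernel is constant on orbits.\<close>

lemma kinv_orbit:
  assumes L: "\<And>l. l \<in> L \<Longrightarrow> - l \<in> L" and k: "kinv L n k"
    and W: "u \<in> words L n" "w \<in> words L n" "u' \<in> words L n" "w' \<in> words L n"
    and eq: "mset (map sign_class (zip u w)) = mset (map sign_class (zip u' w'))"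
  shows "k u w = k u' w'"
proof -
  \<comment> \<open>The value zero off the admissible lists makes both symmetries unconditional, as
    the two preceding lemmas require.\<close>
  define f where "f z = (if length z = n \<and> set z \<subseteq> L \<times> L then k (map fst z) (map snd z) else 0)" for z
  have swap: "f (xs @ a # b # ys) = f (xs @ b # a # ys)" for xs a b ys
  proof (cases "length (xs @ a # b # ys) = n \<and> set (xs @ a # b # ys) \<subseteq> L \<times> L")
    case True
    let ?z = "xs @ a # b # ys"
    have "map fst ?z \<in> words L n" "map snd ?z \<in> words L n" using True by (auto simp: words_def)
    moreover have "Suc (length xs) < n" using True by auto
    ultimately have "k (swap_letters (length xs) (map fst ?z)) (swap_letters (length xs) (map snd ?z)) = k (map fst ?z) (map snd ?z)"
      using k unfolding kinv_def by blast
    moreover have "swap_letters (length xs) (map g ?z) = map g (xs @ b # a # ys)" for g :: "int \<times> int \<Rightarrow> int"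
      by (simp add: swap_letters_def nth_append list_update_append)
    ultimately show ?thesis using True by (simp add: f_def)
  next
    case False
    then show ?thesis by (auto simp: f_def)
  qed
  have neg: "f ((- a, - b) # ys) = f ((a, b) # ys)" for a b ys
  proof (cases "length ((a, b) # ys) = n \<and> set ((a, b) # ys) \<subseteq> L \<times> L")
    case True
    let ?z = "(a, b) # ys"
    have "map fst ?z \<in> words L n" "map snd ?z \<in> words L n" using True by (auto simp: words_def)
    then have "k (negate_first (map fst ?z)) (negate_first (map snd ?z)) = k (map fst ?z) (map snd ?z)"
      using k unfolding kinv_def by blast
    then show ?thesis using True L by (auto simp: f_def negate_first_def)
  next
    case False
    then show ?thesis using L[of "- a"] L[of "- b"] by (auto simp: f_def)
  qed
  have sign_class: "f z = f (map sign_class z)" for z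
    using sign_invariant_class[of f "[]" z, OF swap neg] by simp
  have "f (map sign_class (zip u w)) = f (map sign_class (zip u' w'))"
    using swap_invariant_mset[of f _ _ "[]", OF swap eq] by simp
  then have "f (zip u w) = f (zip u' w')" by (simp flip: sign_class)
  moreover have "f (zip u w) = k u w" if "u \<in> words L n" "w \<in> words L n" for u w
    using that by (auto simp: f_def words_def dest: set_zip_leftD set_zip_rightD)
  ultimately show ?thesis using W by simp
qed

lemma psym_card: "finite S \<Longrightarrow> card S > length u \<Longrightarrow> psym Z S u w = 0"
proof (induction Z S u w rule: psym.induct)
  case (2 Z S c u d w)
  have "psym Z S u w = 0" using 2 by auto
  moreover have "psym Z (S - {i}) u w = 0" if "i \<in> S" for i
    using 2(2)[OF that] 2(3,4) that by (auto simp: card_Diff_singleton)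
  ultimately show ?case by simp
qed auto

lemma psym_signed_unit_nonneg: "psym (\<lambda>i. signed_unit (a i) (b i)) S u w \<ge> 0"
proof (induction u arbitrary: w S)
  case Nil then show ?case by (cases w) auto
next
  case (Cons c u) then show ?case
    by (cases w) (auto intro!: add_nonneg_nonneg sum_nonneg mult_nonneg_nonneg signed_unit_nonneg)
qed

text \<open>With as many indices as factors the injections are bijections. All terms are
  nonnegative, so nothing cancels: the sum is positive exactly when some bijection matches the sign
  classes. Thus the support of this kernel is a single orbit.\<close>

lemma psym_signed_unit_pos_iff:
  assumes "finite S" "card S = length u" "length u = length w" "0 \<notin> set u" "\<And>i. i \<in> S \<Longrightarrow> fst (z i) \<noteq> 0"
  shows "psym (\<lambda>i. signed_unit (fst (z i)) (snd (z i))) S u w > 0 \<longleftrightarrow>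
    image_mset (\<lambda>i. sign_class (z i)) (mset_set S) = mset (map sign_class (zip u w))"
  using assms(3,1,2,4,5)
proof (induction u w arbitrary: S rule: list_induct2)
  case Nil then show ?case by simp
next
  case (Cons c u d w)
  let ?Z = "\<lambda>i. signed_unit (fst (z i)) (snd (z i))" and ?M = "\<lambda>S. image_mset (\<lambda>i. sign_class (z i)) (mset_set S)"
  let ?N = "mset (map sign_class (zip u w))"
  have IH: "psym ?Z (S - {i}) u w > 0 \<longleftrightarrow> ?M (S - {i}) = ?N" if "i \<in> S" for i
    by (rule Cons.IH) (use Cons.prems that in auto)
  have mult_pos: "x * y > 0 \<longleftrightarrow> x > 0 \<and> y > 0" if "x \<ge> 0" "y \<ge> 0" for x y :: rat
    using that by (auto simp: zero_less_mult_iff)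
  have "psym ?Z S u w = 0" using Cons.prems by (intro psym_card) auto
  then have "psym ?Z S (c # u) (d # w) = (\<Sum>i\<in>S. ?Z i c d * psym ?Z (S - {i}) u w)" by simp
  also have "\<dots> > 0 \<longleftrightarrow> (\<exists>i\<in>S. ?Z i c d * psym ?Z (S - {i}) u w > 0)"
  proof -
    have nn: "?Z i c d * psym ?Z (S - {i}) u w \<ge> 0" for i
      by (intro mult_nonneg_nonneg signed_unit_nonneg psym_signed_unit_nonneg)
    have "(\<Sum>i\<in>S. ?Z i c d * psym ?Z (S - {i}) u w) \<ge> 0" by (rule sum_nonneg[OF nn])
    then have "(\<Sum>i\<in>S. ?Z i c d * psym ?Z (S - {i}) u w) > 0
        \<longleftrightarrow> \<not> (\<forall>i\<in>S. ?Z i c d * psym ?Z (S - {i}) u w = 0)"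
      using sum_nonneg_eq_0_iff[OF Cons.prems(1), of "\<lambda>i. ?Z i c d * psym ?Z (S - {i}) u w", OF nn]
      by linarith
    then show ?thesis using nn by (simp add: less_le eq_commute[of 0])
  qed
  also have "\<dots> \<longleftrightarrow> (\<exists>i\<in>S. sign_class (z i) = sign_class (c, d) \<and> ?M (S - {i}) = ?N)"
  proof (rule bex_cong[OF refl])
    fix i assume i: "i \<in> S"
    have "?Z i c d > 0 \<longleftrightarrow> sign_class (z i) = sign_class (c, d)"
      using signed_unit_pos_iff[of "fst (z i)" c "snd (z i)" d] Cons.prems i by auto
    then show "?Z i c d * psym ?Z (S - {i}) u w > 0 \<longleftrightarrow> sign_class (z i) = sign_class (c, d) \<and> ?M (S - {i}) = ?N"
      using IH[OF i] mult_pos[OF signed_unit_nonneg psym_signed_unit_nonneg] by simp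
  qed
  also have "\<dots> \<longleftrightarrow> ?M S = add_mset (sign_class (c, d)) ?N"
  proof
    assume "\<exists>i\<in>S. sign_class (z i) = sign_class (c, d) \<and> ?M (S - {i}) = ?N"
    then show "?M S = add_mset (sign_class (c, d)) ?N"
      using Cons.prems(1) by (auto simp: mset_set.remove)
  next
    assume *: "?M S = add_mset (sign_class (c, d)) ?N"
    then have "sign_class (c, d) \<in># ?M S" by simp
    then obtain i where i: "i \<in> S" "sign_class (z i) = sign_class (c, d)" using Cons.prems(1) by auto
    then have "?M S = add_mset (sign_class (c, d)) (?M (S - {i}))" using Cons.prems(1) by (simp add: mset_set.remove)
    with * i show "\<exists>i\<in>S. sign_class (z i) = sign_class (c, d) \<and> ?M (S - {i}) = ?N" by auto
  qed
  finally show ?case by simp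
qed

locale invariant_algebra = kernel_algebra "words L n" A for L n A +
  assumes finite_L: "finite L" and L_uminus: "l \<in> L \<Longrightarrow> - l \<in> L" and zero_L: "0 \<notin> L"
    and inv_in: "k \<in> A \<Longrightarrow> kinv L n k"
    and deriv_in: "a \<in> L \<Longrightarrow> b \<in> L \<Longrightarrow> deriv_op (signed_unit a b) \<in> A"
begin

definition minv :: "(int \<Rightarrow> int \<Rightarrow> rat) set" where
  "minv = {Y. \<forall>c\<in>L. \<forall>d\<in>L. Y (- c) (- d) = Y c d}"

lemma minv_signed_unit: "signed_unit a b \<in> minv" by (auto simp: minv_def signed_unit_def)

lemma minv_lmul: "Y \<in> minv \<Longrightarrow> Z \<in> minv \<Longrightarrow> lmul L Y Z \<in> minv"
proof -
  assume YZ: "Y \<in> minv" "Z \<in> minv"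
  have "(\<Sum>e\<in>L. Y (- c) e * Z e (- d)) = (\<Sum>e\<in>L. Y c e * Z e d)" if "c \<in> L" "d \<in> L" for c d
  proof (rule sum.reindex_bij_witness[where i = uminus and j = uminus])
    fix e assume "e \<in> L"
    moreover have "Y (- c) (- (- e)) = Y c (- e)" "Z (- (- e)) (- d) = Z (- e) d"
      using YZ that L_uminus[OF \<open>e \<in> L\<close>] unfolding minv_def by blast+
    ultimately show "Y c (- e) * Z (- e) d = Y (- c) e * Z e (- d)" by simp
  qed (use L_uminus in auto)
  then show ?thesis by (simp add: minv_def lmul_def)
qed

lemma deriv_minv:
  assumes Y: "Y \<in> minv"
  shows "deriv_op Y \<in> A"
proof (rule ext_in)
  \<comment> \<open>The half compensates for \<open>(a, b)\<close> and \<open>(- a, - b)\<close>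
    giving the same signed unit.\<close>
  let ?k = "\<lambda>u w. \<Sum>x\<in>L \<times> L. (Y (fst x) (snd x) / 2) * deriv_op (signed_unit (fst x) (snd x)) u w"
  show "?k \<in> A" by (intro sum_in scale_in deriv_in) auto
  fix u w assume uw: "u \<in> words L n" "w \<in> words L n"
  have "Y c d = (\<Sum>x\<in>L \<times> L. (Y (fst x) (snd x) / 2) * signed_unit (fst x) (snd x) c d)" if "c \<in> L" "d \<in> L" for c d
  proof -
    have eq: "c = - a \<and> d = - b \<longleftrightarrow> (a, b) = (- c, - d)" for a b by auto
    have "(\<Sum>x\<in>L \<times> L. (Y (fst x) (snd x) / 2) * signed_unit (fst x) (snd x) c d)
      = (\<Sum>x\<in>L \<times> L. (if x = (c, d) then Y c d / 2 else 0)) + (\<Sum>x\<in>L \<times> L. (if x = (- c, - d) then Y (- c) (- d) / 2 else 0))"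
      unfolding sum.distrib[symmetric]
      by (intro sum.cong refl) (auto simp: signed_unit_def split_def prod_eq_iff)
    also have "\<dots> = Y c d / 2 + Y (- c) (- d) / 2"
      using that L_uminus finite_L by (simp add: sum.delta)
    also have "Y (- c) (- d) = Y c d" using Y that by (simp add: minv_def)
    finally show ?thesis by simp
  qed
  then show "?k u w = deriv_op Y u w"
    using uw by (intro deriv_op_sum[symmetric]) (auto simp: words_def)
qed

text \<open>The subtracted terms of \<open>deriv_op_mult\<close> have the smaller index set
  \<open>S\<close> with changed matrices; hence the induction is on \<open>S\<close> with
  \<open>Z\<close> arbitrary.\<close>

lemma psym_in:
  assumes "finite S" "\<And>i. i \<in> S \<Longrightarrow> Z i \<in> minv"
  shows "psym Z S \<in> A"
  using assms
proof (induction S arbitrary: Z)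
  case empty
  show ?case by (rule ext_in[OF id_in]) (simp add: psym_empty)
next
  case (insert j S)
  let ?k = "\<lambda>u w. kmul (words L n) (deriv_op (Z j)) (psym Z S) u w
      - (\<Sum>i\<in>S. psym (Z(i := lmul L (Z j) (Z i))) S u w)"
  show ?case
  proof (rule ext_in)
    show "?k \<in> A"
    proof (rule diff_in)
      show "kmul (words L n) (deriv_op (Z j)) (psym Z S) \<in> A"
        using insert by (intro mult_in deriv_minv) auto
      show "(\<lambda>u w. \<Sum>i\<in>S. psym (Z(i := lmul L (Z j) (Z i))) S u w) \<in> A"
      proof (rule sum_in)
        show "psym (Z(i := lmul L (Z j) (Z i))) S \<in> A" if "i \<in> S" for i
          using insert that by (intro insert.IH) (auto intro: minv_lmul)
      qed
    qed
    show "?k u w = psym Z (insert j S) u w" if "u \<in> words L n" "w \<in> words L n" for u w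
      using deriv_op_mult[OF finite_L insert.hyps(1,2) that, of "Z j" Z] by simp
  qed
qed

text \<open>The full symmetrization at \<open>(u0, w0)\<close> is supported on one orbit and
  constant there, so subtracting a multiple of it removes that orbit from the support of
  \<open>k\<close>.\<close>

theorem kinv_in:
  assumes "kinv L n k"
  shows "k \<in> A"
  using assms
proof (induction "card {x \<in> words L n \<times> words L n. k (fst x) (snd x) \<noteq> 0}" arbitrary: k rule: less_induct)
  case less
  let ?W = "words L n"
  show ?case
  proof (cases "\<forall>u\<in>?W. \<forall>w\<in>?W. k u w = 0")
    case True
    then show ?thesis by (intro ext_in[OF zero_in]) auto
  next
    case False
    then obtain u0 w0 where uw0: "u0 \<in> ?W" "w0 \<in> ?W" "k u0 w0 \<noteq> 0" by auto
    define z where "z i = (u0 ! i, w0 ! i)" for i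
    define Y where "Y = psym (\<lambda>i. signed_unit (fst (z i)) (snd (z i))) {..<n}"
    have YA: "Y \<in> A" unfolding Y_def by (rule psym_in) (simp_all add: minv_signed_unit)
    have Mz: "image_mset (\<lambda>i. sign_class (z i)) (mset_set {..<n}) = mset (map sign_class (zip u0 w0))"
    proof -
      have "map sign_class (zip u0 w0) = map (\<lambda>i. sign_class (z i)) [0..<n]"
        using uw0 by (intro nth_equalityI) (auto simp: words_def z_def)
      then show ?thesis by (simp add: lessThan_atLeast0 mset_map del: map_map)
    qed
    have pos: "Y u w > 0 \<longleftrightarrow> mset (map sign_class (zip u0 w0)) = mset (map sign_class (zip u w))" if "u \<in> ?W" "w \<in> ?W" for u w
      unfolding Y_def Mz[symmetric]
      using that uw0 zero_L by (intro psym_signed_unit_pos_iff) (auto simp: words_def z_def subset_iff, metis nth_mem)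
    have Y0: "Y u0 w0 > 0" using pos uw0 by simp
    have Yinv: "kinv L n Y" by (rule inv_in[OF YA])
    define k' where "k' u w = k u w - (k u0 w0 / Y u0 w0) * Y u w" for u w
    have "kinv L n k'" using less.prems Yinv by (simp add: kinv_def k'_def)
    moreover have zero: "k' u w = (if Y u w > 0 then 0 else k u w)" if "u \<in> ?W" "w \<in> ?W" for u w
    proof (cases "Y u w > 0")
      case True
      then have "mset (map sign_class (zip u w)) = mset (map sign_class (zip u0 w0))" using pos that by simp
      then have "k u w = k u0 w0" "Y u w = Y u0 w0"
        using kinv_orbit[OF L_uminus _ that uw0(1,2)] less.prems Yinv by auto
      then show ?thesis using Y0 by (simp add: k'_def)
    next
      case False
      then have "Y u w = 0" using psym_signed_unit_nonneg[of "\<lambda>i. fst (z i)" "\<lambda>i. snd (z i)" "{..<n}" u w] by (simp add: Y_def)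
      then show ?thesis by (simp add: k'_def)
    qed
    have "card {x \<in> ?W \<times> ?W. k' (fst x) (snd x) \<noteq> 0} < card {x \<in> ?W \<times> ?W. k (fst x) (snd x) \<noteq> 0}"
    proof (rule psubset_card_mono)
      show "finite {x \<in> ?W \<times> ?W. k (fst x) (snd x) \<noteq> 0}" using finite_W by simp
      have "(u0, w0) \<in> {x \<in> ?W \<times> ?W. k (fst x) (snd x) \<noteq> 0}"
        "(u0, w0) \<notin> {x \<in> ?W \<times> ?W. k' (fst x) (snd x) \<noteq> 0}" using uw0 zero Y0 by auto
      moreover have "{x \<in> ?W \<times> ?W. k' (fst x) (snd x) \<noteq> 0} \<subseteq> {x \<in> ?W \<times> ?W. k (fst x) (snd x) \<noteq> 0}"
        using zero by (auto split: if_splits)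
      ultimately show "{x \<in> ?W \<times> ?W. k' (fst x) (snd x) \<noteq> 0} \<subset> {x \<in> ?W \<times> ?W. k (fst x) (snd x) \<noteq> 0}"
        by blast
    qed
    ultimately have "k' \<in> A" using less.hyps by blast
    then have "(\<lambda>u w. k' u w + k u0 w0 / Y u0 w0 * Y u w) \<in> A"
      by (rule add_in[OF _ scale_in[OF YA]])
    then show ?thesis by (simp add: k'_def)
  qed
qed

end

section \<open>The derivations generated by the coideal subalgebra\<close>

text \<open>The second term appears because \<open>signed_unit b' c\<close> equals
  \<open>signed_unit (- b') (- c)\<close>.\<close>

lemma lmul_signed_unit:
  assumes "finite L" "\<And>l. l \<in> L \<Longrightarrow> - l \<in> L" "0 \<notin> L" "b \<in> L"
  shows "lmul L (signed_unit a b) (signed_unit b' c) e f =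
    of_bool (b = b') * signed_unit a c e f + of_bool (b = - b') * signed_unit a (- c) e f"
proof -
  have b: "- b \<in> L" "b \<noteq> - b" using assms by auto
  have "lmul L (signed_unit a b) (signed_unit b' c) e f =
    (\<Sum>g\<in>L. (if g = b then of_bool (e = a) * signed_unit b' c g f else 0) + (if g = - b then of_bool (e = - a) * signed_unit b' c g f else 0))"
    unfolding lmul_def by (intro sum.cong refl) (use b in \<open>auto simp: signed_unit_def\<close>)
  also have "\<dots> = of_bool (e = a) * signed_unit b' c b f + of_bool (e = - a) * signed_unit b' c (- b) f"
    using assms(1,4) b(1) by (simp add: sum.distrib sum.delta)
  also have "\<dots> = of_bool (b = b') * signed_unit a c e f + of_bool (b = - b') * signed_unit a (- c) e f"
    using b(2) by (auto simp: signed_unit_def)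
  finally show ?thesis .
qed

locale word_kernel_algebra = kernel_algebra "words L n" A for L n A +
  assumes finite_L: "finite L" and L_uminus: "l \<in> L \<Longrightarrow> - l \<in> L" and zero_L: "0 \<notin> L"
begin

lemma deriv_op_ext:
  assumes "deriv_op Y \<in> A" "\<And>c d. c \<in> L \<Longrightarrow> d \<in> L \<Longrightarrow> Y c d = Z c d"
  shows "deriv_op Z \<in> A"
  using assms by (intro ext_in[OF assms(1)] psym_cong) (auto simp: words_def)

lemma deriv_op_add:
  assumes "deriv_op Y \<in> A" "deriv_op Z \<in> A"
  shows "deriv_op (\<lambda>c d. Y c d + Z c d) \<in> A"
proof (rule ext_in[OF add_in[OF assms]])
  fix u w assume "u \<in> words L n" "w \<in> words L n"
  then show "deriv_op Y u w + deriv_op Z u w = deriv_op (\<lambda>c d. Y c d + Z c d) u w"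
    using deriv_op_sum[where Y = "\<lambda>c d. Y c d + Z c d" and I = UNIV and t = "\<lambda>x. 1"
        and V = "\<lambda>x. if x then Y else Z" and u = u and w = w]
    by (simp add: words_def UNIV_bool)
qed

text \<open>The contributions in which the two derivations hit different factors agree in both
  products and cancel; the commutator is the derivation of the matrix commutator.\<close>

lemma deriv_op_commutator:
  assumes "deriv_op Y \<in> A" "deriv_op Z \<in> A"
  shows "deriv_op (\<lambda>c d. lmul L Y Z c d - lmul L Z Y c d) \<in> A"
proof -
  have "kmul (words L n) (deriv_op Y) (deriv_op Z) u w - kmul (words L n) (deriv_op Z) (deriv_op Y) u w
      = deriv_op (lmul L Y Z) u w - deriv_op (lmul L Z Y) u w" if "u \<in> words L n" "w \<in> words L n" for u w
  proof -
    have 1: "psym (\<lambda>_. Z) {Suc 0} = deriv_op Z" by (intro ext psym_sing) simp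
    have 2: "psym ((\<lambda>_. Z)(Suc 0 := V)) {Suc 0} = deriv_op V" "psym ((\<lambda>_. Y)(0 := V)) {0} = deriv_op V" for V
      by (intro ext psym_sing, simp)+
    have "kmul (words L n) (deriv_op Y) (deriv_op Z) u w
      = psym ((\<lambda>_. Z)(0 := Y)) {0, Suc 0} u w + deriv_op (lmul L Y Z) u w"
      using deriv_op_mult[OF finite_L, of "{Suc 0}" 0 u n w Y "\<lambda>_. Z"] that unfolding 1 by (simp add: 2)
    moreover have "kmul (words L n) (deriv_op Z) (deriv_op Y) u w
      = psym ((\<lambda>_. Y)(Suc 0 := Z)) {Suc 0, 0} u w + deriv_op (lmul L Z Y) u w"
      using deriv_op_mult[OF finite_L, of "{0}" "Suc 0" u n w Z "\<lambda>_. Y"] that by (simp add: 2)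
    moreover have "psym ((\<lambda>_. Z)(0 := Y)) {0, Suc 0} u w = psym ((\<lambda>_. Y)(Suc 0 := Z)) {Suc 0, 0} u w"
      unfolding insert_commute[of "Suc 0" 0] by (rule psym_cong) auto
    ultimately show ?thesis by simp
  qed
  moreover have "deriv_op (lmul L Y Z) u w - deriv_op (lmul L Z Y) u w
      = deriv_op (\<lambda>c d. lmul L Y Z c d - lmul L Z Y c d) u w" if "u \<in> words L n" "w \<in> words L n" for u w
    using deriv_op_sum[where Y = "\<lambda>c d. lmul L Y Z c d - lmul L Z Y c d" and I = UNIV and t = "\<lambda>x. if x then 1 else - 1"
        and V = "\<lambda>x. if x then lmul L Y Z else lmul L Z Y" and u = u and w = w] that
    by (simp add: words_def UNIV_bool)
  ultimately show ?thesis
    by (intro ext_in[OF diff_in[OF mult_in[OF assms] mult_in[OF assms(2,1)]]]) simp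
qed

lemma signed_unit_trans:
  assumes "deriv_op (signed_unit a b) \<in> A" "deriv_op (signed_unit b c) \<in> A" "b \<in> L" "c \<in> L" "c \<noteq> a" "c \<noteq> - a"
  shows "deriv_op (signed_unit a c) \<in> A"
proof (rule deriv_op_ext[OF deriv_op_commutator[OF assms(1,2)]])
  have "b \<noteq> - b" using assms zero_L by auto
  then show "lmul L (signed_unit a b) (signed_unit b c) e f - lmul L (signed_unit b c) (signed_unit a b) e f = signed_unit a c e f" for e f
    using assms by (simp add: lmul_signed_unit[OF finite_L L_uminus zero_L])
qed

text \<open>The exceptional case \<open>c = - a\<close> of \<open>signed_unit_trans\<close>: here
  the commutator is \<open>signed_unit a (- a)\<close> minus \<open>signed_unit b (- b)\<close>, so
  one such element must be known beforehand. The index \<open>i = 0\<close> supplies it.\<close>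

lemma signed_unit_trans_uminus:
  assumes "deriv_op (signed_unit a b) \<in> A" "deriv_op (signed_unit b (- a)) \<in> A" "deriv_op (signed_unit b (- b)) \<in> A" "a \<in> L" "b \<in> L"
  shows "deriv_op (signed_unit a (- a)) \<in> A"
proof (rule deriv_op_ext[OF deriv_op_add[OF deriv_op_commutator[OF assms(1,2)] assms(3)]])
  have "b \<noteq> - b" "a \<noteq> - a" "- a \<in> L" using assms zero_L L_uminus by auto
  then show "lmul L (signed_unit a b) (signed_unit b (- a)) e f - lmul L (signed_unit b (- a)) (signed_unit a b) e f + signed_unit b (- b) e f = signed_unit a (- a) e f" for e f
    using assms by (simp add: lmul_signed_unit[OF finite_L L_uminus zero_L])
qed

text \<open>On the positive letters \<open>p k\<close>, indices \<open>i > 0\<close> give the steps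
  down and, up to common sign, indices \<open>i < 0\<close> the steps up; \<open>i = 0\<close> links
  \<open>p 0\<close> with \<open>- p 0\<close>. Chains of commutators connect all positive letters,
  then cross to the negative ones through \<open>p 0\<close>.\<close>

lemma deriv_op_signed_unit_all:
  assumes L: "L = halfs m" and diag: "\<And>j. j \<in> L \<Longrightarrow> deriv_op (signed_unit j j) \<in> A"
    and simple: "\<And>i. \<bar>i\<bar> \<le> int m - 1 \<Longrightarrow> deriv_op (signed_unit (2 * i + 1) (2 * i - 1)) \<in> A"
    and ab: "a \<in> L" "b \<in> L"
  shows "deriv_op (signed_unit a b) \<in> A"
proof -
  define p :: "nat \<Rightarrow> int" where "p k = 2 * int k + 1" for k
  have p: "p k \<in> L" "- p k \<in> L" if "k < m" for k using that by (auto simp: p_def L halfs_def)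
  have p0: "p k \<noteq> - p j" "p k = p j \<longleftrightarrow> k = j" for j k by (auto simp: p_def)
  have down: "deriv_op (signed_unit (p (Suc k)) (p k)) \<in> A" if "Suc k < m" for k
    using simple[of "int k + 1"] that by (simp add: p_def add.commute)
  have up: "deriv_op (signed_unit (p k) (p (Suc k))) \<in> A" if "Suc k < m" for k
  proof -
    have e: "2 * (- int k - 1) + 1 = - p k" "2 * (- int k - 1) - 1 = - p (Suc k)" by (simp_all add: p_def)
    show ?thesis using simple[of "- int k - 1"] that unfolding e signed_unit_uminus by simp
  qed
  have pos: "deriv_op (signed_unit (p j) (p (j + d))) \<in> A \<and> deriv_op (signed_unit (p (j + d)) (p j)) \<in> A" if "j + d < m" for j d
    using that
  proof (induction d)
    case 0 then show ?case using diag p by simp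
  next
    case (Suc d)
    then have IH: "deriv_op (signed_unit (p j) (p (j + d))) \<in> A" "deriv_op (signed_unit (p (j + d)) (p j)) \<in> A" by auto
    have "deriv_op (signed_unit (p j) (p (Suc (j + d)))) \<in> A"
      by (rule signed_unit_trans[OF IH(1) up]) (use Suc.prems in \<open>auto intro: p simp: p0\<close>)
    moreover have "deriv_op (signed_unit (p (Suc (j + d))) (p j)) \<in> A"
      by (rule signed_unit_trans[OF down IH(2)]) (use Suc.prems in \<open>auto intro: p simp: p0\<close>)
    ultimately show ?case by simp
  qed
  have pp: "deriv_op (signed_unit (p j) (p k)) \<in> A" if "j < m" "k < m" for j k
    using pos[of j "k - j"] pos[of k "j - k"] that by (cases "j \<le> k") auto
  have m: "0 < m" using ab(1) by (cases m) (auto simp: L halfs_def)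
  have X1: "deriv_op (signed_unit (p 0) (- p 0)) \<in> A" using simple[of 0] m by (simp add: p_def)
  have X1c: "deriv_op (signed_unit (p 0) (- p k)) \<in> A" if "k < m" for k
  proof (cases "k = 0")
    case False
    have "deriv_op (signed_unit (- p 0) (- p k)) \<in> A" using pp[OF m that] by (simp add: signed_unit_uminus)
    from signed_unit_trans[OF X1 this] show ?thesis using False that m p p0[of 0 k] p0[of k 0] by (auto simp: p0)
  qed (use X1 in simp)
  have pm: "deriv_op (signed_unit (p j) (- p k)) \<in> A" if "j < m" "k < m" for j k
  proof (cases "j = k")
    case False
    then show ?thesis using signed_unit_trans[OF pp[OF that(1) m] X1c[OF that(2)]] that m p p0(1)[of j k, symmetric] by (auto simp: p0)
  next
    case True
    then show ?thesis using signed_unit_trans_uminus[OF pp[OF that(1) m] X1c[OF that(1)] X1] that m p by auto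
  qed
  have "\<exists>k<m. c = p k \<or> c = - p k" if "c \<in> L" for c
  proof -
    from that obtain i where i: "c = 2 * i + 1" "\<bar>2 * i + 1\<bar> \<le> 2 * int m - 1" by (auto simp: L halfs_def elim!: oddE)
    show ?thesis
    proof (cases "i \<ge> 0")
      case True
      then show ?thesis using i by (intro exI[of _ "nat i"]) (auto simp: p_def)
    next
      case False
      then show ?thesis using i by (intro exI[of _ "nat (- i - 1)"]) (auto simp: p_def)
    qed
  qed
  from this[OF ab(1)] this[OF ab(2)] obtain j k where
    "j < m" "k < m" "a = p j \<or> a = - p j" "b = p k \<or> b = - p k" by auto
  then show ?thesis
    using pp[of j k] pm[of j k] signed_unit_uminus[of "p j" "p k"] signed_unit_uminus[of "p j" "- p k"] by auto
qed

end

section \<open>The generators at \<open>q = 1\<close>\<close>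

definition specv :: "int falg \<Rightarrow> (int list \<Rightarrow> rat) \<Rightarrow> bool" where
  "specv v f \<longleftrightarrow> (\<forall>w. spec1 (Poly_Mapping.lookup v (Word w)) (f w))"

lemma specv_add: "specv v f \<Longrightarrow> specv u g \<Longrightarrow> specv (v + u) (\<lambda>w. f w + g w)"
  by (auto simp: specv_def lookup_add intro: spec1_add)
lemma specv_sm: "spec1 c r \<Longrightarrow> specv v f \<Longrightarrow> specv (sm c v) (\<lambda>w. r * f w)"
  by (auto simp: specv_def intro: spec1_mult)
lemma specv_wd: "specv (wd u) (\<lambda>w. of_bool (u = w))"
  by (auto simp: specv_def lookup_single when_def)
lemma specv_0: "specv 0 (\<lambda>w. 0)" by (simp add: specv_def)

lemma lookup_gen_mult:
  "Poly_Mapping.lookup (gen l * v) (Word w) =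
    (case w of [] \<Rightarrow> 0 | d # w' \<Rightarrow> of_bool (l = d) * Poly_Mapping.lookup v (Word w'))"
proof -
  have "gen l * v = (\<Sum>k\<in>Poly_Mapping.keys v. sm (Poly_Mapping.lookup v k) (wd (l # letters k)))"
    by (subst bas_decomp[of v]) (simp add: sum_distrib_left bas_mult plus_word_def)
  then have "Poly_Mapping.lookup (gen l * v) (Word w) =
    (\<Sum>k\<in>Poly_Mapping.keys v. if l # letters k = w then Poly_Mapping.lookup v k else 0)"
    by (simp add: lookup_sum lookup_single when_def if_distrib cong: if_cong)
  also have "\<dots> = (case w of [] \<Rightarrow> 0 | d # w' \<Rightarrow> of_bool (l = d) * Poly_Mapping.lookup v (Word w'))"
  proof (cases w)
    case (Cons d w')
    have "(l # letters k = d # w') \<longleftrightarrow> (l = d \<and> k = Word w')" for k by (cases k) auto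
    then show ?thesis using Cons by (auto simp: in_keys_iff)
  qed simp
  finally show ?thesis .
qed

lemma specv_gen_mult:
  "specv v f \<Longrightarrow> specv (gen l * v) (\<lambda>w. case w of [] \<Rightarrow> 0 | d # w' \<Rightarrow> of_bool (l = d) * f w')"
  by (auto simp: specv_def lookup_gen_mult split: list.split)

lemma specv_cong: "specv v f \<Longrightarrow> (\<And>w. f w = g w) \<Longrightarrow> specv v g"
  by (simp add: specv_def)

lemma spec1_kap: "spec1 (kap i l) 1" by (simp add: kap_def)
lemma spec1_kinvw: "spec1 (kinvw i w) 1"
  using spec1_mult[OF spec1_power[OF spec1_q(1)] spec1_power[OF spec1_q(2)]] by (simp add: kinvw_def)

text \<open>At \<open>q = 1\<close> the twists \<open>kap\<close> become one, and the twisted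
  Leibniz rule becomes the rule for a derivation.\<close>

lemma specv_E: "specv (Eop i (wd u)) (deriv_op (\<lambda>c d. of_bool (c = 2 * i + 1 \<and> d = 2 * i - 1)) u)"
proof (induction u)
  case Nil
  have "deriv_op Y [] = (\<lambda>w. 0)" for Y by (rule ext) (case_tac w; simp)
  then show ?case by (simp add: uact_wd specv_0)
next
  case (Cons l u)
  have "specv (if l = 2 * i + 1 then wd ((l - 2) # u) else 0)
      (\<lambda>w. of_bool (l = 2 * i + 1) * of_bool ((l - 2) # u = w))"
    using specv_wd[of "(l - 2) # u"] specv_0 by auto
  note * = specv_add[OF specv_sm[OF spec1_kap[of i l] specv_gen_mult[OF Cons, of l]] this]
  have eq: "Eop i (wd (l # u)) = sm (kap i l) (gen l * Eop i (wd u))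
      + (if l = 2 * i + 1 then wd ((l - 2) # u) else 0)"
    by (simp add: uact_wd gen_wd)
  show ?case unfolding eq
    by (rule specv_cong[OF *]) (auto simp: psym_empty split: list.split)
qed

lemma specv_F: "specv (Fop i (wd u)) (deriv_op (\<lambda>c d. of_bool (c = 2 * i - 1 \<and> d = 2 * i + 1)) u)"
proof (induction u)
  case Nil
  have "deriv_op Y [] = (\<lambda>w. 0)" for Y by (rule ext) (case_tac w; simp)
  then show ?case by (simp add: uact_wd specv_0)
next
  case (Cons l u)
  have "specv (if l = 2 * i - 1 then sm (kinvw i u) (wd ((l + 2) # u)) else 0)
      (\<lambda>w. of_bool (l = 2 * i - 1) * of_bool ((l + 2) # u = w))"
    using specv_sm[OF spec1_kinvw[of i u] specv_wd[of "(l + 2) # u"]] specv_0 by auto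
  note * = specv_add[OF specv_gen_mult[OF Cons, of l] this]
  have eq: "Fop i (wd (l # u)) = gen l * Fop i (wd u)
      + (if l = 2 * i - 1 then sm (kinvw i u) (wd ((l + 2) # u)) else 0)"
    by (simp add: uact_wd gen_wd)
  show ?case unfolding eq
    by (rule specv_cong[OF *]) (auto simp: psym_empty split: list.split)
qed

lemma deriv_op_signed_unit: "deriv_op (signed_unit a b) u w =
  deriv_op (\<lambda>c d. of_bool (c = a \<and> d = b)) u w + deriv_op (\<lambda>c d. of_bool (c = - a \<and> d = - b)) u w"
proof (induction u arbitrary: w)
  case Nil then show ?case by (cases w) auto
next
  case (Cons c u) then show ?case
    by (cases w) (auto simp: psym_empty signed_unit_def distrib_right)
qed

lemma specv_B: "specv (Bop i (wd u)) (deriv_op (signed_unit (2 * i + 1) (2 * i - 1)) u)"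
proof -
  have F: "specv (Fop (- i) (wd u)) (deriv_op (\<lambda>c d. of_bool (c = - (2 * i + 1) \<and> d = - (2 * i - 1))) u)"
    using specv_F[of "- i" u] by simp
  have E: "specv (Eop i (Kinvop (- i) (wd u))) (deriv_op (\<lambda>c d. of_bool (c = 2 * i + 1 \<and> d = 2 * i - 1)) u)"
    using specv_sm[OF spec1_kinvw specv_E, of "- i" u i u] by (simp add: Kinvop_wd uact_lin)
  have E0: "specv (sm (inverse q) (Eop i (Kinvop (- i) (wd u)))) (deriv_op (\<lambda>c d. of_bool (c = 2 * i + 1 \<and> d = 2 * i - 1)) u)"
    using specv_sm[OF spec1_q(2) E] by simp
  show ?thesis
    using specv_add[OF E F] specv_add[OF E0 F]
    by (auto simp: Bop_eq deriv_op_signed_unit elim!: specv_cong)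
qed

lemma spec1_q_number: "spec1 (inverse (q - 1) * (q ^ k - 1)) (of_nat k)"
proof -
  have "inverse (q - 1) * (q ^ k - 1) = (\<Sum>i<k. q ^ i)"
    by (simp add: power_diff_1_eq flip: mult.assoc)
  moreover have "spec1 (\<Sum>i<k. q ^ i) (\<Sum>i<k. 1 ^ i)"
    by (intro spec1_sum spec1_power spec1_q)
  ultimately show ?thesis by simp
qed

text \<open>A word with \<open>k\<close> letters \<open>\<plusminus> j\<close> has eigenvalue
  \<open>q ^ k\<close>, and \<open>(q ^ k - 1) / (q - 1)\<close> is a \<open>q\<close>-integer with
  value \<open>k\<close> at \<open>1\<close>. The derivation of \<open>signed_unit j j\<close>
  counts the same letters.\<close>

lemma specv_D:
  assumes "j \<noteq> 0"
  shows "specv (sm (inverse (q - 1)) (Dop j (Dop (- j) (wd u)) - wd u)) (deriv_op (signed_unit j j) u)"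
proof -
  define k where "k = count_list u j + count_list u (- j)"
  have "sm (inverse (q - 1)) (Dop j (Dop (- j) (wd u)) - wd u) = sm (inverse (q - 1) * (q ^ k - 1)) (wd u)"
    by (rule poly_mapping_eqI) (simp add: uact_wd uact_lin lookup_minus k_def power_add algebra_simps)
  moreover have "of_nat k * of_bool (u = w) = deriv_op (signed_unit j j) u w" for w
    unfolding k_def
  proof (induction u arbitrary: w)
    case Nil then show ?case by (cases w) auto
  next
    case (Cons c u)
    show ?case
    proof (cases w)
      case (Cons d w')
      then show ?thesis using Cons.IH[of w'] assms by (auto simp: psym_empty signed_unit_def)
    qed simp
  qed
  ultimately show ?thesis
    using specv_sm[OF spec1_q_number[of k] specv_wd[of u]] by (auto elim: specv_cong)
qed

section \<open>Operator spaces and their specializations\<close>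

definition coef :: "(int falg \<Rightarrow> int falg) \<Rightarrow> int list \<Rightarrow> int list \<Rightarrow> qfield" where
  "coef T u w = Poly_Mapping.lookup (T (wd u)) (Word w)"

lemma finite_halfs: "finite (halfs m)"
  by (rule finite_subset[of _ "{- (2 * int m)..2 * int m}"]) (auto simp: halfs_def)

lemma wd_tens: "wd u \<in> tens m n \<longleftrightarrow> u \<in> words (halfs m) n"
  by (simp add: tens_wspan)

lemma tens_expand:
  assumes "x \<in> tens m n"
  shows "x = (\<Sum>v\<in>words (halfs m) n. sm (Poly_Mapping.lookup x (Word v)) (wd v))"
proof (rule poly_mapping_eqI)
  fix k :: "int word"
  obtain w where k: "k = Word w" by (cases k)
  have "Poly_Mapping.lookup (\<Sum>v\<in>words (halfs m) n. sm (Poly_Mapping.lookup x (Word v)) (wd v)) k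
      = (\<Sum>v\<in>words (halfs m) n. if v = w then Poly_Mapping.lookup x (Word v) else 0)"
    by (simp add: lookup_sum lookup_single when_def k if_distrib cong: if_cong)
  also have "\<dots> = (if w \<in> words (halfs m) n then Poly_Mapping.lookup x (Word w) else 0)"
    by (simp add: sum.delta finite_words finite_halfs)
  also have "\<dots> = Poly_Mapping.lookup x k"
  proof -
    have "w \<in> words (halfs m) n" if "Word w \<in> Poly_Mapping.keys x"
      using assms that by (force simp: tens_wspan wspan_def)
    then show ?thesis by (auto simp: k in_keys_iff)
  qed
  finally show "Poly_Mapping.lookup x k = Poly_Mapping.lookup
    (\<Sum>v\<in>words (halfs m) n. sm (Poly_Mapping.lookup x (Word v)) (wd v)) k" by simp
qed

lemma endosD:
  assumes "T \<in> endos m n"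
  shows "v \<in> tens m n \<Longrightarrow> T v \<in> tens m n"
    and "v \<in> tens m n \<Longrightarrow> w \<in> tens m n \<Longrightarrow> T (v + w) = T v + T w"
    and "v \<in> tens m n \<Longrightarrow> T (sm c v) = sm c (T v)"
    and "v \<notin> tens m n \<Longrightarrow> T v = undefined"
  using assms by (auto simp: endos_def sm_def)

lemma zero_tens: "0 \<in> tens m n" by (simp add: tens_wspan)

text \<open>Members of \<open>endos\<close> are linear on \<open>tens m n\<close> only and
  \<open>undefined\<close> elsewhere, so the calculus of \<open>lin\<close> does not apply and
  partial sums must be kept inside \<open>tens m n\<close>.\<close>

lemma endos_expand:
  assumes T: "T \<in> endos m n" and x: "x \<in> tens m n"
  shows "T x = (\<Sum>v\<in>words (halfs m) n. sm (Poly_Mapping.lookup x (Word v)) (T (wd v)))"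
proof -
  have T0: "T 0 = 0" using endosD(3)[OF T zero_tens, of 0] by simp
  have "(\<Sum>v\<in>I. sm (c v) (wd v)) \<in> tens m n
      \<and> T (\<Sum>v\<in>I. sm (c v) (wd v)) = (\<Sum>v\<in>I. sm (c v) (T (wd v)))"
    if "finite I" "I \<subseteq> words (halfs m) n" for c I
    using that
    by (induction I) (auto simp: zero_tens T0 wd_tens endosD[OF T] tens_closed)
  from this[OF finite_words[OF finite_halfs] order_refl]
  show ?thesis using tens_expand[OF x] by metis
qed

lemma endos_eqI:
  assumes "S \<in> endos m n" "T \<in> endos m n"
    and "\<And>u w. u \<in> words (halfs m) n \<Longrightarrow> w \<in> words (halfs m) n \<Longrightarrow> coef S u w = coef T u w"
  shows "S = T"
proof (rule ext)
  fix x
  have "S (wd v) = T (wd v)" if "v \<in> words (halfs m) n" for v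
    using assms(3)[OF that] that endosD(1)[OF assms(1)] endosD(1)[OF assms(2)]
    by (subst (1 2) tens_expand[of _ m n]) (simp_all add: wd_tens coef_def)
  then show "S x = T x"
    by (cases "x \<in> tens m n")
      (simp_all add: endos_expand[OF assms(1)] endos_expand[OF assms(2)] endosD(4)[OF assms(1)] endosD(4)[OF assms(2)])
qed

definition opadd :: "nat \<Rightarrow> nat \<Rightarrow> (int falg \<Rightarrow> int falg) \<Rightarrow> (int falg \<Rightarrow> int falg) \<Rightarrow> int falg \<Rightarrow> int falg" where
  "opadd m n S T = restrict (\<lambda>v. S v + T v) (tens m n)"
definition opscale :: "nat \<Rightarrow> nat \<Rightarrow> qfield \<Rightarrow> (int falg \<Rightarrow> int falg) \<Rightarrow> int falg \<Rightarrow> int falg" where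
  "opscale m n c T = restrict (\<lambda>v. sm c (T v)) (tens m n)"
definition opcomp :: "nat \<Rightarrow> nat \<Rightarrow> (int falg \<Rightarrow> int falg) \<Rightarrow> (int falg \<Rightarrow> int falg) \<Rightarrow> int falg \<Rightarrow> int falg" where
  "opcomp m n S T = restrict (\<lambda>v. S (T v)) (tens m n)"

lemma restrict_endosI:
  assumes "\<And>v. v \<in> tens m n \<Longrightarrow> T v \<in> tens m n"
    and "\<And>v w. v \<in> tens m n \<Longrightarrow> w \<in> tens m n \<Longrightarrow> T (v + w) = T v + T w"
    and "\<And>c v. v \<in> tens m n \<Longrightarrow> T (sm c v) = sm c (T v)"
  shows "restrict T (tens m n) \<in> endos m n"
  unfolding endos_def sm_def[symmetric]
  using assms(1) by (auto simp: assms(2,3) tens_closed)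

lemma opadd_endos:
  assumes S: "S \<in> endos m n" and T: "T \<in> endos m n"
  shows "opadd m n S T \<in> endos m n"
  unfolding opadd_def
  by (rule restrict_endosI) (simp_all add: endosD[OF S] endosD[OF T] tens_closed sm_add_right)

lemma opscale_endos:
  assumes T: "T \<in> endos m n"
  shows "opscale m n c T \<in> endos m n"
  unfolding opscale_def
  by (rule restrict_endosI) (simp_all add: endosD[OF T] tens_closed sm_add_right mult.commute)

lemma coef_opadd: "u \<in> words (halfs m) n \<Longrightarrow> coef (opadd m n S T) u w = coef S u w + coef T u w"
  by (simp add: coef_def opadd_def wd_tens lookup_add)
lemma coef_opscale: "u \<in> words (halfs m) n \<Longrightarrow> coef (opscale m n c T) u w = c * coef T u w"
  by (simp add: coef_def opscale_def wd_tens)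
text \<open>The order of the kernels is reversed, since \<open>u\<close> is the input.\<close>

lemma coef_comp:
  assumes "S \<in> endos m n" "T \<in> endos m n" "u \<in> words (halfs m) n"
  shows "Poly_Mapping.lookup (S (T (wd u))) (Word w) = kmul (words (halfs m) n) (coef T) (coef S) u w"
  by (simp add: endos_expand[OF assms(1)] endosD(1)[OF assms(2)] wd_tens assms(3) lookup_sum kmul_def coef_def)

text \<open>The values at \<open>q = 1\<close> of the members whose matrix entries are all regular.
  Values off \<open>words (halfs m) n\<close> are free, in accordance with
  \<open>ext_in\<close>.\<close>

definition specialized :: "nat \<Rightarrow> nat \<Rightarrow> (int falg \<Rightarrow> int falg) set \<Rightarrow> (int list \<Rightarrow> int list \<Rightarrow> rat) set" where
  "specialized m n S = {k. \<exists>T\<in>S. \<forall>u\<in>words (halfs m) n. \<forall>w\<in>words (halfs m) n. spec1 (coef T u w) (k u w)}"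

locale operator_space =
  fixes m n :: nat and S :: "(int falg \<Rightarrow> int falg) set"
  assumes sub_endos: "S \<subseteq> endos m n" and nonempty: "S \<noteq> {}"
    and add: "T \<in> S \<Longrightarrow> T' \<in> S \<Longrightarrow> opadd m n T T' \<in> S"
    and scale: "T \<in> S \<Longrightarrow> opscale m n c T \<in> S"
begin

definition mats :: "(int list \<times> int list \<Rightarrow> qfield) set" where
  "mats = {f. \<exists>T\<in>S. \<forall>u\<in>words (halfs m) n. \<forall>w\<in>words (halfs m) n. f (u, w) = coef T u w}"

lemma fsubspace_mats: "fsubspace mats"
  unfolding fsubspace_def
proof (intro conjI ballI allI)
  obtain T where T: "T \<in> S" using nonempty by auto
  then show "(\<lambda>_. 0) \<in> mats"
    unfolding mats_def by (auto intro!: bexI[OF _ scale[OF T, of 0]] simp: coef_opscale)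
  fix f g c assume "f \<in> mats"
  then obtain T where T: "T \<in> S" "\<And>u w. u \<in> words (halfs m) n \<Longrightarrow> w \<in> words (halfs m) n \<Longrightarrow> f (u, w) = coef T u w"
    by (auto simp: mats_def)
  then show "(\<lambda>i. c * f i) \<in> mats"
    unfolding mats_def by (auto intro!: bexI[OF _ scale[OF T(1), of c]] simp: coef_opscale)
  assume "g \<in> mats"
  then obtain T' where T': "T' \<in> S" "\<And>u w. u \<in> words (halfs m) n \<Longrightarrow> w \<in> words (halfs m) n \<Longrightarrow> g (u, w) = coef T' u w"
    by (auto simp: mats_def)
  then show "(\<lambda>i. f i + g i) \<in> mats"
    unfolding mats_def using T(2) by (auto intro!: bexI[OF _ add[OF T(1) T'(1)]] simp: coef_opadd)
qed

end

lemma specialization_subset: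
  assumes "operator_space m n S" "operator_space m n S'" "S \<subseteq> S'"
    and spec: "\<And>T k. T \<in> S' \<Longrightarrow>
      (\<And>u w. u \<in> words (halfs m) n \<Longrightarrow> w \<in> words (halfs m) n \<Longrightarrow> spec1 (coef T u w) (k u w)) \<Longrightarrow> k \<in> specialized m n S"
  shows "S' \<subseteq> S"
proof
  fix T assume T: "T \<in> S'"
  interpret S: operator_space m n S by fact
  interpret S': operator_space m n S' by fact
  let ?W = "words (halfs m) n"
  have "\<exists>y\<in>S.mats. \<forall>i\<in>?W \<times> ?W. y i = (\<lambda>(u, w). coef T u w) i"
  proof (rule specialization[OF _ S.fsubspace_mats S'.fsubspace_mats])
    show "finite (?W \<times> ?W)" by (simp add: finite_words finite_halfs)
    show "S.mats \<subseteq> S'.mats" using assms(3) by (auto simp: S.mats_def S'.mats_def)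
    show "(\<lambda>(u, w). coef T u w) \<in> S'.mats" using T by (auto simp: S'.mats_def)
    fix x r assume "x \<in> S'.mats" and r: "\<And>i. i \<in> ?W \<times> ?W \<Longrightarrow> spec1 (x i) (r i)"
    then obtain T1 where T1: "T1 \<in> S'" "\<And>u w. u \<in> ?W \<Longrightarrow> w \<in> ?W \<Longrightarrow> x (u, w) = coef T1 u w"
      by (auto simp: S'.mats_def)
    have "(\<lambda>u w. r (u, w)) \<in> specialized m n S"
      by (rule spec[OF T1(1)]) (use r T1(2) in fastforce)
    then obtain T2 where "T2 \<in> S" "\<forall>u\<in>?W. \<forall>w\<in>?W. spec1 (coef T2 u w) (r (u, w))" by (auto simp: specialized_def)
    then show "\<exists>y\<in>S.mats. \<forall>i\<in>?W \<times> ?W. spec1 (y i) (r i)"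
      by (intro bexI[of _ "\<lambda>(u, w). coef T2 u w"]) (auto simp: S.mats_def)
  qed
  then obtain T2 where T2: "T2 \<in> S" "\<And>u w. u \<in> ?W \<Longrightarrow> w \<in> ?W \<Longrightarrow> coef T u w = coef T2 u w"
    by (fastforce simp: S.mats_def)
  have "T = T2"
    using T T2 S.sub_endos S'.sub_endos by (intro endos_eqI[of T m n T2]) auto
  then show "T \<in> S" using T2 by simp
qed

lemma operator_space_commutant:
  assumes X: "X \<subseteq> endos m n"
  shows "operator_space m n (commutant m n X)"
proof
  show "commutant m n X \<subseteq> endos m n" by (auto simp: commutant_def)
  have X1: "S \<in> endos m n" if "S \<in> X" for S using that X by auto
  have "restrict (\<lambda>v. v) (tens m n) \<in> commutant m n X"
    using endosI[OF lin_id, of m n] endosD(1)[OF X1] by (auto simp: commutant_def)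
  then show "commutant m n X \<noteq> {}" by auto
  fix T T' c assume T: "T \<in> commutant m n X"
  then have Te: "T \<in> endos m n" by (simp add: commutant_def)
  then show "opscale m n c T \<in> commutant m n X"
    using T endosD[OF X1] endosD[OF Te] opscale_endos
    by (auto simp: commutant_def opscale_def)
  assume T': "T' \<in> commutant m n X"
  then have T'e: "T' \<in> endos m n" by (simp add: commutant_def)
  show "opadd m n T T' \<in> commutant m n X"
    using T T' endosD[OF X1] endosD[OF Te] endosD[OF T'e] opadd_endos
    by (auto simp: commutant_def opadd_def)
qed

locale operator_algebra = operator_space +
  assumes id_in: "restrict (\<lambda>v. v) (tens m n) \<in> S"
    and comp: "T \<in> S \<Longrightarrow> T' \<in> S \<Longrightarrow> opcomp m n T T' \<in> S"

lemma (in operator_algebra) kernel_algebra_specialized: "kernel_algebra (words (halfs m) n) (specialized m n S)"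
proof
  let ?W = "words (halfs m) n"
  show "finite ?W" by (simp add: finite_words finite_halfs)
  show "(\<lambda>u w. of_bool (u = w)) \<in> specialized m n S"
    unfolding specialized_def by (auto intro!: bexI[OF _ id_in] simp: coef_def wd_tens lookup_single when_def)
  fix k l c
  assume "k \<in> specialized m n S"
  then obtain T where T: "T \<in> S" "\<And>u w. u \<in> ?W \<Longrightarrow> w \<in> ?W \<Longrightarrow> spec1 (coef T u w) (k u w)" by (auto simp: specialized_def)
  show "(\<lambda>u w. c * k u w) \<in> specialized m n S"
    unfolding specialized_def
    by (auto intro!: bexI[OF _ scale[OF T(1), of "Fract [:c:] 1"]] spec1_mult[OF spec1_const] T(2) simp: coef_opscale)
  show "l \<in> specialized m n S" if "\<And>u w. u \<in> ?W \<Longrightarrow> w \<in> ?W \<Longrightarrow> k u w = l u w"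
    unfolding specialized_def using T that by (auto intro!: bexI[of _ T])
  assume "l \<in> specialized m n S"
  then obtain T' where T': "T' \<in> S" "\<And>u w. u \<in> ?W \<Longrightarrow> w \<in> ?W \<Longrightarrow> spec1 (coef T' u w) (l u w)" by (auto simp: specialized_def)
  show "(\<lambda>u w. k u w + l u w) \<in> specialized m n S"
    unfolding specialized_def
    by (auto intro!: bexI[OF _ add[OF T(1) T'(1)]] spec1_add T(2) T'(2) simp: coef_opadd)
  have e: "T \<in> endos m n" "T' \<in> endos m n" using T(1) T'(1) sub_endos by auto
  have "coef (opcomp m n T' T) u w = kmul ?W (coef T) (coef T') u w" if "u \<in> ?W" for u w
    unfolding coef_def[of "opcomp m n T' T"] using coef_comp[OF e(2,1) that] that by (simp add: opcomp_def wd_tens)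
  moreover have "spec1 (kmul ?W (coef T) (coef T') u w) (kmul ?W k l u w)" if "u \<in> ?W" "w \<in> ?W" for u w
    unfolding kmul_def using that by (intro spec1_sum spec1_mult T(2) T'(2))
  ultimately show "kmul ?W k l \<in> specialized m n S"
    unfolding specialized_def using comp[OF T'(1) T(1)] by (auto intro!: bexI[of _ "opcomp m n T' T"])
qed

text \<open>Both kernel products are values at \<open>q = 1\<close> of the same entries, and such
  values are unique.\<close>

lemma spec_commute:
  assumes T: "T \<in> endos m n" "\<And>u w. u \<in> words (halfs m) n \<Longrightarrow> w \<in> words (halfs m) n \<Longrightarrow> spec1 (coef T u w) (k u w)"
    and T': "T' \<in> endos m n" "\<And>u w. u \<in> words (halfs m) n \<Longrightarrow> w \<in> words (halfs m) n \<Longrightarrow> spec1 (coef T' u w) (l u w)"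
    and comm: "\<And>v. v \<in> tens m n \<Longrightarrow> T (T' v) = T' (T v)"
    and uw: "u \<in> words (halfs m) n" "w \<in> words (halfs m) n"
  shows "kmul (words (halfs m) n) k l u w = kmul (words (halfs m) n) l k u w"
proof (rule spec1_unique)
  let ?W = "words (halfs m) n"
  have "kmul ?W (coef T) (coef T') u w = kmul ?W (coef T') (coef T) u w"
    using coef_comp[OF T'(1) T(1) uw(1), of w] coef_comp[OF T(1) T'(1) uw(1), of w] comm[of "wd u"] uw(1)
    by (simp add: wd_tens)
  moreover have "spec1 (kmul ?W (coef T) (coef T') u w) (kmul ?W k l u w)"
    unfolding kmul_def using uw by (intro spec1_sum spec1_mult T(2) T'(2))
  ultimately show "spec1 (kmul ?W (coef T') (coef T) u w) (kmul ?W k l u w)" by simp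
  show "spec1 (kmul ?W (coef T') (coef T) u w) (kmul ?W l k u w)"
    unfolding kmul_def using uw by (intro spec1_sum spec1_mult T(2) T'(2))
qed

section \<open>The main theorem\<close>

definition simple_refl :: "nat \<Rightarrow> int list \<Rightarrow> int list" where
  "simple_refl i = (if i = 0 then negate_first else swap_letters (i - 1))"

lemma simple_refl_words:
  assumes "u \<in> words (halfs m) n" "i < n"
  shows "simple_refl i u \<in> words (halfs m) n" "simple_refl i (simple_refl i u) = u"
proof -
  have nth: "u ! j \<in> halfs m" if "j < n" for j using assms(1) that by (auto simp: words_def)
  have upd: "ls[k := x] \<in> words (halfs m) n" if "ls \<in> words (halfs m) n" "x \<in> halfs m" for ls k x
    using that set_update_subset_insert[of ls k x] by (auto simp: words_def)
  show "simple_refl i u \<in> words (halfs m) n"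
    using assms nth[of i] nth[of "i - 1"] by (auto simp: simple_refl_def negate_first_def swap_letters_def halfs_uminus intro!: upd)
  show "simple_refl i (simple_refl i u) = u"
    using assms by (auto simp: simple_refl_def negate_first_def swap_letters_def words_def nth_list_update intro!: nth_equalityI)
qed

text \<open>\<open>inverse q - q\<close> vanishes and \<open>inverse q\<close> becomes one, so the
  three cases of the Hecke generator merge into a single transposition.\<close>

lemma spec_hop:
  assumes "u \<in> words (halfs m) n" "i < n"
  shows "spec1 (coef (hact_op m n (gen i)) u w) (of_bool (w = simple_refl i u))"
proof -
  have z: "spec1 (inverse q - q) 0" using spec1_diff[OF spec1_q(2,1)] by simp
  have v: "spec1 (Poly_Mapping.lookup (wd x) (Word w)) (of_bool (w = x))" for x
    by (auto simp: lookup_single when_def)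
  have "coef (hact_op m n (gen i)) u w = Poly_Mapping.lookup (hecke_rep_gen i u) (Word w)"
    using assms(1) by (simp add: coef_def hact_op_def wd_tens hecke_rep_gen_act hop_wd)
  also have "spec1 \<dots> (of_bool (w = simple_refl i u))"
  proof (cases i)
    case 0
    then show ?thesis using v by (simp add: hecke_rep_gen_def simple_refl_def negate_first_def)
  next
    case (Suc j)
    let ?v = "wd (swap_letters j u)"
    have 1: "spec1 (Poly_Mapping.lookup (?v + sm (inverse q - q) (wd u)) (Word w)) (of_bool (w = swap_letters j u))"
      using spec1_add[OF v spec1_mult[OF z v]] by (simp add: lookup_add)
    have 2: "spec1 (Poly_Mapping.lookup (sm (inverse q) ?v) (Word w)) (of_bool (w = swap_letters j u))"
      using spec1_mult[OF spec1_q(2) v] by simp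
    have "hecke_rep_gen i u = (if u ! j < u ! Suc j then ?v
        else if u ! j > u ! Suc j then ?v + sm (inverse q - q) (wd u) else sm (inverse q) ?v)"
      by (simp add: hecke_rep_gen_def Suc Let_def swap_letters_def sm_def)
    then show ?thesis using v[of "swap_letters j u"] 1 2 by (simp add: Suc simple_refl_def)
  qed
  finally show ?thesis .
qed

context
  fixes m n :: nat
  assumes n: "n \<ge> 1"
begin

abbreviation "W \<equiv> words (halfs m) n"
abbreviation "UA \<equiv> uact_op m n ` hhf_elems m"
abbreviation "HA \<equiv> hact_op m n ` carrier (free_alg (hecke_gens n))"

lemma gen_HA: "i < n \<Longrightarrow> hact_op m n (gen i) \<in> HA"
  by (simp add: free_alg_gen hecke_gens_def)

lemma UA_algebra: "operator_algebra m n UA"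
proof
  show "UA \<subseteq> endos m n" by (auto simp: uact_op_endos)
  show "UA \<noteq> {}" using hhf_elems.one by auto
  have s: "scalar c \<in> hhf_elems m" for c by (rule hhf_elems.gen) (simp add: hhf_gens_def)
  show "restrict (\<lambda>v. v) (tens m n) \<in> UA"
    by (rule image_eqI[OF _ hhf_elems.one]) (auto simp: uact_op_def act_simps intro!: restrict_ext)
  fix T T' c assume "T \<in> UA" then obtain p where p: "T = uact_op m n p" "p \<in> hhf_elems m" by auto
  show "opscale m n c T \<in> UA"
    by (rule image_eqI[OF _ hhf_elems.mult[OF s[of c] p(2)]])
      (auto simp: p opscale_def uact_op_def act_simps intro!: restrict_ext)
  assume "T' \<in> UA" then obtain r where r: "T' = uact_op m n r" "r \<in> hhf_elems m" by auto
  show "opadd m n T T' \<in> UA"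
    by (rule image_eqI[OF _ hhf_elems.add[OF p(2) r(2)]])
      (auto simp: p r opadd_def uact_op_def act_simps intro!: restrict_ext)
  show "opcomp m n T T' \<in> UA"
    by (rule image_eqI[OF _ hhf_elems.mult[OF p(2) r(2)]])
      (auto simp: p r opcomp_def uact_op_def act_simps act_tens hhf_elems_carrier intro!: restrict_ext)
qed

lemma HA_algebra: "operator_algebra m n HA"
proof
  show "HA \<subseteq> endos m n" by (auto simp: hact_op_endos)
  show "HA \<noteq> {}" using free_alg_consts by auto
  show "restrict (\<lambda>v. v) (tens m n) \<in> HA"
    by (rule image_eqI[OF _ free_alg_consts(2)]) (auto simp: hact_op_def hecke_rep_simps intro!: restrict_ext)
  fix T T' c assume "T \<in> HA"
  then obtain p where p: "T = hact_op m n p" "p \<in> carrier (free_alg (hecke_gens n))" by auto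
  show "opscale m n c T \<in> HA"
    by (rule image_eqI[OF _ free_alg_mult[OF p(2) free_alg_scalar[of c]]])
      (auto simp: p opscale_def hact_op_def hecke_rep_simps intro!: restrict_ext)
  assume "T' \<in> HA"
  then obtain r where r: "T' = hact_op m n r" "r \<in> carrier (free_alg (hecke_gens n))" by auto
  show "opadd m n T T' \<in> HA"
    by (rule image_eqI[OF _ free_alg_add[OF p(2) r(2)]])
      (auto simp: p r opadd_def hact_op_def hecke_rep_simps intro!: restrict_ext)
  \<comment> \<open>The product is taken as \<open>r * p\<close>: in the right action the first
    factor acts first.\<close>
  show "opcomp m n T T' \<in> HA"
    by (rule image_eqI[OF _ free_alg_mult[OF r(2) p(2)]])
      (auto simp: p r opcomp_def hact_op_def hecke_rep_simps hecke_rep_tens intro!: restrict_ext)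
qed

lemma UA_HA_commute:
  assumes "T \<in> UA" "S \<in> HA" "v \<in> tens m n"
  shows "T (S v) = S (T v)"
  using assms hhf_hecke_commute[of _ m _ n v]
  by (auto simp: uact_op_def hact_op_def act_tens hecke_rep_tens hhf_elems_carrier)

lemma UA_endos: "T \<in> UA \<Longrightarrow> T \<in> endos m n" by (auto simp: uact_op_endos)
lemma HA_endos: "T \<in> HA \<Longrightarrow> T \<in> endos m n" by (auto simp: hact_op_endos)

lemma spec_commutant_kinv:
  assumes T: "T \<in> commutant m n HA" and k: "\<And>u w. u \<in> W \<Longrightarrow> w \<in> W \<Longrightarrow> spec1 (coef T u w) (k u w)"
  shows "kinv (halfs m) n k"
proof -
  have Te: "T \<in> endos m n" using T by (simp add: commutant_def)
  have inv: "k (simple_refl i u) (simple_refl i w) = k u w" if i: "i < n" and uw: "u \<in> W" "w \<in> W" for i u w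
  proof -
    let ?l = "\<lambda>u w. of_bool (w = simple_refl i u)"
    have fW: "finite W" by (simp add: finite_words finite_halfs)
    \<comment> \<open>At the column \<open>simple_refl i w\<close> one product has the single term
      \<open>k u w\<close>, the other \<open>k (simple_refl i u) (simple_refl i w)\<close>.\<close>
    have "kmul W k ?l u (simple_refl i w) = kmul W ?l k u (simple_refl i w)"
    proof (rule spec_commute[OF Te k HA_endos[OF gen_HA[OF i]] spec_hop])
      show "T (hact_op m n (gen i) v) = hact_op m n (gen i) (T v)" if "v \<in> tens m n" for v
        using T gen_HA[OF i] that by (auto simp: commutant_def)
    qed (use uw i simple_refl_words in auto)
    moreover have "kmul W k ?l u (simple_refl i w) = k u w"
    proof -
      have "simple_refl i w = simple_refl i v \<longleftrightarrow> v = w" if "v \<in> W" for v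
        using simple_refl_words(2)[OF that i] simple_refl_words(2)[OF uw(2) i] by metis
      then have "kmul W k ?l u (simple_refl i w) = (\<Sum>v\<in>W. if v = w then k u v else 0)"
        unfolding kmul_def by (intro sum.cong) auto
      then show ?thesis using uw fW by (simp add: sum.delta)
    qed
    moreover have "kmul W ?l k u (simple_refl i w) = k (simple_refl i u) (simple_refl i w)"
    proof -
      have "kmul W ?l k u (simple_refl i w) = (\<Sum>v\<in>W. if v = simple_refl i u then k v (simple_refl i w) else 0)"
        unfolding kmul_def by (intro sum.cong) auto
      then show ?thesis using simple_refl_words(1)[OF uw(1) i] fW by (simp add: sum.delta)
    qed
    ultimately show ?thesis by simp
  qed
  have "k (negate_first u) (negate_first w) = k u w" if "u \<in> W" "w \<in> W" for u w
    using inv[of 0] that n by (simp add: simple_refl_def)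
  moreover have "k (swap_letters i u) (swap_letters i w) = k u w" if "u \<in> W" "w \<in> W" "Suc i < n" for u w i
    using inv[of "Suc i"] that by (simp add: simple_refl_def)
  ultimately show ?thesis by (simp add: kinv_def)
qed

lemma UA_sub_commutant: "UA \<subseteq> commutant m n HA"
  using UA_HA_commute UA_endos by (auto simp: commutant_def)
lemma HA_sub_commutant: "HA \<subseteq> commutant m n UA"
  using UA_HA_commute HA_endos by (auto simp: commutant_def)

lemma UA_invariant_algebra: "invariant_algebra (halfs m) n (specialized m n UA)"
proof -
  interpret K: kernel_algebra W "specialized m n UA"
    by (rule operator_algebra.kernel_algebra_specialized[OF UA_algebra])
  interpret word_kernel_algebra "halfs m" n "specialized m n UA"
    by unfold_locales (auto simp: finite_halfs halfs_uminus, simp add: halfs_def)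
  have in_specialized: "k \<in> specialized m n UA"
    if "p \<in> hhf_elems m" "\<And>u w. u \<in> W \<Longrightarrow> w \<in> W \<Longrightarrow> spec1 (Poly_Mapping.lookup (act uact p (wd u)) (Word w)) (k u w)" for p k
    unfolding specialized_def using that by (auto simp: coef_def uact_op_def wd_tens)
  show ?thesis
  proof unfold_locales
    show "kinv (halfs m) n k" if "k \<in> specialized m n UA" for k
    proof -
      from that obtain T where "T \<in> UA" "\<And>u w. u \<in> W \<Longrightarrow> w \<in> W \<Longrightarrow> spec1 (coef T u w) (k u w)"
        by (auto simp: specialized_def)
      then show ?thesis using spec_commutant_kinv UA_sub_commutant by blast
    qed
    fix a b assume ab: "a \<in> halfs m" "b \<in> halfs m"
    show "deriv_op (signed_unit a b) \<in> specialized m n UA"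
    proof (rule deriv_op_signed_unit_all[OF refl _ _ ab])
      fix j assume j: "j \<in> halfs m"
      have g: "scalar (inverse (q - 1)) \<in> hhf_elems m" "D j * D (- j) \<in> hhf_elems m"
        using j by (auto intro!: hhf_elems.gen simp: hhf_gens_def)
      let ?p = "scalar (inverse (q - 1)) * (D j * D (- j) + - 1)"
      have p: "?p \<in> hhf_elems m" by (intro hhf_elems.mult[OF g(1)] hhf_elems.add[OF g(2)] hhf_elems.uminus hhf_elems.one)
      have "j \<noteq> 0" using j by (auto simp: halfs_def)
      have "act uact ?p (wd u) = sm (inverse (q - 1)) (Dop j (Dop (- j) (wd u)) - wd u)" for u
        by (simp add: act_simps lin_uminus[OF lin_act1])
      then show "deriv_op (signed_unit j j) \<in> specialized m n UA"
        using specv_D[OF \<open>j \<noteq> 0\<close>] by (intro in_specialized[OF p]) (simp add: specv_def)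
    next
      fix i assume "\<bar>i\<bar> \<le> int m - 1"
      then have "B i \<in> hhf_elems m" by (auto intro!: hhf_elems.gen simp: hhf_gens_def)
      from in_specialized[OF this] show "deriv_op (signed_unit (2 * i + 1) (2 * i - 1)) \<in> specialized m n UA"
        using specv_B[of i] by (simp add: specv_def Bop_def)
    qed
  qed (auto simp: finite_halfs halfs_uminus, simp add: halfs_def)
qed

lemma commutant_HA: "commutant m n HA \<subseteq> UA"
proof (rule specialization_subset[OF operator_algebra.axioms(1)[OF UA_algebra]
      operator_space_commutant[of HA] UA_sub_commutant])
  show "HA \<subseteq> endos m n" using HA_endos by auto
  show "k \<in> specialized m n UA"
    if "T \<in> commutant m n HA" "\<And>u w. u \<in> W \<Longrightarrow> w \<in> W \<Longrightarrow> spec1 (coef T u w) (k u w)" for T k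
    using that by (intro invariant_algebra.kinv_in[OF UA_invariant_algebra] spec_commutant_kinv)
qed

text \<open>A kernel invariant under \<open>perms\<close> is in particular \<open>kinv\<close>,
  hence a value at \<open>q = 1\<close> of some member of \<open>UA\<close>. The given operator
  commutes with that member, so the specialized kernels commute and \<open>double_commutant\<close>
  applies.\<close>

lemma commutant_UA: "commutant m n UA \<subseteq> HA"
proof (rule specialization_subset[OF operator_algebra.axioms(1)[OF HA_algebra]
      operator_space_commutant[of UA] HA_sub_commutant])
  show "UA \<subseteq> endos m n" using UA_endos by auto
  fix T k
  assume T: "T \<in> commutant m n UA" and k: "\<And>u w. u \<in> W \<Longrightarrow> w \<in> W \<Longrightarrow> spec1 (coef T u w) (k u w)"
  interpret kernel_algebra W "specialized m n HA"
    by (rule operator_algebra.kernel_algebra_specialized[OF HA_algebra])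
  show "k \<in> specialized m n HA"
  proof (rule double_commutant)
    fix C :: "int list \<Rightarrow> int list \<Rightarrow> rat" and u w
    assume C: "\<And>g u w. g \<in> perms \<Longrightarrow> u \<in> W \<Longrightarrow> w \<in> W \<Longrightarrow> C (g u) (g w) = C u w" and uw: "u \<in> W" "w \<in> W"
    have simple_reflC: "C (simple_refl i u) (simple_refl i w) = C u w" if i: "i < n" and "u \<in> W" "w \<in> W" for i u w
    proof -
      \<comment> \<open>Extended by the identity off \<open>W\<close> to be a permutation of
        \<open>W\<close>; being an involution, it has the same kernel as its inverse.\<close>
      define g where "g u = (if u \<in> W then simple_refl i u else u)" for u
      have gg: "g (g u) = u" for u using simple_refl_words[OF _ i] by (simp add: g_def)
      have "g permutes W"
        unfolding permutes_def by (metis gg g_def)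
      moreover have "(\<lambda>u w. of_bool (w = g u)) \<in> specialized m n HA"
      proof -
        have "\<forall>u\<in>W. \<forall>w\<in>W. spec1 (coef (hact_op m n (gen i)) u w) (of_bool (w = g u))"
          using spec_hop[OF _ i] by (simp add: g_def del: of_bool_eq_iff)
        then show ?thesis unfolding specialized_def using gen_HA[OF i] by blast
      qed
      moreover have "(\<lambda>u w. of_bool (g w = u)) = (\<lambda>u w. of_bool (w = g u) :: rat)"
        using gg by (auto simp: fun_eq_iff of_bool_def)
      ultimately have "g \<in> perms" by (simp add: perms_def)
      from C[OF this that(2,3)] show ?thesis using that by (simp add: g_def)
    qed
    have "kinv (halfs m) n C"
      unfolding kinv_def using simple_reflC[of 0] simple_reflC[of "Suc _"] n by (simp add: simple_refl_def)
    then have "C \<in> specialized m n UA" by (rule invariant_algebra.kinv_in[OF UA_invariant_algebra])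
    then obtain T' where T': "T' \<in> UA" "\<And>u w. u \<in> W \<Longrightarrow> w \<in> W \<Longrightarrow> spec1 (coef T' u w) (C u w)"
      by (auto simp: specialized_def)
    show "kmul W k C u w = kmul W C k u w"
    proof (rule spec_commute[OF _ k UA_endos[OF T'(1)] T'(2) _ uw])
      show "T \<in> endos m n" using T by (simp add: commutant_def)
      show "T (T' v) = T' (T v)" if "v \<in> tens m n" for v
        using T T'(1) that by (auto simp: commutant_def)
    qed
  qed
qed

end

theorem theoremH:
  fixes m n :: nat
  assumes "m \<ge> 1" and "n \<ge> 1"
  shows "Uq_act m n ` Hhf m = commutant m n (Hecke_act m n ` carrier (Hecke n))
       \<and> Hecke_act m n ` carrier (Hecke n) = commutant m n (Uq_act m n ` Hhf m)"
  unfolding Uq_image[OF assms(2)] Hecke_image[OF assms(2)]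
  using commutant_HA[OF assms(2)] commutant_UA[OF assms(2)]
    UA_sub_commutant[OF assms(2)] HA_sub_commutant[OF assms(2)]
  by blast

end
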